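(* Let $(X,\mathfrak A,\mathsf m)$ be a $\sigma$-finite, countably generated measure space and let $E\colon L^2(\mathsf m)\to(-\infty,\infty]$ be proper, convex and lower semicontinuous, with associated semigroup $T_\bullet\colon\overline{D(E)}\to L^2(\mathsf m)$, resolvent $J_\bullet\colon L^2(\mathsf m)\to L^2(\mathsf m)$ and generator $A$. Let $Q$ denote the metric projection of $L^2\oplus L^2$ onto $\overline{D(A)\times D(A)}$, and assume that $$Q(C_\le)\subset C_\le\qquad\text{and}\qquad Q(C_\alpha)\subset C_\alpha\quad\text{for all }\alpha\ge0.$$ (1) The following are equivalent: $T_\bullet$ satisfies either $(M_1)$ or $(M_1')$; $A$ satisfies $(A_7')$; $J_\bullet$ satisfies either $(M_1)$ or $(M_1')$; $E$ satisfies either $(E_7)$ or $(E_7')$. (2) The following are equivalent: $T_\bullet$ satisfies either $(M_2)$ or $(M_2')$; $A$ satisfies $(A_8')$; $J_\bullet$ satisfies either $(M_2)$ or $(M_2')$; $E$ satisfies either $(E_8)$ or $(E_8')$. (3) In particular, the following are equivalent: (i) $T_\bullet$ is sub-Markovian; (ii) $A$ is a Dirichlet operator; (iii) $J_\bullet$ is sub-Markovian; (iv) $E$ is a Dirichlet functional. (The conditions named here are those defined in the context.)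
   Context: $L^2=L^2(\mathsf m)$ is the real Lebesgue space; $D(E)=\{E<\infty\}$; proper means $D(E)\ne\emptyset$; $E^{\oplus2}(u,v)=E(u)+E(v)$ on $L^2\oplus L^2$. Associated objects: $A=\partial E$ is the convex subdifferential, $D(A)=\{f:A(f)\neq\emptyset\}$; the minimal section $A^\circ(f)$ is the element of least norm of the closed convex set $A(f)$, $f\in D(A)$. $J_\lambda=(I+\lambda A)^{-1}$ for $\lambda>0$ and $J_0$ is the metric projection onto $\overline{D(E)}$. $T_t\colon\overline{D(E)}\to L^2$ is the strongly continuous semigroup of non-expansive maps such that, for $f\in D(A)$, $t\mapsto T_t(f)$ is the unique Lipschitz solution of $\frac{d}{dt}T_t(f)\in-A(T_t(f))$ for a.e. $t>0$, $T_0(f)=f$. Sets: $C_\le=\{(u,v)\in L^2\oplus L^2:u\le v\text{ a.e.}\}$, $C_\alpha=\{(u,v)\in L^2\oplus L^2:|u-v|\le\alpha\text{ a.e.}\}$ for $\alpha\in[0,\infty]$; $P_\le,P_\alpha$ are the metric projections of $L^2\oplus L^2$ onto them. For a map $B\colon D\to L^2$, $D\subset L^2$, with $B^{\oplus2}(u,v)=(B(u),B(v))$ on $D\times D$: $(M_1)$ (order-preserving) $u\le v\Rightarrow B(u)\le B(v)$ for $u,v\in D$; $(M_1')$ $B^{\oplus2}((D\times D)\cap C_\le)\subset C_\le$; $(M_2)$ ($L^\infty$-non-expansive) $\|B(u)-B(v)\|_{L^\infty}\le\|u-v\|_{L^\infty}$ for $u,v\in D$ (the right-hand side may be $+\infty$);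 $(M_2')$ $B^{\oplus2}((D\times D)\cap C_\alpha)\subset C_\alpha$ for all $\alpha\ge0$; sub-Markovian: $(M_1)$ and $(M_2)$. A family of maps ($T_t$, $t\ge0$, or $J_\lambda$, $\lambda\ge0$) has one of these properties if every member has it. For $A$: $(A_7')$ $\langle (A^\circ w_1,A^\circ w_2)\,|\,w-P_\le(w)\rangle_{L^2\oplus L^2}\ge0$ for all $w=(w_1,w_2)\in D(A)\times D(A)$; $(A_8')$ the same with $P_\alpha$ in place of $P_\le$, for every $\alpha\ge0$. $A$ is a Dirichlet operator if it is maximal monotone and satisfies $(A_7')$ and $(A_8')$. For $E$: $(E_7)$ $E^{\oplus2}(P_\le w)\le E^{\oplus2}(w)$ for all $w\in L^2\oplus L^2$; $(E_7')$ for all $u,v\in D(E)$: $u\vee v,u\wedge v\in D(E)$ and $E(u\vee v)+E(u\wedge v)\le E(u)+E(v)$; $(E_8)$ $E^{\oplus2}(P_\alpha w)\le E^{\oplus2}(w)$ for all $w\in L^2\oplus L^2$, $\alpha\in[0,\infty]$; $(E_8')$ for all $u,v\in D(E)$ and $\alpha>0$: $H_\alpha(u,v),H_\alpha(v,u)\in D(E)$ and $E(H_\alpha(u,v))+E(H_\alpha(v,u))\le E(u)+E(v)$, where $H_\alpha(s,t)$ equals $t-\alpha$ if $s-t<-\alpha$, $s$ if $|s-t|\le\alpha$, $t+\alpha$ if $s-t>\alpha$. $E$ is a Dirichlet functional if it is proper, convex, lower semicontinuous and satisfies $(E_7)$ and $(E_8)$. *)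

theory Defs
  imports "HOL-Probability.Essential_Supremum"
begin

text \<open>
  Elements of \<open>L\<^sup>2(M)\<close> are represented by square-integrable functions, with equality almost
  everywhere in the role of equality; elements of \<open>L\<^sup>2 \<oplus> L\<^sup>2\<close> are pairs of such functions.
  A functional on \<open>L\<^sup>2(M)\<close> is a function on representatives that respects a.e.\ equality.
  Objects that are unique in \<open>L\<^sup>2(M)\<close> (projections, minimal sections) are determined up to a.e.\
  equality and are picked by a choice operator; every property stated of them below is
  invariant under a change of representative.
\<close>

section \<open>The Hilbert spaces\<close>

definition countably_generated_measure :: "'a measure \<Rightarrow> bool" where
  "countably_generated_measure M \<longleftrightarrow>
     (\<exists>G. countable G \<and> G \<subseteq> Pow (space M) \<and> sets M = sigma_sets (space M) G)"

definition L2 :: "'a measure \<Rightarrow> ('a \<Rightarrow> real) set" where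
  "L2 M = {f \<in> borel_measurable M. integrable M (\<lambda>x. (f x)\<^sup>2)}"

definition ae_eq :: "'a measure \<Rightarrow> ('a \<Rightarrow> real) \<Rightarrow> ('a \<Rightarrow> real) \<Rightarrow> bool" where
  "ae_eq M f g \<longleftrightarrow> (AE x in M. f x = g x)"

definition l2_inner :: "'a measure \<Rightarrow> ('a \<Rightarrow> real) \<Rightarrow> ('a \<Rightarrow> real) \<Rightarrow> real" where
  "l2_inner M f g = (LINT x|M. f x * g x)"

definition l2_norm :: "'a measure \<Rightarrow> ('a \<Rightarrow> real) \<Rightarrow> real" where
  "l2_norm M f = sqrt (l2_inner M f f)"

definition l2_dist :: "'a measure \<Rightarrow> ('a \<Rightarrow> real) \<Rightarrow> ('a \<Rightarrow> real) \<Rightarrow> real" where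
  "l2_dist M f g = l2_norm M (\<lambda>x. f x - g x)"

type_synonym 'a fun_pair = "('a \<Rightarrow> real) \<times> ('a \<Rightarrow> real)"

definition pair_diff :: "'a fun_pair \<Rightarrow> 'a fun_pair \<Rightarrow> 'a fun_pair" where
  "pair_diff w z = ((\<lambda>x. fst w x - fst z x), (\<lambda>x. snd w x - snd z x))"

definition l2sum_inner :: "'a measure \<Rightarrow> 'a fun_pair \<Rightarrow> 'a fun_pair \<Rightarrow> real" where
  "l2sum_inner M w z = l2_inner M (fst w) (fst z) + l2_inner M (snd w) (snd z)"

definition l2sum_dist :: "'a measure \<Rightarrow> 'a fun_pair \<Rightarrow> 'a fun_pair \<Rightarrow> real" where
  "l2sum_dist M w z = sqrt (l2sum_inner M (pair_diff w z) (pair_diff w z))"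

text \<open>Closure and metric projection, for an arbitrary (pseudo-)distance \<open>d\<close> on \<open>S\<close>.\<close>

definition closure_in :: "('b \<Rightarrow> 'b \<Rightarrow> real) \<Rightarrow> 'b set \<Rightarrow> 'b set \<Rightarrow> 'b set" where
  "closure_in d S C = {w \<in> S. \<forall>e>0. \<exists>c\<in>C. d w c < e}"

definition is_metric_projection :: "('b \<Rightarrow> 'b \<Rightarrow> real) \<Rightarrow> 'b set \<Rightarrow> 'b \<Rightarrow> 'b \<Rightarrow> bool" where
  "is_metric_projection d C w p \<longleftrightarrow> p \<in> C \<and> (\<forall>q\<in>C. d w p \<le> d w q)"

definition metric_projection :: "('b \<Rightarrow> 'b \<Rightarrow> real) \<Rightarrow> 'b set \<Rightarrow> 'b \<Rightarrow> 'b" where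
  "metric_projection d C w = (SOME p. is_metric_projection d C w p)"

section \<open>Functionals\<close>

definition l2_functional :: "'a measure \<Rightarrow> (('a \<Rightarrow> real) \<Rightarrow> ereal) \<Rightarrow> bool" where
  "l2_functional M E \<longleftrightarrow>
     (\<forall>f\<in>L2 M. E f \<noteq> -\<infinity>) \<and> (\<forall>f\<in>L2 M. \<forall>g\<in>L2 M. ae_eq M f g \<longrightarrow> E f = E g)"

definition eff_dom :: "'a measure \<Rightarrow> (('a \<Rightarrow> real) \<Rightarrow> ereal) \<Rightarrow> ('a \<Rightarrow> real) set" where
  "eff_dom M E = {f \<in> L2 M. E f < \<infinity>}"

definition eff_dom_closure :: "'a measure \<Rightarrow> (('a \<Rightarrow> real) \<Rightarrow> ereal) \<Rightarrow> ('a \<Rightarrow> real) set" where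
  "eff_dom_closure M E = closure_in (l2_dist M) (L2 M) (eff_dom M E)"

definition proper_functional :: "'a measure \<Rightarrow> (('a \<Rightarrow> real) \<Rightarrow> ereal) \<Rightarrow> bool" where
  "proper_functional M E \<longleftrightarrow> eff_dom M E \<noteq> {}"

definition convex_functional :: "'a measure \<Rightarrow> (('a \<Rightarrow> real) \<Rightarrow> ereal) \<Rightarrow> bool" where
  "convex_functional M E \<longleftrightarrow>
     (\<forall>f\<in>L2 M. \<forall>g\<in>L2 M. \<forall>t::real. 0 \<le> t \<and> t \<le> 1 \<longrightarrow>
        E (\<lambda>x. (1 - t) * f x + t * g x) \<le> ereal (1 - t) * E f + ereal t * E g)"

definition lsc_functional :: "'a measure \<Rightarrow> (('a \<Rightarrow> real) \<Rightarrow> ereal) \<Rightarrow> bool" where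
  "lsc_functional M E \<longleftrightarrow>
     (\<forall>f\<in>L2 M. \<forall>c::ereal. c < E f \<longrightarrow> (\<exists>d>0. \<forall>g\<in>L2 M. l2_dist M f g < d \<longrightarrow> c < E g))"

section \<open>Operators, resolvents and semigroups\<close>

text \<open>A multivalued operator is a map \<open>A\<close> into sets of functions, with \<open>A f = {}\<close> off its domain.\<close>

type_synonym 'a l2_op = "('a \<Rightarrow> real) \<Rightarrow> ('a \<Rightarrow> real) set"

definition op_dom :: "'a l2_op \<Rightarrow> ('a \<Rightarrow> real) set" where
  "op_dom A = {f. A f \<noteq> {}}"

definition subdifferential :: "'a measure \<Rightarrow> (('a \<Rightarrow> real) \<Rightarrow> ereal) \<Rightarrow> 'a l2_op" where
  "subdifferential M E f =
     {g \<in> L2 M. f \<in> eff_dom M E \<and>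
        (\<forall>h\<in>L2 M. E f + ereal (l2_inner M g (\<lambda>x. h x - f x)) \<le> E h)}"

definition minimal_section :: "'a measure \<Rightarrow> 'a l2_op \<Rightarrow> ('a \<Rightarrow> real) \<Rightarrow> ('a \<Rightarrow> real)" where
  "minimal_section M A f = (SOME g. g \<in> A f \<and> (\<forall>h\<in>A f. l2_norm M g \<le> l2_norm M h))"

definition monotone_operator :: "'a measure \<Rightarrow> 'a l2_op \<Rightarrow> bool" where
  "monotone_operator M A \<longleftrightarrow>
     op_dom A \<subseteq> L2 M \<and> (\<forall>f. A f \<subseteq> L2 M) \<and>
     (\<forall>f g. \<forall>f'\<in>A f. \<forall>g'\<in>A g. 0 \<le> l2_inner M (\<lambda>x. f' x - g' x) (\<lambda>x. f x - g x))"

definition maximal_monotone_operator :: "'a measure \<Rightarrow> 'a l2_op \<Rightarrow> bool" where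
  "maximal_monotone_operator M A \<longleftrightarrow>
     monotone_operator M A \<and>
     (\<forall>B. monotone_operator M B \<and> (\<forall>f. A f \<subseteq> B f) \<longrightarrow> B = A)"

text \<open>The multivalued operator \<open>I + \<lambda>A\<close>.\<close>

definition id_plus :: "real \<Rightarrow> 'a l2_op \<Rightarrow> 'a l2_op" where
  "id_plus l A f = {(\<lambda>x. f x + l * g x) | g. g \<in> A f}"

text \<open>
  \<open>J\<close> is the resolvent of \<open>E\<close>: for \<open>\<lambda> > 0\<close> its graph over \<open>L\<^sup>2\<close> is the inverse of the graph of
  \<open>I + \<lambda> \<partial>E\<close>, and \<open>J\<^sub>0\<close> is the metric projection onto the closure of the effective domain.
\<close>

definition resolvent_of ::
  "'a measure \<Rightarrow> (('a \<Rightarrow> real) \<Rightarrow> ereal) \<Rightarrow> (real \<Rightarrow> ('a \<Rightarrow> real) \<Rightarrow> ('a \<Rightarrow> real)) \<Rightarrow> bool" where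
  "resolvent_of M E J \<longleftrightarrow>
     (\<forall>l>0. \<forall>f\<in>L2 M. J l f \<in> L2 M \<and>
        (\<forall>g\<in>L2 M. ae_eq M g (J l f) \<longleftrightarrow> f \<in> id_plus l (subdifferential M E) g)) \<and>
     (\<forall>f\<in>L2 M. is_metric_projection (l2_dist M) (eff_dom_closure M E) f (J 0 f))"

definition has_l2_derivative ::
  "'a measure \<Rightarrow> (real \<Rightarrow> ('a \<Rightarrow> real)) \<Rightarrow> ('a \<Rightarrow> real) \<Rightarrow> real \<Rightarrow> bool" where
  "has_l2_derivative M u g t \<longleftrightarrow>
     ((\<lambda>s. l2_dist M (\<lambda>x. (u s x - u t x) / (s - t)) g) \<longlongrightarrow> 0) (at t)"

text \<open>Lipschitz solutions \<open>u : [0,\<infinity>) \<rightarrow> L\<^sup>2\<close> of \<open>u' \<in> -A(u)\<close> a.e., \<open>u(0) = f\<close>; the values of \<open>u\<close> at negative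
  times are irrelevant.\<close>

definition lipschitz_solution ::
  "'a measure \<Rightarrow> 'a l2_op \<Rightarrow> ('a \<Rightarrow> real) \<Rightarrow> (real \<Rightarrow> ('a \<Rightarrow> real)) \<Rightarrow> bool" where
  "lipschitz_solution M A f u \<longleftrightarrow>
     (\<forall>t\<ge>0. u t \<in> L2 M) \<and>
     ae_eq M (u 0) f \<and>
     (\<exists>L. \<forall>s\<ge>0. \<forall>t\<ge>0. l2_dist M (u s) (u t) \<le> L * \<bar>s - t\<bar>) \<and>
     (AE t in lborel. 0 < t \<longrightarrow>
        (\<exists>g\<in>L2 M. has_l2_derivative M u g t \<and> (\<lambda>x. - g x) \<in> A (u t)))"

definition semigroup_of ::
  "'a measure \<Rightarrow> (('a \<Rightarrow> real) \<Rightarrow> ereal) \<Rightarrow> (real \<Rightarrow> ('a \<Rightarrow> real) \<Rightarrow> ('a \<Rightarrow> real)) \<Rightarrow> bool" where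
  "semigroup_of M E T \<longleftrightarrow>
     (let D = eff_dom_closure M E; A = subdifferential M E in
        (\<forall>t\<ge>0. \<forall>f\<in>D. T t f \<in> D) \<and>
        (\<forall>f\<in>D. ae_eq M (T 0 f) f) \<and>
        (\<forall>s\<ge>0. \<forall>t\<ge>0. \<forall>f\<in>D. ae_eq M (T (s + t) f) (T s (T t f))) \<and>
        (\<forall>t\<ge>0. \<forall>f\<in>D. \<forall>g\<in>D. l2_dist M (T t f) (T t g) \<le> l2_dist M f g) \<and>
        (\<forall>f\<in>D. \<forall>t\<ge>0. ((\<lambda>s. l2_dist M (T s f) (T t f)) \<longlongrightarrow> 0) (at t within {0..})) \<and>
        (\<forall>f\<in>op_dom A. lipschitz_solution M A f (\<lambda>t. T t f) \<and>
           (\<forall>u. lipschitz_solution M A f u \<longrightarrow> (\<forall>t\<ge>0. ae_eq M (u t) (T t f)))))"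

section \<open>The order and the sup-norm constraint sets\<close>

definition C_le :: "'a measure \<Rightarrow> 'a fun_pair set" where
  "C_le M = {(u, v). u \<in> L2 M \<and> v \<in> L2 M \<and> (AE x in M. u x \<le> v x)}"

definition C_alpha :: "'a measure \<Rightarrow> ennreal \<Rightarrow> 'a fun_pair set" where
  "C_alpha M \<alpha> = {(u, v). u \<in> L2 M \<and> v \<in> L2 M \<and> (AE x in M. ennreal \<bar>u x - v x\<bar> \<le> \<alpha>)}"

definition P_le :: "'a measure \<Rightarrow> 'a fun_pair \<Rightarrow> 'a fun_pair" where
  "P_le M = metric_projection (l2sum_dist M) (C_le M)"

definition P_alpha :: "'a measure \<Rightarrow> ennreal \<Rightarrow> 'a fun_pair \<Rightarrow> 'a fun_pair" where
  "P_alpha M \<alpha> = metric_projection (l2sum_dist M) (C_alpha M \<alpha>)"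

section \<open>Conditions on maps\<close>

definition Linf_norm :: "'a measure \<Rightarrow> ('a \<Rightarrow> real) \<Rightarrow> ennreal" where
  "Linf_norm M f = esssup M (\<lambda>x. ennreal \<bar>f x\<bar>)"

text \<open>In the following, \<open>B\<close> is regarded as a map \<open>D \<rightarrow> L\<^sup>2\<close>.\<close>

definition cond_M1 ::
  "'a measure \<Rightarrow> ('a \<Rightarrow> real) set \<Rightarrow> (('a \<Rightarrow> real) \<Rightarrow> ('a \<Rightarrow> real)) \<Rightarrow> bool" where
  "cond_M1 M D B \<longleftrightarrow>
     (\<forall>u\<in>D. \<forall>v\<in>D. (AE x in M. u x \<le> v x) \<longrightarrow> (AE x in M. B u x \<le> B v x))"

definition cond_M1' ::
  "'a measure \<Rightarrow> ('a \<Rightarrow> real) set \<Rightarrow> (('a \<Rightarrow> real) \<Rightarrow> ('a \<Rightarrow> real)) \<Rightarrow> bool" where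
  "cond_M1' M D B \<longleftrightarrow> map_prod B B ` ((D \<times> D) \<inter> C_le M) \<subseteq> C_le M"

definition cond_M2 ::
  "'a measure \<Rightarrow> ('a \<Rightarrow> real) set \<Rightarrow> (('a \<Rightarrow> real) \<Rightarrow> ('a \<Rightarrow> real)) \<Rightarrow> bool" where
  "cond_M2 M D B \<longleftrightarrow>
     (\<forall>u\<in>D. \<forall>v\<in>D. Linf_norm M (\<lambda>x. B u x - B v x) \<le> Linf_norm M (\<lambda>x. u x - v x))"

definition cond_M2' ::
  "'a measure \<Rightarrow> ('a \<Rightarrow> real) set \<Rightarrow> (('a \<Rightarrow> real) \<Rightarrow> ('a \<Rightarrow> real)) \<Rightarrow> bool" where
  "cond_M2' M D B \<longleftrightarrow> (\<forall>\<alpha>. map_prod B B ` ((D \<times> D) \<inter> C_alpha M \<alpha>) \<subseteq> C_alpha M \<alpha>)"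

definition sub_Markovian ::
  "'a measure \<Rightarrow> ('a \<Rightarrow> real) set \<Rightarrow> (('a \<Rightarrow> real) \<Rightarrow> ('a \<Rightarrow> real)) \<Rightarrow> bool" where
  "sub_Markovian M D B \<longleftrightarrow> cond_M1 M D B \<and> cond_M2 M D B"

section \<open>Conditions on operators\<close>

definition cond_A7' :: "'a measure \<Rightarrow> 'a l2_op \<Rightarrow> bool" where
  "cond_A7' M A \<longleftrightarrow>
     (\<forall>w \<in> op_dom A \<times> op_dom A.
        0 \<le> l2sum_inner M (map_prod (minimal_section M A) (minimal_section M A) w)
              (pair_diff w (P_le M w)))"

definition cond_A8' :: "'a measure \<Rightarrow> 'a l2_op \<Rightarrow> bool" where
  "cond_A8' M A \<longleftrightarrow>
     (\<forall>\<alpha>. \<forall>w \<in> op_dom A \<times> op_dom A.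
        0 \<le> l2sum_inner M (map_prod (minimal_section M A) (minimal_section M A) w)
              (pair_diff w (P_alpha M \<alpha> w)))"

definition Dirichlet_operator :: "'a measure \<Rightarrow> 'a l2_op \<Rightarrow> bool" where
  "Dirichlet_operator M A \<longleftrightarrow> maximal_monotone_operator M A \<and> cond_A7' M A \<and> cond_A8' M A"

section \<open>Conditions on functionals\<close>

definition E_sum :: "(('a \<Rightarrow> real) \<Rightarrow> ereal) \<Rightarrow> 'a fun_pair \<Rightarrow> ereal" where
  "E_sum E w = E (fst w) + E (snd w)"

definition cond_E7 :: "'a measure \<Rightarrow> (('a \<Rightarrow> real) \<Rightarrow> ereal) \<Rightarrow> bool" where
  "cond_E7 M E \<longleftrightarrow> (\<forall>w \<in> L2 M \<times> L2 M. E_sum E (P_le M w) \<le> E_sum E w)"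

definition cond_E7' :: "'a measure \<Rightarrow> (('a \<Rightarrow> real) \<Rightarrow> ereal) \<Rightarrow> bool" where
  "cond_E7' M E \<longleftrightarrow>
     (\<forall>u\<in>eff_dom M E. \<forall>v\<in>eff_dom M E.
        (\<lambda>x. max (u x) (v x)) \<in> eff_dom M E \<and> (\<lambda>x. min (u x) (v x)) \<in> eff_dom M E \<and>
        E (\<lambda>x. max (u x) (v x)) + E (\<lambda>x. min (u x) (v x)) \<le> E u + E v)"

definition cond_E8 :: "'a measure \<Rightarrow> (('a \<Rightarrow> real) \<Rightarrow> ereal) \<Rightarrow> bool" where
  "cond_E8 M E \<longleftrightarrow> (\<forall>w \<in> L2 M \<times> L2 M. \<forall>\<alpha>. E_sum E (P_alpha M \<alpha> w) \<le> E_sum E w)"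

definition H_cut :: "real \<Rightarrow> real \<Rightarrow> real \<Rightarrow> real" where
  "H_cut \<alpha> s t = (if s - t < - \<alpha> then t - \<alpha> else if \<bar>s - t\<bar> \<le> \<alpha> then s else t + \<alpha>)"

definition cond_E8' :: "'a measure \<Rightarrow> (('a \<Rightarrow> real) \<Rightarrow> ereal) \<Rightarrow> bool" where
  "cond_E8' M E \<longleftrightarrow>
     (\<forall>u\<in>eff_dom M E. \<forall>v\<in>eff_dom M E. \<forall>\<alpha>>0.
        (\<lambda>x. H_cut \<alpha> (u x) (v x)) \<in> eff_dom M E \<and> (\<lambda>x. H_cut \<alpha> (v x) (u x)) \<in> eff_dom M E \<and>
        E (\<lambda>x. H_cut \<alpha> (u x) (v x)) + E (\<lambda>x. H_cut \<alpha> (v x) (u x)) \<le> E u + E v)"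

definition Dirichlet_functional :: "'a measure \<Rightarrow> (('a \<Rightarrow> real) \<Rightarrow> ereal) \<Rightarrow> bool" where
  "Dirichlet_functional M E \<longleftrightarrow>
     proper_functional M E \<and> convex_functional M E \<and> lsc_functional M E \<and> cond_E7 M E \<and> cond_E8 M E"

definition all_equivalent :: "bool list \<Rightarrow> bool" where
  "all_equivalent Ps \<longleftrightarrow> (\<forall>P\<in>set Ps. \<forall>Q\<in>set Ps. P \<longleftrightarrow> Q)"

end

theory Submission
  imports Defs
begin

text \<open>
  Both constraints ask that \<open>v - u\<close> takes values in a closed interval \<open>I\<close> containing \<open>0\<close>, so a single
  argument covers them; let \<open>C\<close> be the set of such pairs and \<open>P\<close> the projection onto it. If the energy
  of pairs decreases under \<open>P\<close>, then \<open>P J\<^sub>\<lambda> w\<close> is as good a minimizer as \<open>J\<^sub>\<lambda> w\<close> for \<open>w \<in> C\<close>, and the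
  subgradient inequality gives the condition on \<open>A\<^sup>\<circ>\<close>. If the resolvent preserves \<open>C\<close>, comparing the
  gradients of the Moreau envelope along two parallel segments shows that the energy decreases under
  the reflection \<open>2P - 1\<close>, hence, by convexity, under \<open>P\<close>. The condition on \<open>A\<^sup>\<circ>\<close> says that the distance
  to \<open>C\<close> does not increase along the flow. Finally, if the flow preserves \<open>C\<close> and \<open>z\<close> has finite energy,
  then the flow started at \<open>P z\<close>, which lies in the closed domain by the assumption on \<open>Q\<close>, stays at
  least as far from \<open>z\<close> as \<open>P z\<close>, and the evolution variational inequality yields \<open>E(P z) \<le> E(z)\<close>.
\<close>

section \<open>The space of square-integrable functions\<close>

text \<open>The energy may be infinite and has no gradient, so invariance of the resolvent cannot be
  read directly as a statement about slopes of \<open>E\<close>. The Moreau envelopes are finite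
  everywhere and have \<open>(f - J l f) / l\<close> as a subgradient at \<open>f\<close>, so a
  statement about \<open>J\<close> is one about their slopes. The reflection is the natural target
  there: the segment from \<open>v\<close> to its reflected value and the one from the reflected
  value of \<open>u\<close> to \<open>u\<close> are translations by the same \<open>\<phi>\<close>,
  and their difference stays equal to \<open>c (v - u)\<close>. For the two intervals the reflection
  is the pair of minimum and maximum, respectively the pair of \<open>H_cut\<close> functions, which
  accounts for the primed conditions on \<open>E\<close>. Along the flow, derivatives exist only
  almost everywhere and the distance to \<open>C\<close> is not visibly differentiable. It is
  bounded from above by the distance to a point frozen at the current time, with equality at that
  time, and the monotonicity lemma for real functions asks only for one-sided bounds on
  growth.\<close>

lemma L2_measurable: "f \<in> L2 M \<Longrightarrow> f \<in> borel_measurable M"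
  by (simp add: L2_def)

lemma L2_square_integrable: "f \<in> L2 M \<Longrightarrow> integrable M (\<lambda>x. (f x)\<^sup>2)"
  by (simp add: L2_def)

lemma L2_bounded_by_squares:
  assumes "f \<in> L2 M" "g \<in> L2 M" "h \<in> borel_measurable M"
    and "\<And>x. \<bar>h x\<bar> \<le> C * ((f x)\<^sup>2 + (g x)\<^sup>2)"
  shows "integrable M h"
proof (rule Bochner_Integration.integrable_bound)
  show "integrable M (\<lambda>x. C * ((f x)\<^sup>2 + (g x)\<^sup>2))"
    using assms(1,2) by (simp add: L2_def)
  show "AE x in M. norm (h x) \<le> norm (C * ((f x)\<^sup>2 + (g x)\<^sup>2))"
    using assms(4) by (intro AE_I2) (metis abs_ge_self order_trans real_norm_def)
qed (use assms in auto)

lemma L2_integrable_mult: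
  assumes "f \<in> L2 M" "g \<in> L2 M"
  shows "integrable M (\<lambda>x. f x * g x)"
proof (rule L2_bounded_by_squares[OF assms])
  show "\<bar>f x * g x\<bar> \<le> 1 * ((f x)\<^sup>2 + (g x)\<^sup>2)" for x
  proof -
    have "0 \<le> \<bar>f x\<bar> * \<bar>g x\<bar>" by simp
    moreover have "2 * \<bar>f x\<bar> * \<bar>g x\<bar> \<le> \<bar>f x\<bar>\<^sup>2 + \<bar>g x\<bar>\<^sup>2" by (rule sum_squares_bound)
    ultimately have "\<bar>f x\<bar> * \<bar>g x\<bar> \<le> \<bar>f x\<bar>\<^sup>2 + \<bar>g x\<bar>\<^sup>2" by linarith
    then show ?thesis by (simp add: abs_mult)
  qed
qed (use assms in \<open>auto intro: borel_measurable_times L2_measurable\<close>)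

lemma L2_zero [simp]: "(\<lambda>x. 0) \<in> L2 M"
  by (simp add: L2_def)

lemma L2_bound:
  assumes "f \<in> L2 M" "g \<in> borel_measurable M" "\<And>x. \<bar>g x\<bar> \<le> \<bar>f x\<bar>"
  shows "g \<in> L2 M"
  unfolding L2_def mem_Collect_eq
proof
  show "integrable M (\<lambda>x. (g x)\<^sup>2)"
    using assms(2,3) by (intro L2_bounded_by_squares[OF assms(1) L2_zero, of _ 1])
      (auto simp: abs_le_square_iff)
qed (use assms in auto)

lemma L2_add [simp]:
  assumes "f \<in> L2 M" "g \<in> L2 M"
  shows "(\<lambda>x. f x + g x) \<in> L2 M"
  using assms L2_integrable_mult[OF assms]
  by (auto simp: L2_def power2_sum mult.assoc)

lemma L2_cmult [simp]: "f \<in> L2 M \<Longrightarrow> (\<lambda>x. c * f x) \<in> L2 M"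
  by (auto simp: L2_def power_mult_distrib)

lemma L2_divide [simp]: "f \<in> L2 M \<Longrightarrow> (\<lambda>x. f x / c) \<in> L2 M"
  using L2_cmult[of f M "1 / c"] by simp

lemma L2_minus [simp]: "f \<in> L2 M \<Longrightarrow> (\<lambda>x. - f x) \<in> L2 M"
  using L2_cmult[of f M "-1"] by simp

lemma L2_diff [simp]: "f \<in> L2 M \<Longrightarrow> g \<in> L2 M \<Longrightarrow> (\<lambda>x. f x - g x) \<in> L2 M"
  using L2_add[of f M "\<lambda>x. - g x"] by simp

section \<open>Bilinearity and positivity of the inner product\<close>

lemma l2_inner_commute: "l2_inner M f g = l2_inner M g f"
  by (simp add: l2_inner_def mult.commute)

lemma l2_inner_add_left:
  "f \<in> L2 M \<Longrightarrow> g \<in> L2 M \<Longrightarrow> h \<in> L2 M \<Longrightarrow>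
    l2_inner M (\<lambda>x. f x + g x) h = l2_inner M f h + l2_inner M g h"
  by (simp add: l2_inner_def distrib_right L2_integrable_mult)

lemma l2_inner_diff_left:
  "f \<in> L2 M \<Longrightarrow> g \<in> L2 M \<Longrightarrow> h \<in> L2 M \<Longrightarrow>
    l2_inner M (\<lambda>x. f x - g x) h = l2_inner M f h - l2_inner M g h"
  by (simp add: l2_inner_def left_diff_distrib L2_integrable_mult)

lemma l2_inner_cmult_left: "l2_inner M (\<lambda>x. c * f x) h = c * l2_inner M f h"
  by (simp add: l2_inner_def mult.assoc)

lemma l2_inner_divide_left: "l2_inner M (\<lambda>x. f x / c) h = l2_inner M f h / c"
  using l2_inner_cmult_left[of M "1 / c" f h] by simp

lemma l2_inner_minus_left: "l2_inner M (\<lambda>x. - f x) h = - l2_inner M f h"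
  using l2_inner_cmult_left[of M "-1" f h] by simp

lemma l2_inner_add_right:
  "f \<in> L2 M \<Longrightarrow> g \<in> L2 M \<Longrightarrow> h \<in> L2 M \<Longrightarrow>
    l2_inner M h (\<lambda>x. f x + g x) = l2_inner M h f + l2_inner M h g"
  using l2_inner_add_left[of f M g h] by (simp add: l2_inner_commute[of M h])

lemma l2_inner_diff_right:
  "f \<in> L2 M \<Longrightarrow> g \<in> L2 M \<Longrightarrow> h \<in> L2 M \<Longrightarrow>
    l2_inner M h (\<lambda>x. f x - g x) = l2_inner M h f - l2_inner M h g"
  using l2_inner_diff_left[of f M g h] by (simp add: l2_inner_commute[of M h])

lemma l2_inner_cmult_right: "l2_inner M h (\<lambda>x. c * f x) = c * l2_inner M h f"
  using l2_inner_cmult_left[of M c f h] by (simp add: l2_inner_commute[of M h])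

lemma l2_inner_divide_right: "l2_inner M h (\<lambda>x. f x / c) = l2_inner M h f / c"
  using l2_inner_divide_left[of M f c h] by (simp add: l2_inner_commute[of M h])

lemma l2_inner_minus_right: "l2_inner M h (\<lambda>x. - f x) = - l2_inner M h f"
  using l2_inner_minus_left[of M f h] by (simp add: l2_inner_commute[of M h])

lemmas l2_inner_simps =
  l2_inner_add_left l2_inner_diff_left l2_inner_cmult_left l2_inner_divide_left l2_inner_minus_left
  l2_inner_add_right l2_inner_diff_right l2_inner_cmult_right l2_inner_divide_right
  l2_inner_minus_right

lemma l2_inner_nonneg [simp]: "0 \<le> l2_inner M f f"
  by (simp add: l2_inner_def)

lemma l2_inner_ge_0_AE: "(AE x in M. 0 \<le> f x * g x) \<Longrightarrow> 0 \<le> l2_inner M f g"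
  unfolding l2_inner_def by (rule integral_nonneg_AE)

lemma l2_inner_cong:
  assumes "ae_eq M f f'" "ae_eq M g g'" "f \<in> L2 M" "f' \<in> L2 M" "g \<in> L2 M" "g' \<in> L2 M"
  shows "l2_inner M f g = l2_inner M f' g'"
  unfolding l2_inner_def using assms
  by (intro integral_cong_AE) (auto simp: ae_eq_def L2_def)

lemma l2_inner_mono_square:
  assumes "f \<in> L2 M" "g \<in> L2 M" "AE x in M. \<bar>f x\<bar> \<le> \<bar>g x\<bar>"
  shows "l2_inner M f f \<le> l2_inner M g g"
  unfolding l2_inner_def
  using assms by (intro integral_mono_AE L2_integrable_mult)
    (auto simp: abs_le_square_iff power2_eq_square)

lemma l2_inner_self_eq_0:
  assumes "f \<in> L2 M" "l2_inner M f f = 0"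
  shows "AE x in M. f x = 0"
  using assms integral_nonneg_eq_0_iff_AE[of M "\<lambda>x. f x * f x"] L2_integrable_mult[of f M f]
  by (simp add: l2_inner_def)

lemma l2_norm_nonneg [simp]: "0 \<le> l2_norm M f"
  by (simp add: l2_norm_def)

lemma l2_norm_square: "(l2_norm M f)\<^sup>2 = l2_inner M f f"
  by (simp add: l2_norm_def)

lemma l2_norm_le_iff: "l2_norm M f \<le> l2_norm M g \<longleftrightarrow> l2_inner M f f \<le> l2_inner M g g"
  by (simp add: l2_norm_def)

lemma l2_norm_mono:
  "f \<in> L2 M \<Longrightarrow> g \<in> L2 M \<Longrightarrow> AE x in M. \<bar>f x\<bar> \<le> \<bar>g x\<bar> \<Longrightarrow> l2_norm M f \<le> l2_norm M g"
  by (simp add: l2_norm_le_iff l2_inner_mono_square)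

lemma l2_norm_cong:
  "ae_eq M f g \<Longrightarrow> f \<in> L2 M \<Longrightarrow> g \<in> L2 M \<Longrightarrow> l2_norm M f = l2_norm M g"
  by (simp add: l2_norm_def l2_inner_cong[of M f g f g])

lemma l2_norm_eq_0: "f \<in> L2 M \<Longrightarrow> l2_norm M f = 0 \<Longrightarrow> AE x in M. f x = 0"
  by (simp add: l2_norm_def l2_inner_self_eq_0)

lemma l2_norm_cmult: "l2_norm M (\<lambda>x. c * f x) = \<bar>c\<bar> * l2_norm M f"
  by (simp add: l2_norm_def l2_inner_cmult_left l2_inner_cmult_right real_sqrt_mult
      flip: mult.assoc)

lemma l2_Cauchy_Schwarz:
  assumes f: "f \<in> L2 M" and g: "g \<in> L2 M"
  shows "\<bar>l2_inner M f g\<bar> \<le> l2_norm M f * l2_norm M g"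
proof -
  let ?i = "l2_inner M f g" and ?a = "l2_inner M f f" and ?b = "l2_inner M g g"
  have *: "0 \<le> ?a - 2 * t * ?i + t\<^sup>2 * ?b" for t
  proof -
    have "0 \<le> l2_inner M (\<lambda>x. f x - t * g x) (\<lambda>x. f x - t * g x)" by simp
    also have "\<dots> = ?a - 2 * t * ?i + t\<^sup>2 * ?b"
      using f g by (simp add: l2_inner_simps l2_inner_commute[of M g f] power2_eq_square algebra_simps)
    finally show ?thesis .
  qed
  have "?i\<^sup>2 \<le> ?a * ?b"
  proof (cases "?b = 0")
    case True
    have "?i = 0"
    proof (rule ccontr)
      assume "?i \<noteq> 0"
      \<comment> \<open>With \<open>?b = 0\<close> the quadratic is affine in \<open>t\<close>; this
        \<open>t\<close> makes it equal to -1.\<close>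
      then show False using *[of "(?a + 1) / (2 * ?i)"] True by simp
    qed
    then show ?thesis using True by simp
  next
    case False
    then have "0 < ?b" by (simp add: order_less_le)
    moreover have "0 \<le> ?a - ?i\<^sup>2 / ?b"
      using *[of "?i / ?b"] \<open>0 < ?b\<close> by (simp add: power2_eq_square field_simps)
    ultimately show ?thesis by (simp add: field_simps)
  qed
  then have "sqrt (?i\<^sup>2) \<le> sqrt (?a * ?b)" by (rule real_sqrt_le_mono)
  then show ?thesis by (simp add: l2_norm_def real_sqrt_mult)
qed

lemma l2_norm_triangle:
  assumes f: "f \<in> L2 M" and g: "g \<in> L2 M"
  shows "l2_norm M (\<lambda>x. f x + g x) \<le> l2_norm M f + l2_norm M g"
proof (rule power2_le_imp_le)
  show "(l2_norm M (\<lambda>x. f x + g x))\<^sup>2 \<le> (l2_norm M f + l2_norm M g)\<^sup>2"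
    using f g l2_Cauchy_Schwarz[OF f g]
    by (simp add: l2_norm_square power2_sum l2_inner_simps l2_inner_commute[of M g f])
qed simp

lemma l2_norm_minus: "l2_norm M (\<lambda>x. - f x) = l2_norm M f"
  using l2_norm_cmult[of M "-1" f] by simp

lemma l2_norm_triangle_diff:
  "f \<in> L2 M \<Longrightarrow> g \<in> L2 M \<Longrightarrow> l2_norm M (\<lambda>x. f x - g x) \<le> l2_norm M f + l2_norm M g"
  using l2_norm_triangle[of f M "\<lambda>x. - g x"] by (simp add: l2_norm_minus)

section \<open>Distance, almost everywhere equality and convergence\<close>

lemma l2_dist_square: "(l2_dist M f g)\<^sup>2 = (LINT x|M. (f x - g x)\<^sup>2)"
  unfolding l2_dist_def l2_norm_square l2_inner_def by (simp add: power2_eq_square)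

lemma l2_dist_commute: "l2_dist M f g = l2_dist M g f"
  unfolding l2_dist_def using l2_norm_minus[of M "\<lambda>x. f x - g x"] by simp

lemma l2_dist_nonneg [simp]: "0 \<le> l2_dist M f g"
  by (simp add: l2_dist_def)

lemma l2_dist_self [simp]: "l2_dist M f f = 0"
  by (simp add: l2_dist_def l2_norm_def l2_inner_def)

lemma l2_dist_triangle:
  assumes "f \<in> L2 M" "g \<in> L2 M" "h \<in> L2 M"
  shows "l2_dist M f h \<le> l2_dist M f g + l2_dist M g h"
  using l2_norm_triangle[of "\<lambda>x. f x - g x" M "\<lambda>x. g x - h x"] assms by (simp add: l2_dist_def)

lemma l2_norm_dist_triangle:
  assumes "f \<in> L2 M" "g \<in> L2 M"
  shows "\<bar>l2_norm M f - l2_norm M g\<bar> \<le> l2_dist M f g"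
  using l2_norm_triangle[of "\<lambda>x. f x - g x" M g] l2_norm_triangle[of "\<lambda>x. g x - f x" M f] assms
    l2_dist_commute[of M f g]
  by (simp add: l2_dist_def)

lemma ae_eq_refl [simp]: "ae_eq M f f"
  by (simp add: ae_eq_def)

lemma ae_eq_sym: "ae_eq M f g \<Longrightarrow> ae_eq M g f"
  by (simp add: ae_eq_def eq_commute)

lemma l2_dist_cong:
  assumes "ae_eq M f f'" "ae_eq M g g'" "f \<in> L2 M" "f' \<in> L2 M" "g \<in> L2 M" "g' \<in> L2 M"
  shows "l2_dist M f g = l2_dist M f' g'"
proof -
  have "ae_eq M (\<lambda>x. f x - g x) (\<lambda>x. f' x - g' x)"
    using assms(1,2) by (auto simp: ae_eq_def)
  then show ?thesis
    using assms by (simp add: l2_dist_def l2_norm_cong)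
qed

lemma l2_dist_eq_0: "f \<in> L2 M \<Longrightarrow> g \<in> L2 M \<Longrightarrow> l2_dist M f g = 0 \<longleftrightarrow> ae_eq M f g"
  using l2_norm_eq_0[of "\<lambda>x. f x - g x" M] l2_dist_cong[of M f g g g]
  by (auto simp: l2_dist_def ae_eq_def)

lemma l2_inner_tendsto:
  assumes "\<forall>\<^sub>F n in F. f n \<in> L2 M" "g \<in> L2 M" "h \<in> L2 M" "((\<lambda>n. l2_dist M (f n) g) \<longlongrightarrow> 0) F"
  shows "((\<lambda>n. l2_inner M (f n) h) \<longlongrightarrow> l2_inner M g h) F"
proof -
  have "((\<lambda>n. l2_inner M (f n) h - l2_inner M g h) \<longlongrightarrow> 0) F"
  proof (rule Lim_null_comparison)
    show "\<forall>\<^sub>F n in F. norm (l2_inner M (f n) h - l2_inner M g h) \<le> l2_dist M (f n) g * l2_norm M h"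
      using assms(1)
    proof eventually_elim
      case (elim n)
      then show ?case
        using assms l2_Cauchy_Schwarz[of "\<lambda>x. f n x - g x" M h]
        by (simp add: l2_dist_def l2_inner_diff_left)
    qed
    show "((\<lambda>n. l2_dist M (f n) g * l2_norm M h) \<longlongrightarrow> 0) F"
      using tendsto_mult_right[OF assms(4), of "l2_norm M h"] by simp
  qed
  then show ?thesis by (rule LIM_zero_cancel)
qed

lemma l2_norm_tendsto:
  assumes "\<forall>\<^sub>F n in F. f n \<in> L2 M" "g \<in> L2 M" "((\<lambda>n. l2_dist M (f n) g) \<longlongrightarrow> 0) F"
  shows "((\<lambda>n. l2_norm M (f n)) \<longlongrightarrow> l2_norm M g) F"
proof -
  have "\<forall>\<^sub>F n in F. norm (l2_norm M (f n) - l2_norm M g) \<le> l2_dist M (f n) g"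
    using assms(1)
  proof eventually_elim
    case (elim n)
    then show ?case using l2_norm_dist_triangle[of "f n" M g] assms(2) by simp
  qed
  then have "((\<lambda>n. l2_norm M (f n) - l2_norm M g) \<longlongrightarrow> 0) F"
    using assms(3) by (rule Lim_null_comparison)
  then show ?thesis by (rule LIM_zero_cancel)
qed

text \<open>The triangle inequality is applied to the absolute values, so a pointwise bound by two
  terms becomes a bound in norm even without a linear identity behind it, as for the nonlinear
  projection below.\<close>

lemma l2_dist_le_sum:
  assumes "f \<in> L2 M" "g \<in> L2 M" "a \<in> L2 M" "b \<in> L2 M" "a' \<in> L2 M" "b' \<in> L2 M"
    and le: "\<And>x. \<bar>f x - g x\<bar> \<le> \<bar>a x - b x\<bar> + \<bar>a' x - b' x\<bar>"
  shows "l2_dist M f g \<le> l2_dist M a b + l2_dist M a' b'"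
proof -
  have abs: "(\<lambda>x. \<bar>h x\<bar>) \<in> L2 M" "l2_norm M (\<lambda>x. \<bar>h x\<bar>) = l2_norm M h" if "h \<in> L2 M" for h
    using L2_measurable[OF that] by (auto intro: L2_bound[OF that] simp: l2_norm_def l2_inner_def)
  have ab: "(\<lambda>x. a x - b x) \<in> L2 M" "(\<lambda>x. a' x - b' x) \<in> L2 M" using assms by auto
  have "l2_dist M f g \<le> l2_norm M (\<lambda>x. \<bar>a x - b x\<bar> + \<bar>a' x - b' x\<bar>)"
    unfolding l2_dist_def using le abs(1)[OF ab(1)] abs(1)[OF ab(2)] assms(1,2)
    by (intro l2_norm_mono AE_I2) auto
  also have "\<dots> \<le> l2_norm M (\<lambda>x. \<bar>a x - b x\<bar>) + l2_norm M (\<lambda>x. \<bar>a' x - b' x\<bar>)"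
    by (intro l2_norm_triangle abs(1) ab)
  also have "\<dots> = l2_dist M a b + l2_dist M a' b'"
    by (simp add: abs(2)[OF ab(1)] abs(2)[OF ab(2)] l2_dist_def)
  finally show ?thesis .
qed

lemma l2sum_dist_le_iff:
  "l2sum_dist M (u, v) (p, q) \<le> l2sum_dist M (u, v) (p', q') \<longleftrightarrow>
    (l2_dist M u p)\<^sup>2 + (l2_dist M v q)\<^sup>2 \<le> (l2_dist M u p')\<^sup>2 + (l2_dist M v q')\<^sup>2"
  by (simp add: l2sum_dist_def l2sum_inner_def pair_diff_def l2_dist_def l2_norm_square)

text \<open>Convergence of rapidly converging sequences suffices for the minimizing sequences below.\<close>

lemma L2_complete_fast:
  assumes f: "\<And>n. f n \<in> L2 M" and fast: "\<And>n. l2_dist M (f n) (f (Suc n)) \<le> C * (1 / 4) ^ n"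
  obtains g where "g \<in> L2 M" "(\<lambda>n. l2_dist M (f n) g) \<longlonglongrightarrow> 0"
proof -
  have [measurable]: "f n \<in> borel_measurable M" for n using f by (simp add: L2_def)
  define d where "d n x = f (Suc n) x - f n x" for n x
  have d: "d n \<in> L2 M" for n unfolding d_def[abs_def] using f by simp
  have [measurable]: "d n \<in> borel_measurable M" for n using d by (simp add: L2_def)
  have C0: "0 \<le> C" using order_trans[OF l2_dist_nonneg fast[of 0]] by simp
  have int_d: "(LINT x|M. (d n x)\<^sup>2) \<le> C\<^sup>2 * (1 / 16) ^ n" for n
  proof -
    have "(LINT x|M. (d n x)\<^sup>2) = (l2_dist M (f (Suc n)) (f n))\<^sup>2"
      by (simp add: d_def[abs_def] l2_dist_square)
    also have "\<dots> \<le> (C * (1 / 4) ^ n)\<^sup>2"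
      using fast[of n] by (intro power_mono) (simp_all add: l2_dist_commute)
    also have "\<dots> = C\<^sup>2 * (1 / 16) ^ n"
      by (simp add: power_mult_distrib power_divide power2_eq_square flip: power_mult_distrib[of 4 4])
    finally show ?thesis .
  qed
  \<comment> \<open>The weight \<open>4 ^ n\<close> leaves a summable series of integrals, since the
    squares decay like \<open>(1 / 16) ^ n\<close>, and it forces the pointwise increments below
    \<open>sqrt K * (1 / 2) ^ n\<close>.\<close>
  have nn_d: "(\<integral>\<^sup>+x. ennreal (4 ^ n * (d n x)\<^sup>2) \<partial>M) \<le> ennreal (C\<^sup>2 * (1 / 4) ^ n)" for n
  proof -
    have "(\<integral>\<^sup>+x. ennreal (4 ^ n * (d n x)\<^sup>2) \<partial>M) = ennreal (4 ^ n * (LINT x|M. (d n x)\<^sup>2))"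
      using L2_square_integrable[OF d[of n]] by (subst nn_integral_eq_integral) auto
    also have "\<dots> \<le> ennreal (4 ^ n * (C\<^sup>2 * (1 / 16) ^ n))"
      using int_d[of n] by (intro ennreal_leI mult_left_mono) auto
    also have "4 ^ n * (C\<^sup>2 * (1 / 16) ^ n) = C\<^sup>2 * (1 / 4 :: real) ^ n"
      by (simp add: power_mult_distrib[symmetric] mult.left_commute[of _ "C\<^sup>2"])
    finally show ?thesis .
  qed
  have "(\<integral>\<^sup>+x. (\<Sum>n. ennreal (4 ^ n * (d n x)\<^sup>2)) \<partial>M) = (\<Sum>n. \<integral>\<^sup>+x. ennreal (4 ^ n * (d n x)\<^sup>2) \<partial>M)"
    by (rule nn_integral_suminf) simp
  also have "\<dots> \<le> (\<Sum>n. ennreal (C\<^sup>2 * (1 / 4) ^ n))"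
    by (intro suminf_le nn_d) auto
  also have "\<dots> = ennreal (\<Sum>n. C\<^sup>2 * (1 / 4) ^ n)"
    by (rule suminf_ennreal2) (auto intro!: summable_mult summable_geometric)
  finally have "(\<integral>\<^sup>+x. (\<Sum>n. ennreal (4 ^ n * (d n x)\<^sup>2)) \<partial>M) \<noteq> \<infinity>"
    by (auto simp: top_unique)
  then have fin: "AE x in M. (\<Sum>n. ennreal (4 ^ n * (d n x)\<^sup>2)) \<noteq> \<infinity>"
    by (intro nn_integral_PInf_AE) auto
  \<comment> \<open>\<open>lim\<close> is total, so \<open>g\<close> is measurable although the
    limit is known to exist only almost everywhere.\<close>
  define g where "g x = lim (\<lambda>n. f n x)" for x
  have [measurable]: "g \<in> borel_measurable M" unfolding g_def[abs_def] by measurable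
  have lim: "AE x in M. (\<lambda>n. f n x) \<longlonglongrightarrow> g x"
    using fin
  proof eventually_elim
    case (elim x)
    have "summable (\<lambda>n. 4 ^ n * (d n x)\<^sup>2)"
      using elim by (intro summable_suminf_not_top) auto
    then have "Bseq (\<lambda>n. 4 ^ n * (d n x)\<^sup>2)"
      by (intro convergent_imp_Bseq convergentI[of _ 0] summable_LIMSEQ_zero)
    then obtain K where K: "K > 0" "\<And>n. norm (4 ^ n * (d n x)\<^sup>2) \<le> K"
      by (auto simp: Bseq_def)
    have "norm (d n x) \<le> sqrt K * (1 / 2) ^ n" for n
    proof -
      have four: "(2 ^ n)\<^sup>2 = (4 :: real) ^ n"
        using power_mult_distrib[of "2 :: real" 2 n] by (simp add: power2_eq_square)
      have "(2 ^ n * \<bar>d n x\<bar>)\<^sup>2 \<le> K"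
        using K(2)[of n] by (simp add: power_mult_distrib four)
      then have "2 ^ n * \<bar>d n x\<bar> \<le> sqrt K" by (rule real_le_rsqrt)
      then show ?thesis by (simp add: field_simps power_divide)
    qed
    then have "summable (\<lambda>n. d n x)"
      by (rule summable_comparison_test'[of "\<lambda>n. sqrt K * (1 / 2) ^ n" 0, rotated])
        (intro summable_mult summable_geometric, simp)
    then have "convergent (\<lambda>n. \<Sum>i<n. d i x)" by (simp add: summable_iff_convergent)
    then have "convergent (\<lambda>n. f n x - f 0 x)"
      by (simp add: d_def sum_lessThan_telescope[of "\<lambda>n. f n x"])
    then have "convergent (\<lambda>n. f n x)"
      using convergent_add[OF _ convergent_const[of "f 0 x"], of "\<lambda>n. f n x - f 0 x"] by simp
    then show ?case by (simp add: g_def convergent_LIMSEQ_iff)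
  qed
  have far: "l2_dist M (f n) (f (n + m)) \<le> 2 * C * (1 / 4) ^ n" for n m
  proof -
    have "l2_dist M (f n) (f (n + m)) \<le> C * (1 / 4) ^ n * (\<Sum>i<m. (1 / 4) ^ i)"
    proof (induction m)
      case (Suc m)
      have "l2_dist M (f n) (f (n + Suc m)) \<le> l2_dist M (f n) (f (n + m)) + l2_dist M (f (n + m)) (f (Suc (n + m)))"
        using l2_dist_triangle[OF f f f] by simp
      also have "\<dots> \<le> C * (1 / 4) ^ n * (\<Sum>i<m. (1 / 4) ^ i) + C * (1 / 4) ^ (n + m)"
        using Suc fast[of "n + m"] by linarith
      finally show ?case by (simp add: algebra_simps power_add)
    qed simp
    \<comment> \<open>The remainder term makes the bound by 2 inductive.\<close>
    moreover have "(\<Sum>i<m. (1 / 4 :: real) ^ i) + 2 * (1 / 4) ^ m \<le> 2"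
    proof (induction m)
      case (Suc m)
      have "0 \<le> (1 / 4 :: real) ^ m" by simp
      then show ?case using Suc unfolding sum.lessThan_Suc power_Suc by linarith
    qed simp
    then have "(\<Sum>i<m. (1 / 4 :: real) ^ i) \<le> 2"
      by (rule order_trans[rotated]) simp
    ultimately show ?thesis
      using mult_left_mono[of "\<Sum>i<m. (1 / 4 :: real) ^ i" 2 "C * (1 / 4) ^ n"] C0 by simp
  qed
  \<comment> \<open>Fatou's lemma, with \<open>f (n + m)\<close> tending to \<open>g\<close> as
    \<open>m\<close> grows.\<close>
  have nn_g: "(\<integral>\<^sup>+x. ennreal ((f n x - g x)\<^sup>2) \<partial>M) \<le> ennreal ((2 * C * (1 / 4) ^ n)\<^sup>2)" for n
  proof -
    have "(\<integral>\<^sup>+x. ennreal ((f n x - g x)\<^sup>2) \<partial>M)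
        = (\<integral>\<^sup>+x. liminf (\<lambda>m. ennreal ((f n x - f (n + m) x)\<^sup>2)) \<partial>M)"
    proof (rule nn_integral_cong_AE)
      show "AE x in M. ennreal ((f n x - g x)\<^sup>2) = liminf (\<lambda>m. ennreal ((f n x - f (n + m) x)\<^sup>2))"
        using lim
      proof eventually_elim
        case (elim x)
        have "(\<lambda>m. f (m + n) x) \<longlonglongrightarrow> g x" using elim by (rule LIMSEQ_ignore_initial_segment)
        then have "(\<lambda>m. ennreal ((f n x - f (n + m) x)\<^sup>2)) \<longlonglongrightarrow> ennreal ((f n x - g x)\<^sup>2)"
          by (auto simp: add.commute intro!: tendsto_intros)
        then show ?case by (rule lim_imp_Liminf[OF sequentially_bot, symmetric])
      qed
    qed
    also have "\<dots> \<le> liminf (\<lambda>m. \<integral>\<^sup>+x. ennreal ((f n x - f (n + m) x)\<^sup>2) \<partial>M)"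
      by (rule nn_integral_liminf) simp
    also have "\<dots> \<le> liminf (\<lambda>m. ennreal ((2 * C * (1 / 4) ^ n)\<^sup>2))"
    proof (intro Liminf_mono always_eventually allI)
      fix m
      have "(\<lambda>x. f n x - f (n + m) x) \<in> L2 M" using f by simp
      then have "(\<integral>\<^sup>+x. ennreal ((f n x - f (n + m) x)\<^sup>2) \<partial>M) = ennreal ((l2_dist M (f n) (f (n + m)))\<^sup>2)"
        by (subst nn_integral_eq_integral)
          (auto simp: L2_def l2_dist_square)
      also have "\<dots> \<le> ennreal ((2 * C * (1 / 4) ^ n)\<^sup>2)"
        using far by (intro ennreal_leI power_mono) auto
      finally show "(\<integral>\<^sup>+x. ennreal ((f n x - f (n + m) x)\<^sup>2) \<partial>M) \<le> ennreal ((2 * C * (1 / 4) ^ n)\<^sup>2)" .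
    qed
    also have "\<dots> = ennreal ((2 * C * (1 / 4) ^ n)\<^sup>2)" by (simp add: Liminf_const)
    finally show ?thesis .
  qed
  have fg: "(\<lambda>x. f n x - g x) \<in> L2 M" for n
    using nn_g[of n] by (auto simp: L2_def integrable_iff_bounded top_unique less_top[symmetric])
  have "(\<lambda>x. f 0 x - (f 0 x - g x)) \<in> L2 M"
    using L2_diff[OF f[of 0] fg[of 0]] .
  then have g: "g \<in> L2 M" by simp
  have "l2_dist M (f n) g \<le> 2 * C * (1 / 4) ^ n" for n
  proof -
    have "ennreal ((l2_dist M (f n) g)\<^sup>2) = (\<integral>\<^sup>+x. ennreal ((f n x - g x)\<^sup>2) \<partial>M)"
      using fg[of n] by (subst nn_integral_eq_integral)
        (auto simp: L2_def l2_dist_square)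
    also note nn_g
    finally have "(l2_dist M (f n) g)\<^sup>2 \<le> (2 * C * (1 / 4) ^ n)\<^sup>2" by simp
    then show ?thesis by (rule power2_le_imp_le) (use C0 in simp)
  qed
  moreover have "(\<lambda>n. 2 * C * (1 / 4) ^ n) \<longlonglongrightarrow> 0"
    by (intro tendsto_mult_right_zero LIMSEQ_power_zero) simp
  ultimately have "(\<lambda>n. l2_dist M (f n) g) \<longlonglongrightarrow> 0"
    by (intro Lim_null_comparison[of "\<lambda>n. l2_dist M (f n) g"] always_eventually) auto
  with g show thesis by (rule that)
qed

section \<open>Monotonicity from one-sided derivative bounds\<close>

text \<open>An exceptional null set is covered by an open set \<open>U\<close> of small measure; subtracting \<open>L\<close> times the
  measure of \<open>U\<close> up to the current point absorbs the possible growth there.\<close>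

lemma nonincreasing_if_AE_right_growth:
  fixes \<phi> :: "real \<Rightarrow> real"
  assumes ab: "a \<le> b"
    and lip: "\<And>r s. a \<le> r \<Longrightarrow> r \<le> s \<Longrightarrow> s \<le> b \<Longrightarrow> \<phi> s - \<phi> r \<le> L * (s - r)"
    and growth: "AE r in lborel. a < r \<longrightarrow> r < b \<longrightarrow>
      (\<forall>e>0. \<exists>d>0. \<forall>s. r < s \<longrightarrow> s < r + d \<longrightarrow> \<phi> s - \<phi> r \<le> e * (s - r))"
  shows "\<phi> b \<le> \<phi> a"
proof (rule field_le_epsilon)
  fix e' :: real assume "e' > 0"
  \<comment> \<open>\<open>K\<close> dominates the growth rate and the length of the interval, so
    that with \<open>e = e' / (2 * K)\<close> the two final error terms add up to at most
    \<open>e'\<close>.\<close>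
  define K where "K = max L 0 + (b - a) + 1"
  have K: "L \<le> K" "b - a \<le> K" "0 < K" using ab by (auto simp: K_def)
  define e where "e = e' / (2 * K)"
  have e: "0 < e" using \<open>e' > 0\<close> K by (simp add: e_def)
  from growth obtain N where N: "N \<in> null_sets lborel"
    and good: "\<And>r e. r \<notin> N \<Longrightarrow> a < r \<Longrightarrow> r < b \<Longrightarrow> e > 0 \<Longrightarrow>
      \<exists>d>0. \<forall>s. r < s \<longrightarrow> s < r + d \<longrightarrow> \<phi> s - \<phi> r \<le> e * (s - r)"
  proof (rule AE_E3)
    fix N assume N: "N \<in> null_sets lborel"
      "\<And>r. r \<in> space lborel - N \<Longrightarrow> a < r \<longrightarrow> r < b \<longrightarrow>
        (\<forall>e>0. \<exists>d>0. \<forall>s. r < s \<longrightarrow> s < r + d \<longrightarrow> \<phi> s - \<phi> r \<le> e * (s - r))"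
    show thesis by (rule that[OF N(1)]) (use N(2) in simp)
  qed
  \<comment> \<open>The endpoint \<open>a\<close> joins the exceptional set, because the growth
    hypothesis is silent there.\<close>
  have "{a} \<union> N \<in> null_sets lborel"
    by (rule null_sets.Un[OF finite_imp_null_set_lborel N]) simp
  then have N': "insert a N \<in> sets borel" "emeasure lborel (insert a N) = 0" by auto
  obtain U where U: "open U" "insert a N \<subseteq> U" "emeasure lborel (U - insert a N) < e"
    using outer_regular_lborel[OF N'(1) e] .
  have mU: "emeasure lborel U < e"
  proof -
    have "emeasure lborel U = emeasure lborel (insert a N \<union> (U - insert a N))"
      using U(2) by (intro arg_cong[of _ _ "emeasure lborel"]) auto
    also have "\<dots> \<le> emeasure lborel (insert a N) + emeasure lborel (U - insert a N)"
      using N'(1) U(1) by (intro emeasure_subadditive) auto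
    finally show ?thesis using U(3) N' by simp
  qed
  define m where "m s = measure lborel (U \<inter> {a..s})" for s
  have fin: "U \<inter> {a..s} \<in> fmeasurable lborel" for s
    by (rule fmeasurableI2[of "{a..s}"])
      (use U(1) in \<open>auto intro!: fmeasurableI simp: emeasure_lborel_Icc_eq\<close>)
  have m_mono: "m r \<le> m s" if "r \<le> s" for r s
    unfolding m_def using that fin U(1) by (intro measure_mono_fmeasurable) auto
  \<comment> \<open>Inside \<open>U\<close> the term \<open>K * m s\<close> grows at rate
    \<open>K\<close> and cancels the crude Lipschitz growth; outside \<open>U\<close>,
    \<open>e * (s - a)\<close> cancels the growth allowed by the hypothesis.\<close>
  define \<psi> where "\<psi> s = \<phi> s - K * m s - e * (s - a)" for s
  have step: "\<exists>d>0. \<forall>s. r < s \<longrightarrow> s < r + d \<longrightarrow> s \<le> b \<longrightarrow> \<psi> s \<le> \<psi> r" if r: "a \<le> r" "r < b" for r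
  proof (cases "r \<in> U")
    case True
    then obtain d where d: "d > 0" "\<And>s. dist s r < d \<Longrightarrow> s \<in> U" using U(1) by (auto simp: open_dist)
    have "\<psi> s \<le> \<psi> r" if s: "r < s" "s < r + d" "s \<le> b" for s
    proof -
      have sub: "{r<..s} \<subseteq> U" using d s by (auto simp: dist_real_def)
      have "m r + (s - r) = measure lborel (U \<inter> {a..r}) + measure lborel {r<..s}"
        using s by (simp add: m_def)
      also have "\<dots> = measure lborel ((U \<inter> {a..r}) \<union> {r<..s})"
      proof -
        have "{r<..s} \<in> fmeasurable lborel"
          by (rule fmeasurableI2[of "{r..s}"]) (auto intro!: fmeasurableI simp: emeasure_lborel_Icc_eq)
        moreover have "U \<inter> {a..r} \<inter> {r<..s} = {}" by auto
        ultimately show ?thesis using measure_Un3[OF fin[of r], of "{r<..s}"] by simp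
      qed
      also have "(U \<inter> {a..r}) \<union> {r<..s} = U \<inter> {a..s}" using sub r s by auto
      finally have "m s = m r + (s - r)" by (simp add: m_def)
      then have "K * m s = K * m r + K * (s - r)" by (simp add: distrib_left)
      moreover have "\<phi> s - \<phi> r \<le> K * (s - r)"
        using lip[of r s] r s K(1) mult_right_mono[OF K(1), of "s - r"] by linarith
      moreover have "e * (s - a) \<ge> e * (r - a)" using e s by (intro mult_left_mono) auto
      ultimately show ?thesis by (simp add: \<psi>_def algebra_simps)
    qed
    with d(1) show ?thesis by blast
  next
    case False
    then have "r \<notin> N" "a < r" using U(2) r by (auto simp: less_le)
    then obtain d where d: "d > 0" "\<And>s. r < s \<Longrightarrow> s < r + d \<Longrightarrow> \<phi> s - \<phi> r \<le> e * (s - r)"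
      using good[of r e] r e by blast
    have "\<psi> s \<le> \<psi> r" if s: "r < s" "s < r + d" for s
    proof -
      have "K * m r \<le> K * m s" using s m_mono[of r s] K(3) by simp
      then show ?thesis using d(2)[OF s] by (simp add: \<psi>_def algebra_simps)
    qed
    with d(1) show ?thesis by blast
  qed
  define S where "S = {t \<in> {a..b}. \<psi> t \<le> \<psi> a}"
  define t where "t = Sup S"
  have aS: "a \<in> S" using ab by (simp add: S_def)
  have bdd: "bdd_above S" by (rule bdd_aboveI[of _ b]) (simp add: S_def)
  have t: "a \<le> t" "t \<le> b"
    unfolding t_def
    by (rule cSup_upper[OF aS bdd], rule cSup_least) (use aS in \<open>auto simp: S_def\<close>)
  \<comment> \<open>\<open>\<phi>\<close> need not be continuous: the one-sided bound excludes an
    upward jump at the supremum, and the subtracted terms are monotone.\<close>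
  have tS: "t \<in> S"
  proof -
    have "\<psi> t \<le> \<psi> a + \<eta>" if "\<eta> > 0" for \<eta>
    proof -
      have "0 < \<eta> / K" using that K by simp
      then obtain s where s: "s \<in> S" "t - \<eta> / K < s"
        using less_cSup_iff[of S "t - \<eta> / K"] aS bdd by (auto simp: t_def)
      have st: "s \<le> t" using cSup_upper[OF s(1) bdd] by (simp add: t_def)
      have "\<phi> t - \<phi> s \<le> K * (t - s)"
        using lip[of s t] t s st mult_right_mono[OF K(1), of "t - s"] by (auto simp: S_def)
      also have "\<dots> \<le> \<eta>" using s(2) K(3) by (simp add: field_simps)
      finally have "\<phi> t \<le> \<phi> s + \<eta>" by simp
      moreover have "K * m s \<le> K * m t" using m_mono[OF st] K(3) by (intro mult_left_mono) auto
      moreover have "e * (s - a) \<le> e * (t - a)" using st e by (intro mult_left_mono) auto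
      moreover have "\<psi> s \<le> \<psi> a" using s by (simp add: S_def)
      ultimately show ?thesis by (simp add: \<psi>_def)
    qed
    then have "\<psi> t \<le> \<psi> a" by (rule field_le_epsilon)
    then show ?thesis using t by (simp add: S_def)
  qed
  have "t = b"
  proof (rule ccontr)
    assume "t \<noteq> b"
    with t have "t < b" by simp
    from step[OF t(1) this] obtain d where d: "d > 0" "\<And>s. t < s \<Longrightarrow> s < t + d \<Longrightarrow> s \<le> b \<Longrightarrow> \<psi> s \<le> \<psi> t"
      by blast
    define s where "s = min b (t + d / 2)"
    have s: "t < s" "s < t + d" "s \<le> b" using d(1) \<open>t < b\<close> by (auto simp: s_def)
    then have "\<psi> s \<le> \<psi> a" using d(2)[OF s] tS by (simp add: S_def)
    then have "s \<in> S" using s t by (simp add: S_def)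
    then have "s \<le> t" unfolding t_def by (rule cSup_upper[OF _ bdd])
    then show False using s by simp
  qed
  then have "\<psi> b \<le> \<psi> a" using tS by (simp add: S_def)
  moreover have "m b \<le> e"
  proof -
    have "emeasure lborel (U \<inter> {a..b}) \<le> emeasure lborel U"
      by (rule emeasure_mono) (use U(1) in auto)
    then have "emeasure lborel (U \<inter> {a..b}) \<le> ennreal e" using mU by simp
    then show ?thesis unfolding m_def measure_def using e by (simp add: enn2real_leI)
  qed
  moreover have "0 \<le> K * m a" using K(3) by (simp add: m_def)
  ultimately have "\<phi> b - \<phi> a \<le> K * m b + e * (b - a)" 
    by (simp add: \<psi>_def)
  also have "\<dots> \<le> K * e + e * K"
    using \<open>m b \<le> e\<close> K e by (intro add_mono mult_left_mono) auto
  also have "\<dots> = e'" using K(3) by (simp add: e_def)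
  finally show "\<phi> b \<le> \<phi> a + e'" by simp
qed

lemma nonincreasing_if_AE_derivative_le_0:
  fixes \<phi> :: "real \<Rightarrow> real"
  assumes "a \<le> b"
    and "\<And>r s. a \<le> r \<Longrightarrow> r \<le> s \<Longrightarrow> s \<le> b \<Longrightarrow> \<phi> s - \<phi> r \<le> L * (s - r)"
    and "AE r in lborel. a < r \<longrightarrow> r < b \<longrightarrow> (\<exists>D\<le>0. (\<phi> has_real_derivative D) (at r))"
  shows "\<phi> b \<le> \<phi> a"
  using assms(1,2)
proof (rule nonincreasing_if_AE_right_growth)
  show "AE r in lborel. a < r \<longrightarrow> r < b \<longrightarrow>
      (\<forall>e>0. \<exists>d>0. \<forall>s. r < s \<longrightarrow> s < r + d \<longrightarrow> \<phi> s - \<phi> r \<le> e * (s - r))"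
    using assms(3)
  proof eventually_elim
    case (elim r)
    show ?case
    proof (intro impI allI)
      fix e :: real assume "a < r" "r < b" "e > 0"
      then obtain D where D: "D \<le> 0" "((\<lambda>s. (\<phi> s - \<phi> r) / (s - r)) \<longlongrightarrow> D) (at r)"
        using elim by (auto simp: has_field_derivative_iff)
      have "\<forall>\<^sub>F s in at r. (\<phi> s - \<phi> r) / (s - r) < e"
        using order_tendstoD(2)[OF D(2), of e] D(1) \<open>e > 0\<close> by simp
      then obtain d where "d > 0" and d: "\<And>s. s \<noteq> r \<Longrightarrow> dist s r < d \<Longrightarrow> (\<phi> s - \<phi> r) / (s - r) < e"
        by (auto simp: eventually_at)
      have "\<phi> s - \<phi> r \<le> e * (s - r)" if "r < s" "s < r + d" for s
        using d[of s] that by (simp add: dist_real_def field_simps)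
      with \<open>d > 0\<close> show "\<exists>d>0. \<forall>s. r < s \<longrightarrow> s < r + d \<longrightarrow> \<phi> s - \<phi> r \<le> e * (s - r)" by blast
    qed
  qed
qed

section \<open>Energies and their subdifferentials\<close>

locale energy =
  fixes M :: "'a measure" and E :: "('a \<Rightarrow> real) \<Rightarrow> ereal"
  assumes functional: "l2_functional M E"
    and proper: "proper_functional M E"
    and convex: "convex_functional M E"
    and lsc: "lsc_functional M E"
begin

abbreviation "D \<equiv> eff_dom M E"
abbreviation "Dc \<equiv> eff_dom_closure M E"
abbreviation "A \<equiv> subdifferential M E"

text \<open>Real values allow linear arithmetic. Infinite energy is sent to 0, so inequalities for
  \<open>val\<close> are meaningful only on \<open>D\<close>.\<close>

definition val :: "('a \<Rightarrow> real) \<Rightarrow> real" where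
  "val f = real_of_ereal (E f)"

lemma D_L2: "f \<in> D \<Longrightarrow> f \<in> L2 M"
  by (simp add: eff_dom_def)

lemma E_not_MInf: "f \<in> L2 M \<Longrightarrow> E f \<noteq> -\<infinity>"
  using functional unfolding l2_functional_def by blast

lemma E_val: "f \<in> D \<Longrightarrow> E f = ereal (val f)"
  using E_not_MInf[of f] unfolding val_def eff_dom_def by (cases "E f") auto

lemma E_not_D: "f \<in> L2 M \<Longrightarrow> f \<notin> D \<Longrightarrow> E f = \<infinity>"
  by (auto simp: eff_dom_def)

lemma E_cong: "ae_eq M f g \<Longrightarrow> f \<in> L2 M \<Longrightarrow> g \<in> L2 M \<Longrightarrow> E f = E g"
  using functional unfolding l2_functional_def by blast

lemma D_cong: "f \<in> D \<Longrightarrow> ae_eq M f g \<Longrightarrow> g \<in> L2 M \<Longrightarrow> g \<in> D"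
  using E_cong[of f g] by (auto simp: eff_dom_def)

lemma Dc_L2: "f \<in> Dc \<Longrightarrow> f \<in> L2 M"
  by (simp add: eff_dom_closure_def closure_in_def)

lemma DcI: "f \<in> L2 M \<Longrightarrow> (\<And>e. e > 0 \<Longrightarrow> \<exists>g\<in>D. l2_dist M f g < e) \<Longrightarrow> f \<in> Dc"
  by (simp add: eff_dom_closure_def closure_in_def)

lemma DcD: "f \<in> Dc \<Longrightarrow> e > 0 \<Longrightarrow> \<exists>g\<in>D. l2_dist M f g < e"
  by (simp add: eff_dom_closure_def closure_in_def)

lemma D_Dc: "f \<in> D \<Longrightarrow> f \<in> Dc"
  by (rule DcI[OF D_L2]) (auto intro!: bexI[of _ f])

lemma Dc_cong:
  assumes "f \<in> Dc" "ae_eq M f g" "g \<in> L2 M"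
  shows "g \<in> Dc"
proof (rule DcI)
  fix e :: real assume "e > 0"
  then obtain h where h: "h \<in> D" "l2_dist M f h < e" using DcD assms(1) by blast
  moreover have "l2_dist M f h = l2_dist M g h"
    using assms Dc_L2 D_L2 h by (intro l2_dist_cong) auto
  ultimately show "\<exists>h\<in>D. l2_dist M g h < e" by auto
qed fact

text \<open>Neither summand can be -\<infinity>, so a finite bound on the sum makes both of them
  finite.\<close>

lemma E_sum_le_D:
  assumes "f \<in> L2 M" "g \<in> L2 M" "u \<in> D" "v \<in> D" "E f + E g \<le> E u + E v"
  shows "f \<in> D" "g \<in> D" "val f + val g \<le> val u + val v"
proof -
  have "E f + E g \<le> ereal (val u + val v)"
    using assms(5) by (simp add: E_val assms(3,4))
  then have "E f \<noteq> \<infinity> \<and> E g \<noteq> \<infinity>"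
    using E_not_MInf[OF assms(1)] E_not_MInf[OF assms(2)] by (cases "E f"; cases "E g"; simp)
  then show fg: "f \<in> D" "g \<in> D"
    using assms(1,2) by (auto simp: eff_dom_def)
  show "val f + val g \<le> val u + val v"
    using assms(5) by (simp add: E_val assms fg)
qed

lemma convexD:
  assumes "f \<in> D" "g \<in> D" "0 \<le> t" "t \<le> 1"
  shows "(\<lambda>x. (1 - t) * f x + t * g x) \<in> D"
    and "val (\<lambda>x. (1 - t) * f x + t * g x) \<le> (1 - t) * val f + t * val g"
proof -
  have "E (\<lambda>x. (1 - t) * f x + t * g x) \<le> ereal (1 - t) * E f + ereal t * E g"
    using convex assms D_L2 unfolding convex_functional_def by blast
  then have le: "E (\<lambda>x. (1 - t) * f x + t * g x) \<le> ereal ((1 - t) * val f + t * val g)"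
    using assms by (simp add: E_val)
  then show in_D: "(\<lambda>x. (1 - t) * f x + t * g x) \<in> D"
    using D_L2[OF assms(1)] D_L2[OF assms(2)] order_le_less_trans[OF le, of \<infinity>] by (simp add: eff_dom_def)
  show "val (\<lambda>x. (1 - t) * f x + t * g x) \<le> (1 - t) * val f + t * val g"
    using le by (simp add: E_val[OF in_D])
qed

lemma Dc_convex:
  assumes "f \<in> Dc" "g \<in> Dc" "0 \<le> t" "t \<le> 1"
  shows "(\<lambda>x. (1 - t) * f x + t * g x) \<in> Dc"
proof (rule DcI)
  show "(\<lambda>x. (1 - t) * f x + t * g x) \<in> L2 M" using assms Dc_L2 by simp
  fix e :: real assume "e > 0"
  obtain f' where f': "f' \<in> D" "l2_dist M f f' < e / 2" using DcD[OF assms(1), of "e / 2"] \<open>e > 0\<close> by auto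
  obtain g' where g': "g' \<in> D" "l2_dist M g g' < e / 2" using DcD[OF assms(2), of "e / 2"] \<open>e > 0\<close> by auto
  note L = Dc_L2[OF assms(1)] Dc_L2[OF assms(2)] D_L2[OF f'(1)] D_L2[OF g'(1)]
  have "l2_dist M (\<lambda>x. (1 - t) * f x + t * g x) (\<lambda>x. (1 - t) * f' x + t * g' x)
      = l2_norm M (\<lambda>x. (1 - t) * (f x - f' x) + t * (g x - g' x))"
    unfolding l2_dist_def by (intro arg_cong[of _ _ "l2_norm M"]) (auto simp: algebra_simps)
  also have "\<dots> \<le> l2_norm M (\<lambda>x. (1 - t) * (f x - f' x)) + l2_norm M (\<lambda>x. t * (g x - g' x))"
    using L by (intro l2_norm_triangle) auto
  also have "\<dots> = (1 - t) * l2_dist M f f' + t * l2_dist M g g'"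
    using assms by (simp add: l2_norm_cmult l2_dist_def)
  also have "\<dots> \<le> 1 * l2_dist M f f' + 1 * l2_dist M g g'"
    using assms by (intro add_mono mult_right_mono) auto
  also have "\<dots> < e" using f' g' by simp
  finally show "\<exists>h\<in>D. l2_dist M (\<lambda>x. (1 - t) * f x + t * g x) h < e"
    using convexD(1)[OF f'(1) g'(1) assms(3,4)] by blast
qed

text \<open>Test functions outside \<open>D\<close> have infinite energy, so the inequality has
  content only on \<open>D\<close> and can be stated over the reals.\<close>

lemma subdifferential_iff:
  "g \<in> A f \<longleftrightarrow> g \<in> L2 M \<and> f \<in> D \<and> (\<forall>h\<in>D. val f + l2_inner M g (\<lambda>x. h x - f x) \<le> val h)"
  (is "_ \<longleftrightarrow> ?R")
proof
  assume "g \<in> A f"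
  then have *: "g \<in> L2 M" "f \<in> D" "\<And>h. h \<in> L2 M \<Longrightarrow> E f + ereal (l2_inner M g (\<lambda>x. h x - f x)) \<le> E h"
    by (auto simp: subdifferential_def)
  then show ?R using *(3)[OF D_L2] by (simp add: E_val)
next
  assume R: ?R
  have "E f + ereal (l2_inner M g (\<lambda>x. h x - f x)) \<le> E h" if "h \<in> L2 M" for h
    using R that by (cases "h \<in> D") (auto simp: E_val E_not_D)
  with R show "g \<in> A f" by (auto simp: subdifferential_def)
qed

lemma A_L2: "g \<in> A f \<Longrightarrow> g \<in> L2 M"
  and A_D: "g \<in> A f \<Longrightarrow> f \<in> D"
  and A_le: "g \<in> A f \<Longrightarrow> h \<in> D \<Longrightarrow> val f + l2_inner M g (\<lambda>x. h x - f x) \<le> val h"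
  by (auto simp: subdifferential_iff)

lemma op_dom_D: "f \<in> op_dom A \<Longrightarrow> f \<in> D"
  by (auto simp: op_dom_def A_D)

lemma A_cong:
  assumes "g \<in> A f" "ae_eq M f f'" "f' \<in> L2 M" "ae_eq M g g'" "g' \<in> L2 M"
  shows "g' \<in> A f'"
proof -
  have L: "g \<in> L2 M" "f \<in> L2 M" using assms A_L2 A_D D_L2 by auto
  have f': "f' \<in> D" using assms A_D D_cong by blast
  have "val f' = val f" using E_cong[OF assms(2) L(2) assms(3)] by (simp add: val_def)
  moreover have "l2_inner M g' (\<lambda>x. h x - f' x) = l2_inner M g (\<lambda>x. h x - f x)" if "h \<in> D" for h
    using assms L D_L2[OF that] by (intro l2_inner_cong) (auto simp: ae_eq_def)
  ultimately show ?thesis using A_le[OF assms(1)] f' assms(5) by (simp add: subdifferential_iff)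
qed

lemma A_monotone:
  assumes "f' \<in> A f" "g' \<in> A g"
  shows "0 \<le> l2_inner M (\<lambda>x. f' x - g' x) (\<lambda>x. f x - g x)"
proof -
  note L = A_L2[OF assms(1)] A_L2[OF assms(2)] D_L2[OF A_D[OF assms(1)]] D_L2[OF A_D[OF assms(2)]]
  have "val f + l2_inner M f' (\<lambda>x. g x - f x) \<le> val g" "val g + l2_inner M g' (\<lambda>x. f x - g x) \<le> val f"
    using assms A_le A_D by blast+
  then show ?thesis using L by (simp add: l2_inner_simps)
qed

lemma monotone_A: "monotone_operator M A"
  unfolding monotone_operator_def using op_dom_D D_L2 A_L2 A_monotone by blast

lemma lscD:
  assumes "f \<in> L2 M" "c < E f"
  obtains d where "d > 0" "\<And>g. g \<in> L2 M \<Longrightarrow> l2_dist M f g < d \<Longrightarrow> c < E g"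
  using lsc assms unfolding lsc_functional_def by blast

text \<open>\<open>A f\<close> is closed and convex, and a minimizing sequence in it is Cauchy by
  the parallelogram identity.\<close>

lemma minimal_section_exists:
  assumes "f \<in> op_dom A"
  shows "\<exists>g. g \<in> A f \<and> (\<forall>h\<in>A f. l2_norm M g \<le> l2_norm M h)"
proof -
  let ?N = "(\<lambda>g. l2_inner M g g) ` A f"
  define m where "m = Inf ?N"
  have ne: "?N \<noteq> {}" using assms by (auto simp: op_dom_def)
  have bdd: "bdd_below ?N" by (rule bdd_belowI[of _ 0]) auto
  have m_le: "m \<le> l2_inner M g g" if "g \<in> A f" for g
    unfolding m_def using that by (intro cInf_lower bdd) auto
  \<comment> \<open>The rate makes the squared distances of consecutive terms at most
    \<open>4 * (1 / 16) ^ n\<close>, hence the distances at most \<open>2 * (1 / 4) ^ n\<close>, the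
    form that \<open>L2_complete_fast\<close> asks for.\<close>
  have "\<exists>g. g \<in> A f \<and> l2_inner M g g < m + (1 / 16) ^ n" for n :: nat
  proof -
    have "Inf ?N < m + (1 / 16) ^ n" by (simp add: m_def)
    then show ?thesis using cInf_less_iff[OF ne bdd] by auto
  qed
  then obtain g where g: "\<And>n. g n \<in> A f" "\<And>n. l2_inner M (g n) (g n) < m + (1 / 16) ^ n" by metis
  note gL = A_L2[OF g(1)]
  have mid: "(\<lambda>x. (h x + k x) / 2) \<in> A f" if "h \<in> A f" "k \<in> A f" for h k
    unfolding subdifferential_iff
  proof (intro conjI ballI)
    fix w assume w: "w \<in> D"
    have "val f + l2_inner M h (\<lambda>x. w x - f x) \<le> val w" "val f + l2_inner M k (\<lambda>x. w x - f x) \<le> val w"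
      using that w A_le by blast+
    then show "val f + l2_inner M (\<lambda>x. (h x + k x) / 2) (\<lambda>x. w x - f x) \<le> val w"
      using that w A_L2 D_L2 A_D by (simp add: l2_inner_divide_left l2_inner_add_left field_simps)
  qed (use that A_L2 A_D in auto)
  have fast: "l2_dist M (g n) (g (Suc n)) \<le> 2 * (1 / 4) ^ n" for n
  proof (rule power2_le_imp_le)
    have "m \<le> l2_inner M (\<lambda>x. (g n x + g (Suc n) x) / 2) (\<lambda>x. (g n x + g (Suc n) x) / 2)"
      using mid g(1) m_le by blast
    then have "4 * m \<le> l2_inner M (g n) (g n) + 2 * l2_inner M (g n) (g (Suc n)) + l2_inner M (g (Suc n)) (g (Suc n))"
      using gL by (simp add: l2_inner_simps l2_inner_commute[of M "g (Suc n)" "g n"])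
    moreover have "(l2_dist M (g n) (g (Suc n)))\<^sup>2
        = l2_inner M (g n) (g n) - 2 * l2_inner M (g n) (g (Suc n)) + l2_inner M (g (Suc n)) (g (Suc n))"
      using gL by (simp add: l2_dist_def l2_norm_square l2_inner_simps l2_inner_commute[of M "g (Suc n)" "g n"])
    moreover have "(1 / 16 :: real) ^ Suc n \<le> (1 / 16) ^ n" by simp
    ultimately have "(l2_dist M (g n) (g (Suc n)))\<^sup>2 \<le> 4 * (1 / 16) ^ n"
      using g(2)[of n] g(2)[of "Suc n"] by linarith
    also have "\<dots> = (2 * (1 / 4) ^ n)\<^sup>2"
      using power_mult_distrib[of "1 / 4 :: real" "1 / 4" n] by (simp add: power2_eq_square)
    finally show "(l2_dist M (g n) (g (Suc n)))\<^sup>2 \<le> (2 * (1 / 4) ^ n)\<^sup>2" .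
  qed simp
  obtain g' where g': "g' \<in> L2 M" "(\<lambda>n. l2_dist M (g n) g') \<longlonglongrightarrow> 0"
    using L2_complete_fast[OF gL fast] by blast
  \<comment> \<open>Closedness of \<open>A f\<close>: the subgradient inequality passes to the
    limit.\<close>
  have "val f + l2_inner M g' (\<lambda>x. w x - f x) \<le> val w" if "w \<in> D" for w
  proof (rule LIMSEQ_le_const2)
    show "(\<lambda>n. val f + l2_inner M (g n) (\<lambda>x. w x - f x)) \<longlonglongrightarrow> val f + l2_inner M g' (\<lambda>x. w x - f x)"
      using gL g' that D_L2 assms op_dom_D by (intro tendsto_add tendsto_const l2_inner_tendsto always_eventually allI) auto
    show "\<exists>N. \<forall>n\<ge>N. val f + l2_inner M (g n) (\<lambda>x. w x - f x) \<le> val w"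
      using A_le[OF g(1) that] by blast
  qed
  then have "g' \<in> A f" using g' assms op_dom_D by (simp add: subdifferential_iff)
  moreover have "l2_norm M g' \<le> l2_norm M h" if "h \<in> A f" for h
  proof -
    have "(\<lambda>n. (l2_norm M (g n))\<^sup>2) \<longlonglongrightarrow> (l2_norm M g')\<^sup>2"
      using gL g' by (intro tendsto_power l2_norm_tendsto always_eventually allI)
    moreover have "(\<lambda>n. m + (1 / 16) ^ n) \<longlonglongrightarrow> m + 0"
      by (intro tendsto_add tendsto_const LIMSEQ_power_zero) simp
    ultimately have "(l2_norm M g')\<^sup>2 \<le> m + 0"
      by (rule LIMSEQ_le) (use g(2) in \<open>auto simp: l2_norm_square intro: less_imp_le\<close>)
    then show ?thesis using m_le[OF that] by (simp add: l2_norm_le_iff l2_norm_square)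
  qed
  ultimately show ?thesis by blast
qed

lemma minimal_section_in: "f \<in> op_dom A \<Longrightarrow> minimal_section M A f \<in> A f"
  and minimal_section_le: "f \<in> op_dom A \<Longrightarrow> h \<in> A f \<Longrightarrow> l2_norm M (minimal_section M A f) \<le> l2_norm M h"
  using someI_ex[OF minimal_section_exists] unfolding minimal_section_def by blast+

text \<open>The hypothesis is the variational inequality of a least-norm element. For the chosen
  element \<open>h\<close>, whose norm is at most that of \<open>g\<close>, expanding the squared
  norm of \<open>g - h\<close> leaves at most 0.\<close>

lemma minimal_section_unique:
  assumes g: "g \<in> A f" and le: "\<And>h. h \<in> A f \<Longrightarrow> l2_inner M g g \<le> l2_inner M g h"
  shows "ae_eq M g (minimal_section M A f)"
proof -
  let ?h = "minimal_section M A f"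
  have f: "f \<in> op_dom A" using g by (auto simp: op_dom_def)
  note h = minimal_section_in[OF f]
  have "l2_inner M ?h ?h \<le> l2_inner M g g"
    using minimal_section_le[OF f g] by (simp add: l2_norm_le_iff)
  then have "l2_inner M (\<lambda>x. g x - ?h x) (\<lambda>x. g x - ?h x) \<le> 0"
    using le[OF h] A_L2[OF g] A_L2[OF h] by (simp add: l2_inner_simps l2_inner_commute[of M ?h g])
  then have "l2_inner M (\<lambda>x. g x - ?h x) (\<lambda>x. g x - ?h x) = 0"
    by (simp add: order_antisym)
  then have "AE x in M. g x - ?h x = 0"
    using A_L2[OF g] A_L2[OF h] by (intro l2_inner_self_eq_0) auto
  then show ?thesis by (simp add: ae_eq_def)
qed

end

section \<open>Resolvents\<close>

locale energy_resolvent = energy M E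
  for M :: "'a measure" and E +
  fixes J :: "real \<Rightarrow> ('a \<Rightarrow> real) \<Rightarrow> ('a \<Rightarrow> real)"
  assumes resolvent: "resolvent_of M E J"
begin

lemma J_L2: "l > 0 \<Longrightarrow> f \<in> L2 M \<Longrightarrow> J l f \<in> L2 M"
  using resolvent by (simp add: resolvent_of_def)

text \<open>This is the Yosida approximation. The defining equivalence is applied to the
  representative \<open>J l f\<close> itself.\<close>

lemma J_A:
  assumes "l > 0" "f \<in> L2 M"
  shows "(\<lambda>x. (f x - J l f x) / l) \<in> A (J l f)"
proof -
  have "f \<in> id_plus l A (J l f)"
    using resolvent assms J_L2 ae_eq_refl unfolding resolvent_of_def by blast
  then obtain g where g: "g \<in> A (J l f)" "f = (\<lambda>x. J l f x + l * g x)"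
    by (auto simp: id_plus_def)
  have "(f x - J l f x) / l = g x" for x
    using assms(1) fun_cong[OF g(2), of x] by (simp add: field_simps)
  then show ?thesis using g(1) by simp
qed

lemma J_op_dom: "l > 0 \<Longrightarrow> f \<in> L2 M \<Longrightarrow> J l f \<in> op_dom A"
  using J_A by (auto simp: op_dom_def)

lemma J_D: "l > 0 \<Longrightarrow> f \<in> L2 M \<Longrightarrow> J l f \<in> D"
  using J_op_dom op_dom_D by blast

lemma J_0: "f \<in> L2 M \<Longrightarrow> J 0 f \<in> Dc"
  and J_0_le: "f \<in> L2 M \<Longrightarrow> g \<in> Dc \<Longrightarrow> l2_dist M f (J 0 f) \<le> l2_dist M f g"
  using resolvent by (auto simp: resolvent_of_def is_metric_projection_def)

text \<open>The Moreau envelope, written with its minimizer \<open>J l f\<close> in place of an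
  infimum; its properties then come from subgradient inequalities at \<open>J l f\<close>.\<close>

definition moreau :: "real \<Rightarrow> ('a \<Rightarrow> real) \<Rightarrow> real" where
  "moreau l f = val (J l f) + (l2_dist M f (J l f))\<^sup>2 / (2 * l)"

text \<open>The subgradient inequality at \<open>J l f\<close>, tested with \<open>J l g\<close>, is
  combined with the nonnegativity of the squared norm of \<open>(f - J l f) - (g - J l g)\<close>,
  divided by \<open>2 * l\<close>.\<close>

lemma moreau_subgradient:
  assumes l: "l > 0" and f: "f \<in> L2 M" and g: "g \<in> L2 M"
  shows "moreau l f + l2_inner M (\<lambda>x. (f x - J l f x) / l) (\<lambda>x. g x - f x) \<le> moreau l g"
proof -
  define p where "p = J l f"
  define q where "q = J l g"
  have pq: "p \<in> L2 M" "q \<in> L2 M" using J_L2 l f g by (auto simp: p_def q_def)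
  have "val p + l2_inner M (\<lambda>x. (f x - p x) / l) (\<lambda>x. q x - p x) \<le> val q"
    unfolding p_def q_def using J_A J_D l f g by (intro A_le) auto
  then have 1: "val p + l2_inner M (\<lambda>x. f x - p x) (\<lambda>x. q x - p x) / l \<le> val q"
    by (simp add: l2_inner_divide_left)
  have "0 \<le> l2_inner M (\<lambda>x. (f x - p x) - (g x - q x)) (\<lambda>x. (f x - p x) - (g x - q x))"
    by simp
  also have "\<dots> = 2 * l2_inner M (\<lambda>x. f x - p x) (\<lambda>x. q x - p x)
      - 2 * l2_inner M (\<lambda>x. f x - p x) (\<lambda>x. g x - f x)
      + (l2_dist M g q)\<^sup>2 - (l2_dist M f p)\<^sup>2"
    unfolding l2_dist_def l2_norm_square using f g pq
    by (simp add: l2_inner_simps l2_inner_commute[of M p f] l2_inner_commute[of M g f]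
      l2_inner_commute[of M q f] l2_inner_commute[of M g p] l2_inner_commute[of M q p]
      l2_inner_commute[of M q g])
  finally have "0 \<le> (2 * l2_inner M (\<lambda>x. f x - p x) (\<lambda>x. q x - p x)
      - 2 * l2_inner M (\<lambda>x. f x - p x) (\<lambda>x. g x - f x)
      + (l2_dist M g q)\<^sup>2 - (l2_dist M f p)\<^sup>2) / (2 * l)"
    using l by simp
  also have "\<dots> = l2_inner M (\<lambda>x. f x - p x) (\<lambda>x. q x - p x) / l
      - l2_inner M (\<lambda>x. f x - p x) (\<lambda>x. g x - f x) / l
      + (l2_dist M g q)\<^sup>2 / (2 * l) - (l2_dist M f p)\<^sup>2 / (2 * l)"
    by (simp add: diff_divide_distrib add_divide_distrib)
  finally show ?thesis
    using 1 by (simp add: moreau_def l2_inner_divide_left flip: p_def q_def)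
qed

lemma moreau_le:
  assumes "l > 0" "f \<in> D"
  shows "moreau l f \<le> val f"
proof -
  have "val (J l f) + l2_inner M (\<lambda>x. (f x - J l f x) / l) (\<lambda>x. f x - J l f x) \<le> val f"
    using J_A D_L2 assms by (intro A_le) auto
  then have "val (J l f) + (l2_dist M f (J l f))\<^sup>2 / l \<le> val f"
    by (simp add: l2_inner_divide_left l2_dist_def l2_norm_square)
  moreover have "(l2_dist M f (J l f))\<^sup>2 / (2 * l) \<le> (l2_dist M f (J l f))\<^sup>2 / l"
    using assms(1) by (intro divide_left_mono) auto
  ultimately show ?thesis by (simp add: moreau_def)
qed

text \<open>An affine minorant of the energy, provided by any subgradient, bounds the Moreau envelopes.\<close>

lemma moreau_lower_bound:
  assumes f: "f \<in> L2 M"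
  obtains m where "\<And>l. 0 < l \<Longrightarrow> l \<le> 1 \<Longrightarrow> m + (l2_dist M f (J l f))\<^sup>2 / (4 * l) \<le> moreau l f"
proof -
  define g where "g = J 1 f"
  define z where "z = (\<lambda>x. (f x - g x) / 1)"
  have z: "z \<in> A g" using J_A[of 1 f] f unfolding z_def g_def by simp
  have L: "g \<in> L2 M" "z \<in> L2 M" using z A_D D_L2 A_L2 by auto
  define b where "b = l2_norm M z"
  show thesis
  proof (rule that)
    fix l :: real assume l: "0 < l" "l \<le> 1"
    define p where "p = J l f"
    have p: "p \<in> D" "p \<in> L2 M" using J_D J_L2 l f by (auto simp: p_def)
    define r where "r = l2_dist M f p"
    have "val g + l2_inner M z (\<lambda>x. p x - g x) \<le> val p" by (rule A_le[OF z p(1)])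
    moreover have "l2_inner M z (\<lambda>x. p x - g x) = l2_inner M z (\<lambda>x. f x - g x) - l2_inner M z (\<lambda>x. f x - p x)"
      using L p f by (simp add: l2_inner_simps)
    moreover have "l2_inner M z (\<lambda>x. f x - p x) \<le> b * r"
      using l2_Cauchy_Schwarz[of z M "\<lambda>x. f x - p x"] L p f by (auto simp: b_def r_def l2_dist_def)
    \<comment> \<open>Young's inequality, tuned to consume half of the quadratic term of the
      envelope; the other half controls the distance to \<open>J l f\<close>. The restriction to
      \<open>l \<le> 1\<close> makes the bound uniform in \<open>l\<close>.\<close>
    moreover have "b * r \<le> b\<^sup>2 + r\<^sup>2 / (4 * l)"
    proof -
      have "0 \<le> (r - 2 * l * b)\<^sup>2 / (4 * l)" using l by simp
      also have "\<dots> = r\<^sup>2 / (4 * l) - b * r + l * b\<^sup>2"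
        using l by (simp add: power2_eq_square field_simps)
      also have "\<dots> \<le> r\<^sup>2 / (4 * l) - b * r + 1 * b\<^sup>2"
        using l by (intro add_left_mono mult_right_mono) auto
      finally show ?thesis by simp
    qed
    moreover have "r\<^sup>2 / (2 * l) = r\<^sup>2 / (4 * l) + r\<^sup>2 / (4 * l)" by simp
    ultimately have "val g + l2_inner M z (\<lambda>x. f x - g x) - b\<^sup>2 + r\<^sup>2 / (4 * l) \<le> val p + r\<^sup>2 / (2 * l)"
      by linarith
    then show "val g + l2_inner M z (\<lambda>x. f x - g x) - b\<^sup>2 + (l2_dist M f (J l f))\<^sup>2 / (4 * l) \<le> moreau l f"
      by (simp add: moreau_def r_def p_def)
  qed
qed

text \<open>An upper bound on the envelopes against the lower bound just shown forces the squared
  distance below \<open>4 * l * (K - m)\<close>. This serves also for reflected functions, before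
  their energy is known to be finite.\<close>

lemma J_tendsto:
  assumes f: "f \<in> L2 M" and bound: "\<And>l. 0 < l \<Longrightarrow> l \<le> 1 \<Longrightarrow> moreau l f \<le> K"
  shows "((\<lambda>l. l2_dist M f (J l f)) \<longlongrightarrow> 0) (at_right 0)"
proof -
  obtain m where m: "\<And>l. 0 < l \<Longrightarrow> l \<le> 1 \<Longrightarrow> m + (l2_dist M f (J l f))\<^sup>2 / (4 * l) \<le> moreau l f"
    using moreau_lower_bound[OF f] by blast
  have "l2_dist M f (J l f) \<le> sqrt (4 * l * (K - m))" if "0 < l" "l \<le> 1" for l
  proof (rule real_le_rsqrt)
    have "(l2_dist M f (J l f))\<^sup>2 / (4 * l) \<le> K - m" using m[OF that] bound[OF that] by simp
    then show "(l2_dist M f (J l f))\<^sup>2 \<le> 4 * l * (K - m)" using that by (simp add: field_simps)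
  qed
  then have "\<forall>\<^sub>F l in at_right 0. norm (l2_dist M f (J l f)) \<le> sqrt (4 * l * (K - m))"
    by (auto simp: eventually_at_right_field intro!: exI[of _ 1])
  moreover have "((\<lambda>l. sqrt (4 * l * (K - m))) \<longlongrightarrow> sqrt (4 * 0 * (K - m))) (at_right 0)"
    by (intro tendsto_intros)
  then have "((\<lambda>l. sqrt (4 * l * (K - m))) \<longlongrightarrow> 0) (at_right 0)" by simp
  ultimately show ?thesis by (rule Lim_null_comparison)
qed

text \<open>A nearby \<open>h\<close> in \<open>D\<close> is replaced by \<open>J l h\<close>, which
  lies in the domain of \<open>A\<close> and is close to \<open>h\<close> for small
  \<open>l\<close>.\<close>

lemma op_dom_dense:
  assumes "f \<in> Dc" "e > 0"
  shows "\<exists>g\<in>op_dom A. l2_dist M f g < e"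
proof -
  obtain h where h: "h \<in> D" "l2_dist M f h < e / 2" using DcD[OF assms(1), of "e / 2"] assms by auto
  have "((\<lambda>l. l2_dist M h (J l h)) \<longlongrightarrow> 0) (at_right 0)"
    using h D_L2 moreau_le by (intro J_tendsto[of h "val h"]) auto
  then have "\<forall>\<^sub>F l in at_right 0. l2_dist M h (J l h) < e / 2"
    by (rule order_tendstoD) (use assms in simp)
  then have "\<forall>\<^sub>F l in at_right (0 :: real). 0 < l \<and> l2_dist M h (J l h) < e / 2"
    using eventually_at_right_less by (rule eventually_conj[rotated])
  then obtain l where l: "l > 0" "l2_dist M h (J l h) < e / 2"
    using eventually_happens'[OF trivial_limit_at_right_real] by blast
  have "l2_dist M f (J l h) < e"
    using l2_dist_triangle[of f M h "J l h"] h l assms Dc_L2 D_L2 J_L2 by force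
  then show ?thesis using J_op_dom[of l h] l h D_L2 by blast
qed

text \<open>Minty's argument: the range of \<open>I + A\<close> is everything.\<close>

lemma maximal_monotone_A: "maximal_monotone_operator M A"
  unfolding maximal_monotone_operator_def
proof (intro conjI allI impI monotone_A)
  fix B assume B: "monotone_operator M B \<and> (\<forall>f. A f \<subseteq> B f)"
  then have mono: "\<forall>f g. \<forall>f'\<in>B f. \<forall>g'\<in>B g. 0 \<le> l2_inner M (\<lambda>x. f' x - g' x) (\<lambda>x. f x - g x)"
    by (simp add: monotone_operator_def)
  have "g \<in> A f" if g: "g \<in> B f" for f g
  proof -
    have L: "f \<in> L2 M" "g \<in> L2 M" using B g by (auto simp: monotone_operator_def op_dom_def)
    define w where "w = (\<lambda>x. f x + g x)"
    have w: "w \<in> L2 M" using L by (simp add: w_def)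
    define h where "h = J 1 w"
    have h: "h \<in> L2 M" using J_L2[of 1 w] w by (simp add: h_def)
    have k: "(\<lambda>x. w x - h x) \<in> A h" using J_A[of 1 w] w by (simp add: h_def)
    then have "(\<lambda>x. w x - h x) \<in> B h" using B by blast
    then have "0 \<le> l2_inner M (\<lambda>x. g x - (w x - h x)) (\<lambda>x. f x - h x)"
      using mono g by auto
    \<comment> \<open>The choice of \<open>w\<close> makes the difference of the images the negative
      of the difference of the points, so monotonicity makes a square nonpositive.\<close>
    also have "(\<lambda>x. g x - (w x - h x)) = (\<lambda>x. - (f x - h x))" by (auto simp: w_def)
    finally have "l2_inner M (\<lambda>x. f x - h x) (\<lambda>x. f x - h x) \<le> 0"
      unfolding l2_inner_minus_left by simp
    then have "l2_inner M (\<lambda>x. f x - h x) (\<lambda>x. f x - h x) = 0" by (simp add: order_antisym)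
    then have "AE x in M. f x - h x = 0" using L h by (intro l2_inner_self_eq_0) auto
    then have eq: "ae_eq M h f" by (auto simp: ae_eq_def)
    then have "ae_eq M (\<lambda>x. w x - h x) g" by (auto simp: ae_eq_def w_def)
    then show "g \<in> A f" using A_cong[OF k eq L(1) _ L(2)] by blast
  qed
  then show "B = A" using B by blast
qed

end

section \<open>Pairs with constrained difference\<close>

text \<open>Both constraint sets have the form \<open>v - u \<in> I\<close> a.e.\ for a closed interval \<open>I\<close> containing \<open>0\<close>;
  \<open>c\<close> is the projection of \<open>\<real>\<close> onto \<open>I\<close>. With \<open>\<phi> = c (v - u) - (v - u)\<close>, the projection of \<open>(u, v)\<close> is
  \<open>(u - \<phi>/2, v + \<phi>/2)\<close> and the reflection is \<open>(u - \<phi>, v + \<phi>)\<close>.\<close>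

locale clamp =
  fixes I :: "real set" and c :: "real \<Rightarrow> real"
  assumes zero_in: "0 \<in> I"
    and clamp_in: "c d \<in> I"
    and clamp_variational: "i \<in> I \<Longrightarrow> 0 \<le> (d - c d) * (c d - i)"
    and clamp_measurable: "c \<in> borel_measurable borel"
begin

lemma abs_clamp_le: "\<bar>c d\<bar> \<le> \<bar>d\<bar>"
  using clamp_variational[OF zero_in, of d]
  by (smt (verit) mult_neg_pos mult_pos_neg)

lemma clamp_lipschitz: "\<bar>c d - c d'\<bar> \<le> \<bar>d - d'\<bar>"
  using clamp_variational[OF clamp_in, of d d'] clamp_variational[OF clamp_in, of d' d]
  by (smt (verit) mult_neg_pos mult_pos_neg)

lemma clamp_L2 [simp]:
  assumes "f \<in> L2 M"
  shows "(\<lambda>x. c (f x)) \<in> L2 M"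
  by (rule L2_bound[OF assms])
    (use measurable_compose[OF L2_measurable[OF assms] clamp_measurable] abs_clamp_le in auto)

lemma l2_clamp_variational:
  "AE x in M. k x \<in> I \<Longrightarrow> 0 \<le> l2_inner M (\<lambda>x. d x - c (d x)) (\<lambda>x. c (d x) - k x)"
  by (rule l2_inner_ge_0_AE) (auto simp: clamp_variational elim: AE_mp)

definition defect :: "('a \<Rightarrow> real) \<Rightarrow> ('a \<Rightarrow> real) \<Rightarrow> 'a \<Rightarrow> real" where
  "defect u v x = c (v x - u x) - (v x - u x)"

lemma defect_L2 [simp]: "u \<in> L2 M \<Longrightarrow> v \<in> L2 M \<Longrightarrow> defect u v \<in> L2 M"
  unfolding defect_def[abs_def] by simp

text \<open>Pointwise, \<open>d - c d\<close> and \<open>c d - k\<close> have the same sign, so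
  \<open>c d\<close> is the point of \<open>I\<close> nearest to \<open>d\<close>. The norm of the
  defect is thus the distance of \<open>v - u\<close> to the functions with values in
  \<open>I\<close>.\<close>

lemma defect_norm_le:
  assumes "u \<in> L2 M" "v \<in> L2 M" "k \<in> L2 M" "AE x in M. k x \<in> I"
  shows "l2_norm M (defect u v) \<le> l2_dist M (\<lambda>x. v x - u x) k"
  unfolding l2_dist_def
proof (rule l2_norm_mono)
  show "AE x in M. \<bar>defect u v x\<bar> \<le> \<bar>v x - u x - k x\<bar>"
    using assms(4)
  proof eventually_elim
    case (elim x)
    let ?d = "v x - u x"
    have "0 \<le> (?d - c ?d) * (c ?d - k x)" by (rule clamp_variational[OF elim])
    then have "0 \<le> ?d - c ?d \<and> 0 \<le> c ?d - k x \<or> ?d - c ?d \<le> 0 \<and> c ?d - k x \<le> 0"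
      by (simp add: zero_le_mult_iff)
    then show ?case by (auto simp: defect_def)
  qed
qed (use assms in auto)

definition proj1 where "proj1 u v = (\<lambda>x. u x - defect u v x / 2)"
definition proj2 where "proj2 u v = (\<lambda>x. v x + defect u v x / 2)"
definition refl1 where "refl1 u v = (\<lambda>x. u x - defect u v x)"
definition refl2 where "refl2 u v = (\<lambda>x. v x + defect u v x)"

lemma proj_refl_L2 [simp]:
  assumes "u \<in> L2 M" "v \<in> L2 M"
  shows "proj1 u v \<in> L2 M" "proj2 u v \<in> L2 M" "refl1 u v \<in> L2 M" "refl2 u v \<in> L2 M"
  using assms by (auto simp: proj1_def proj2_def refl1_def refl2_def)

lemma proj_diff: "proj2 u v x - proj1 u v x = c (v x - u x)"
  by (simp add: proj1_def proj2_def defect_def field_simps)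

text \<open>With \<open>d = v - u\<close> and \<open>\<phi> = c d - d\<close>, the product
  \<open>(d - c d) * (c d - k)\<close> equals \<open>(k - d - \<phi>) * \<phi>\<close>; the clamp
  inequality is integrated in this form.\<close>

lemma l2_defect_variational:
  assumes "u \<in> L2 M" "v \<in> L2 M" "k \<in> L2 M" "AE x in M. k x \<in> I"
  shows "l2_inner M (defect u v) (defect u v) \<le> l2_inner M (\<lambda>x. k x - (v x - u x)) (defect u v)"
proof -
  have "0 \<le> l2_inner M (\<lambda>x. (v x - u x) - c (v x - u x)) (\<lambda>x. c (v x - u x) - k x)"
    using assms(4) by (rule l2_clamp_variational)
  also have "\<dots> = l2_inner M (\<lambda>x. (k x - (v x - u x)) - defect u v x) (defect u v)"
    unfolding l2_inner_def by (rule Bochner_Integration.integral_cong) (auto simp: defect_def algebra_simps)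
  also have "\<dots> = l2_inner M (\<lambda>x. k x - (v x - u x)) (defect u v) - l2_inner M (defect u v) (defect u v)"
    using assms by (intro l2_inner_diff_left) auto
  finally show ?thesis by simp
qed

lemma defect_zero_in:
  assumes "u \<in> L2 M" "v \<in> L2 M" "l2_inner M (defect u v) (defect u v) \<le> 0"
  shows "AE x in M. v x - u x \<in> I"
proof -
  have "l2_inner M (defect u v) (defect u v) = 0" using assms(3) by (simp add: order_antisym)
  then have "AE x in M. defect u v x = 0" using assms by (intro l2_inner_self_eq_0) auto
  then show ?thesis
  proof eventually_elim
    case (elim x)
    then show ?case using clamp_in[of "v x - u x"] by (simp add: defect_def)
  qed
qed

text \<open>The variational inequality squeezes the squared defect below half of itself. The factor
  one half is what a comparison of distances gives for \<open>J 0\<close>; for positive parameters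
  the left side is even nonpositive.\<close>

lemma in_if_defect_small:
  assumes "u \<in> L2 M" "v \<in> L2 M" "k \<in> L2 M" "AE x in M. k x \<in> I"
    and "l2_inner M (\<lambda>x. k x - (v x - u x)) (defect u v) \<le> l2_inner M (defect u v) (defect u v) / 2"
  shows "AE x in M. v x - u x \<in> I"
  by (rule defect_zero_in[OF assms(1,2)]) (use l2_defect_variational[OF assms(1-4)] assms(5) in linarith)

section \<open>The constraint set and the metric projection onto it\<close>

definition constraint :: "'a measure \<Rightarrow> 'a fun_pair set" where
  "constraint M = {(u, v). u \<in> L2 M \<and> v \<in> L2 M \<and> (AE x in M. v x - u x \<in> I)}"

lemma proj_constraint: "u \<in> L2 M \<Longrightarrow> v \<in> L2 M \<Longrightarrow> (proj1 u v, proj2 u v) \<in> constraint M"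
  by (simp add: constraint_def proj_diff clamp_in)

text \<open>The correction \<open>(- \<phi> / 2, \<phi> / 2)\<close> is antisymmetric, so the cross
  term involves only the differences \<open>v - u\<close> and \<open>q - p\<close>, and its sign is
  the variational inequality for the defect.\<close>

lemma proj_pythagoras:
  assumes "u \<in> L2 M" "v \<in> L2 M" "(p, q) \<in> constraint M"
  shows "(l2_dist M u (proj1 u v))\<^sup>2 + (l2_dist M v (proj2 u v))\<^sup>2
    + ((l2_dist M (proj1 u v) p)\<^sup>2 + (l2_dist M (proj2 u v) q)\<^sup>2)
    \<le> (l2_dist M u p)\<^sup>2 + (l2_dist M v q)\<^sup>2"
proof -
  have pq: "p \<in> L2 M" "q \<in> L2 M" "AE x in M. q x - p x \<in> I" using assms(3) by (auto simp: constraint_def)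
  let ?f = "defect u v"
  have f: "?f \<in> L2 M" using assms by simp
  have "l2_inner M ?f ?f \<le> l2_inner M (\<lambda>x. (q x - p x) - (v x - u x)) ?f"
    using assms pq by (intro l2_defect_variational) auto
  then show ?thesis
    unfolding proj1_def proj2_def l2_dist_def l2_norm_square using assms pq f
    by (simp add: l2_inner_simps add_divide_distrib diff_divide_distrib
        l2_inner_commute[of M ?f u] l2_inner_commute[of M ?f v]
        l2_inner_commute[of M ?f p] l2_inner_commute[of M ?f q] l2_inner_commute[of M p u]
        l2_inner_commute[of M q v])
qed

lemma proj_is_metric_projection:
  assumes "u \<in> L2 M" "v \<in> L2 M"
  shows "is_metric_projection (l2sum_dist M) (constraint M) (u, v) (proj1 u v, proj2 u v)"
  unfolding is_metric_projection_def
proof (intro conjI ballI proj_constraint assms)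
  fix z assume "z \<in> constraint M"
  then obtain p q where z: "z = (p, q)" "(p, q) \<in> constraint M" by (cases z) auto
  then show "l2sum_dist M (u, v) (proj1 u v, proj2 u v) \<le> l2sum_dist M (u, v) z"
    unfolding z l2sum_dist_le_iff using proj_pythagoras[OF assms z(2)]
    by (smt (verit) zero_le_power2)
qed

text \<open>The choice operator may pick any minimizer; by \<open>proj_pythagoras\<close> every
  minimizer agrees almost everywhere with the explicit formula.\<close>

lemma metric_projection_constraint:
  assumes "u \<in> L2 M" "v \<in> L2 M"
  obtains p q where "metric_projection (l2sum_dist M) (constraint M) (u, v) = (p, q)"
    "p \<in> L2 M" "q \<in> L2 M" "ae_eq M p (proj1 u v)" "ae_eq M q (proj2 u v)"
proof -
  obtain p q where z: "metric_projection (l2sum_dist M) (constraint M) (u, v) = (p, q)"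
    by (cases "metric_projection (l2sum_dist M) (constraint M) (u, v)")
  have "is_metric_projection (l2sum_dist M) (constraint M) (u, v) (p, q)"
    unfolding z[symmetric] metric_projection_def
    by (rule someI, rule proj_is_metric_projection[OF assms])
  then have pq: "(p, q) \<in> constraint M"
    and "l2sum_dist M (u, v) (p, q) \<le> l2sum_dist M (u, v) (proj1 u v, proj2 u v)"
    using proj_constraint[OF assms] by (auto simp: is_metric_projection_def)
  then have "(l2_dist M (proj1 u v) p)\<^sup>2 + (l2_dist M (proj2 u v) q)\<^sup>2 \<le> 0"
    using proj_pythagoras[OF assms pq] unfolding l2sum_dist_le_iff by linarith
  then have "l2_dist M (proj1 u v) p = 0" "l2_dist M (proj2 u v) q = 0"
    by (simp_all add: sum_power2_le_zero_iff)
  moreover have L: "p \<in> L2 M" "q \<in> L2 M" using pq by (auto simp: constraint_def)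
  ultimately show thesis
    using assms by (intro that[OF z L]) (auto simp: l2_dist_eq_0 intro: ae_eq_sym)
qed

text \<open>The components are \<open>(u + v - c (v - u)) / 2\<close> and
  \<open>(u + v + c (v - u)) / 2\<close>, and \<open>c\<close> is 1-Lipschitz.\<close>

lemma proj_continuous:
  assumes "u \<in> L2 M" "v \<in> L2 M" "u' \<in> L2 M" "v' \<in> L2 M"
  shows "l2_dist M (proj1 u v) (proj1 u' v') \<le> l2_dist M u u' + l2_dist M v v'"
    and "l2_dist M (proj2 u v) (proj2 u' v') \<le> l2_dist M u u' + l2_dist M v v'"
proof -
  have "\<bar>proj1 u v x - proj1 u' v' x\<bar> \<le> \<bar>u x - u' x\<bar> + \<bar>v x - v' x\<bar>" for x
    using clamp_lipschitz[of "v x - u x" "v' x - u' x"]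
    by (simp add: proj1_def defect_def abs_if field_simps split: if_splits)
  moreover have "\<bar>proj2 u v x - proj2 u' v' x\<bar> \<le> \<bar>u x - u' x\<bar> + \<bar>v x - v' x\<bar>" for x
    using clamp_lipschitz[of "v x - u x" "v' x - u' x"]
    by (simp add: proj2_def defect_def abs_if field_simps split: if_splits)
  ultimately show "l2_dist M (proj1 u v) (proj1 u' v') \<le> l2_dist M u u' + l2_dist M v v'"
    "l2_dist M (proj2 u v) (proj2 u' v') \<le> l2_dist M u u' + l2_dist M v v'"
    using assms by (auto intro!: l2_dist_le_sum)
qed

end

section \<open>Energy, resolvent and generator under a constraint\<close>

locale constrained_resolvent = energy_resolvent M E J + clamp I c
  for M :: "'a measure" and E J I c
begin

definition energy_contracted :: bool where
  "energy_contracted \<longleftrightarrow> (\<forall>u\<in>L2 M. \<forall>v\<in>L2 M. E (proj1 u v) + E (proj2 u v) \<le> E u + E v)"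

text \<open>The interval form of \<open>cond_E7'\<close> and, for one fixed bound, of
  \<open>cond_E8'\<close>.\<close>

definition energy_reflected :: bool where
  "energy_reflected \<longleftrightarrow> (\<forall>u\<in>D. \<forall>v\<in>D. refl1 u v \<in> D \<and> refl2 u v \<in> D \<and>
     val (refl1 u v) + val (refl2 u v) \<le> val u + val v)"

definition invariant :: "('a \<Rightarrow> real) set \<Rightarrow> (('a \<Rightarrow> real) \<Rightarrow> 'a \<Rightarrow> real) \<Rightarrow> bool" where
  "invariant S B \<longleftrightarrow> (\<forall>u\<in>S. \<forall>v\<in>S. (AE x in M. v x - u x \<in> I) \<longrightarrow> (AE x in M. B v x - B u x \<in> I))"

text \<open>Since \<open>w - P w\<close> is \<open>(\<phi> / 2, - \<phi> / 2)\<close>, the inner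
  product in \<open>cond_A7'\<close> and \<open>cond_A8'\<close> is \<open>- 1 / 2\<close> times
  this one, hence the reversed sign.\<close>

definition generator_condition :: bool where
  "generator_condition \<longleftrightarrow> (\<forall>u\<in>op_dom A. \<forall>v\<in>op_dom A.
     l2_inner M (\<lambda>x. minimal_section M A v x - minimal_section M A u x) (defect u v) \<le> 0)"

lemma energy_contracted_D:
  assumes "energy_contracted" "u \<in> D" "v \<in> D"
  shows "proj1 u v \<in> D" "proj2 u v \<in> D" "val (proj1 u v) + val (proj2 u v) \<le> val u + val v"
  using E_sum_le_D[of "proj1 u v" "proj2 u v" u v] assms D_L2[OF assms(2)] D_L2[OF assms(3)]
  by (simp_all add: energy_contracted_def)

lemma energy_contracted_if_reflected:
  assumes "energy_reflected"
  shows "energy_contracted"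
  unfolding energy_contracted_def
proof (intro ballI)
  fix u v assume L: "u \<in> L2 M" "v \<in> L2 M"
  show "E (proj1 u v) + E (proj2 u v) \<le> E u + E v"
  proof (cases "u \<in> D \<and> v \<in> D")
    case True
    then have uv: "u \<in> D" "v \<in> D" and r: "refl1 u v \<in> D" "refl2 u v \<in> D"
      "val (refl1 u v) + val (refl2 u v) \<le> val u + val v"
      using assms by (auto simp: energy_reflected_def)
    have eq: "proj1 u v = (\<lambda>x. (1 - 1/2) * u x + 1/2 * refl1 u v x)"
      "proj2 u v = (\<lambda>x. (1 - 1/2) * v x + 1/2 * refl2 u v x)"
      by (auto simp: proj1_def proj2_def refl1_def refl2_def field_simps)
    have "proj1 u v \<in> D" "proj2 u v \<in> D"
      "val (proj1 u v) \<le> (1 - 1/2) * val u + 1/2 * val (refl1 u v)"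
      "val (proj2 u v) \<le> (1 - 1/2) * val v + 1/2 * val (refl2 u v)"
      unfolding eq by (intro convexD uv r; simp)+
    then show ?thesis using r uv by (simp add: E_val)
  next
    case False
    then have top: "E u + E v = \<infinity>" using L E_not_MInf by (auto simp: E_not_D)
    show ?thesis unfolding top by simp
  qed
qed

text \<open>The subgradient inequalities at the resolvents \<open>p\<close>, \<open>q\<close> are
  tested with the projection of \<open>(p, q)\<close>. Contraction removes the energies, and what
  remains is that \<open>(v - u) - (q - p)\<close> has nonpositive inner product with the
  defect.\<close>

lemma resolvent_invariant_if_contracted_pos:
  assumes "energy_contracted" and l: "l > 0"
  shows "invariant (L2 M) (J l)"
  unfolding invariant_def
proof (intro ballI impI)
  fix u v assume L: "u \<in> L2 M" "v \<in> L2 M" and I: "AE x in M. v x - u x \<in> I"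
  define p where "p = J l u"
  define q where "q = J l v"
  have pq: "p \<in> D" "q \<in> D" using J_D l L by (auto simp: p_def q_def)
  have pqL: "p \<in> L2 M" "q \<in> L2 M" using pq D_L2 by auto
  let ?f = "defect p q"
  have f: "?f \<in> L2 M" using pqL by simp
  note contr = energy_contracted_D[OF assms(1) pq]
  have "val p + l2_inner M (\<lambda>x. (u x - p x) / l) (\<lambda>x. proj1 p q x - p x) \<le> val (proj1 p q)"
    unfolding p_def by (rule A_le[OF J_A[OF l L(1)]]) (use contr in \<open>simp add: p_def\<close>)
  moreover have "val q + l2_inner M (\<lambda>x. (v x - q x) / l) (\<lambda>x. proj2 p q x - q x) \<le> val (proj2 p q)"
    unfolding q_def by (rule A_le[OF J_A[OF l L(2)]]) (use contr in \<open>simp add: q_def\<close>)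
  ultimately have "l2_inner M (\<lambda>x. (u x - p x) / l) (\<lambda>x. proj1 p q x - p x)
      + l2_inner M (\<lambda>x. (v x - q x) / l) (\<lambda>x. proj2 p q x - q x) \<le> 0"
    using contr(3) by linarith
  moreover have "(\<lambda>x. proj1 p q x - p x) = (\<lambda>x. (- 1 / 2) * ?f x)" "(\<lambda>x. proj2 p q x - q x) = (\<lambda>x. (1 / 2) * ?f x)"
    by (auto simp: proj1_def proj2_def)
  ultimately have "(l2_inner M (\<lambda>x. v x - q x) ?f - l2_inner M (\<lambda>x. u x - p x) ?f) / (2 * l) \<le> 0"
    by (simp only: l2_inner_divide_left l2_inner_cmult_right) (simp add: diff_divide_distrib mult.commute)
  then have "l2_inner M (\<lambda>x. v x - q x) ?f - l2_inner M (\<lambda>x. u x - p x) ?f \<le> 0"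
    using l by (simp add: divide_le_0_iff)
  then have "l2_inner M (\<lambda>x. (v x - u x) - (q x - p x)) ?f \<le> 0"
    using L pqL f by (simp add: l2_inner_simps)
  also have "0 \<le> l2_inner M ?f ?f / 2" by simp
  finally show "AE x in M. J l v x - J l u x \<in> I"
    using in_if_defect_small[OF pqL _ I] L unfolding p_def q_def by simp
qed

lemma proj_Dc:
  assumes "energy_contracted" "u \<in> Dc" "v \<in> Dc"
  shows "proj1 u v \<in> Dc" "proj2 u v \<in> Dc"
proof -
  note L = Dc_L2[OF assms(2)] Dc_L2[OF assms(3)]
  have ex: "\<exists>u'\<in>D. \<exists>v'\<in>D. l2_dist M (proj1 u v) (proj1 u' v') < e \<and> l2_dist M (proj2 u v) (proj2 u' v') < e"
    if "e > 0" for e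
  proof -
    obtain u' where u': "u' \<in> D" "l2_dist M u u' < e / 2"
      using DcD[OF assms(2), of "e / 2"] \<open>e > 0\<close> by auto
    obtain v' where v': "v' \<in> D" "l2_dist M v v' < e / 2"
      using DcD[OF assms(3), of "e / 2"] \<open>e > 0\<close> by auto
    have "l2_dist M (proj1 u v) (proj1 u' v') < e" "l2_dist M (proj2 u v) (proj2 u' v') < e"
      using proj_continuous[OF L D_L2[OF u'(1)] D_L2[OF v'(1)]] u' v' by auto
    then show ?thesis using u' v' by blast
  qed
  show "proj1 u v \<in> Dc" "proj2 u v \<in> Dc"
    using ex energy_contracted_D[OF assms(1)] L by (auto intro!: DcI; meson)+
qed

text \<open>\<open>J 0\<close> comes with no subgradient. Instead the distances of \<open>u\<close>
  and \<open>v\<close> to \<open>p\<close> and \<open>q\<close> are compared with those to the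
  projection of \<open>(p, q)\<close>, which stays in the closed domain; expanding the squares
  leaves half of the squared defect.\<close>

lemma resolvent_invariant_if_contracted_0:
  assumes "energy_contracted"
  shows "invariant (L2 M) (J 0)"
  unfolding invariant_def
proof (intro ballI impI)
  fix u v assume L: "u \<in> L2 M" "v \<in> L2 M" and I: "AE x in M. v x - u x \<in> I"
  define p where "p = J 0 u"
  define q where "q = J 0 v"
  have pq: "p \<in> Dc" "q \<in> Dc" using J_0 L by (auto simp: p_def q_def)
  note pqL = Dc_L2[OF pq(1)] Dc_L2[OF pq(2)]
  let ?f = "defect p q"
  have f: "?f \<in> L2 M" using pqL by simp
  have "l2_dist M u p \<le> l2_dist M u (proj1 p q)" "l2_dist M v q \<le> l2_dist M v (proj2 p q)"
    unfolding p_def q_def using proj_Dc[OF assms pq] J_0_le L by (auto simp: p_def q_def)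
  then have "l2_inner M (\<lambda>x. u x - p x) (\<lambda>x. u x - p x)
      \<le> l2_inner M (\<lambda>x. u x - proj1 p q x) (\<lambda>x. u x - proj1 p q x)"
    "l2_inner M (\<lambda>x. v x - q x) (\<lambda>x. v x - q x)
      \<le> l2_inner M (\<lambda>x. v x - proj2 p q x) (\<lambda>x. v x - proj2 p q x)"
    by (auto simp: l2_dist_def l2_norm_le_iff)
  then have "l2_inner M (\<lambda>x. (v x - u x) - (q x - p x)) ?f \<le> l2_inner M ?f ?f / 2"
    using L pqL f unfolding proj1_def proj2_def
    by (simp add: l2_inner_simps add_divide_distrib diff_divide_distrib
        l2_inner_commute[of M ?f u] l2_inner_commute[of M ?f v]
        l2_inner_commute[of M ?f p] l2_inner_commute[of M ?f q] l2_inner_commute[of M p u]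
        l2_inner_commute[of M q v])
  then show "AE x in M. J 0 v x - J 0 u x \<in> I"
    using in_if_defect_small[OF pqL _ I] L unfolding p_def q_def by simp
qed

lemma generator_condition_if_contracted:
  assumes "energy_contracted"
  shows "generator_condition"
  unfolding generator_condition_def
proof (intro ballI)
  fix u v assume uv: "u \<in> op_dom A" "v \<in> op_dom A"
  note uvD = op_dom_D[OF uv(1)] op_dom_D[OF uv(2)]
  note L = D_L2[OF uvD(1)] D_L2[OF uvD(2)]
  let ?a = "minimal_section M A u" and ?b = "minimal_section M A v"
  note ab = minimal_section_in[OF uv(1)] minimal_section_in[OF uv(2)]
  note abL = A_L2[OF ab(1)] A_L2[OF ab(2)]
  note contr = energy_contracted_D[OF assms uvD]
  have "val u + l2_inner M ?a (\<lambda>x. proj1 u v x - u x) \<le> val (proj1 u v)"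
    "val v + l2_inner M ?b (\<lambda>x. proj2 u v x - v x) \<le> val (proj2 u v)"
    using ab contr by (auto intro: A_le)
  then have "l2_inner M ?a (\<lambda>x. proj1 u v x - u x) + l2_inner M ?b (\<lambda>x. proj2 u v x - v x) \<le> 0"
    using contr(3) by linarith
  then show "l2_inner M (\<lambda>x. ?b x - ?a x) (defect u v) \<le> 0"
    using L abL by (simp add: proj1_def proj2_def l2_inner_simps)
qed

text \<open>\<open>P\<close> leads from \<open>v\<close> to \<open>refl2 u v\<close> and
  \<open>R\<close> from \<open>refl1 u v\<close> to \<open>u\<close>, both by adding multiples of
  the same defect, so \<open>P s - R s\<close> is always \<open>c (v - u)\<close>. Invariance of
  \<open>J l\<close> orders the slopes of the envelope along the two segments, and integrating the
  slopes compares the increments.\<close>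

lemma moreau_reflected:
  assumes J: "invariant (L2 M) (J l)" and l: "l > 0" and L: "u \<in> L2 M" "v \<in> L2 M"
  shows "moreau l (refl1 u v) + moreau l (refl2 u v) \<le> moreau l u + moreau l v"
proof -
  let ?f = "defect u v"
  define a where "a g = (\<lambda>x. (g x - J l g x) / l)" for g
  define P where "P s = (\<lambda>x. v x + s * ?f x)" for s
  define R where "R s = (\<lambda>x. refl1 u v x + s * ?f x)" for s
  have f: "?f \<in> L2 M" using L by simp
  have PR: "P s \<in> L2 M" "R s \<in> L2 M" for s using L f by (auto simp: P_def R_def)
  have aL: "a g \<in> L2 M" if "g \<in> L2 M" for g using that J_L2 l by (simp add: a_def)
  have le: "l2_inner M (a (P s)) ?f \<le> l2_inner M (a (R s)) ?f" for s
  proof -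
    have diff: "P s x - R s x = c (v x - u x)" for x
      by (simp add: P_def R_def refl1_def defect_def)
    then have "AE x in M. P s x - R s x \<in> I" by (simp add: clamp_in)
    then have "AE x in M. J l (P s) x - J l (R s) x \<in> I"
      using J PR unfolding invariant_def by blast
    \<comment> \<open>In the difference of the Yosida approximations the points contribute
      \<open>c (v - u)\<close> and the resolvents an element of \<open>I\<close>; the sign is the
      clamp inequality at \<open>v - u\<close>.\<close>
    then have "AE x in M. 0 \<le> (a (R s) x - a (P s) x) * ?f x"
    proof eventually_elim
      case (elim x)
      have "a (R s) x - a (P s) x = ((J l (P s) x - J l (R s) x) - c (v x - u x)) / l"
        unfolding diff[symmetric] a_def by (simp add: diff_divide_distrib)
      then have "(a (R s) x - a (P s) x) * ?f x
        = ((v x - u x) - c (v x - u x)) * (c (v x - u x) - (J l (P s) x - J l (R s) x)) / l"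
        by (simp add: defect_def algebra_simps)
      then show ?case using clamp_variational[OF elim] l by simp
    qed
    then have "0 \<le> l2_inner M (\<lambda>x. a (R s) x - a (P s) x) ?f" by (rule l2_inner_ge_0_AE)
    then show ?thesis using aL PR f by (simp add: l2_inner_diff_left)
  qed
  define b where "b s = l2_inner M (a (R s)) ?f" for s
  have stepP: "moreau l (P s) - t * l2_inner M (a (P s)) ?f \<le> moreau l (P (s - t))" for s t
  proof -
    have "moreau l (P s) + l2_inner M (a (P s)) (\<lambda>x. P (s - t) x - P s x) \<le> moreau l (P (s - t))"
      unfolding a_def by (rule moreau_subgradient[OF l PR(1) PR(1)])
    also have "(\<lambda>x. P (s - t) x - P s x) = (\<lambda>x. - t * ?f x)" by (auto simp: P_def algebra_simps)
    finally show ?thesis unfolding l2_inner_cmult_right by simp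
  qed
  have stepR: "moreau l (R s) + t * b s \<le> moreau l (R (s + t))" for s t
  proof -
    have "moreau l (R s) + l2_inner M (a (R s)) (\<lambda>x. R (s + t) x - R s x) \<le> moreau l (R (s + t))"
      unfolding a_def by (rule moreau_subgradient[OF l PR(2) PR(2)])
    also have "(\<lambda>x. R (s + t) x - R s x) = (\<lambda>x. t * ?f x)" by (auto simp: R_def algebra_simps)
    finally show ?thesis unfolding l2_inner_cmult_right b_def by simp
  qed
  \<comment> \<open>Riemann sums replace the integral: increments along \<open>P\<close> are bounded
    above by the slope at the right end of a step, increments along \<open>R\<close> below by the
    slope at the left end. The errors telescope to \<open>(b 1 - b 0) * t\<close>.\<close>
  have disc: "moreau l (P 1) - moreau l (P 0) \<le> moreau l (R 1) - moreau l (R 0) + (b 1 - b 0) / Suc n" for n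
  proof -
    define t where "t = 1 / real (Suc n)"
    have t: "t > 0" by (simp add: t_def)
    have "moreau l (P (k * t)) - moreau l (P 0)
        \<le> moreau l (R (k * t)) - moreau l (R 0) + (b (k * t) - b 0) * t" for k :: nat
    proof (induction k)
      case (Suc k)
      define s where "s = real k * t"
      have s: "real (Suc k) * t = s + t" by (simp add: s_def algebra_simps)
      have "moreau l (P (s + t)) - t * l2_inner M (a (P (s + t))) ?f \<le> moreau l (P s)"
        using stepP[of "s + t" t] by simp
      moreover have "t * l2_inner M (a (P (s + t))) ?f \<le> t * b (s + t)"
        unfolding b_def using le t by (intro mult_left_mono) auto
      ultimately show ?case
        using Suc stepR[of s t] unfolding s s_def[symmetric] by (simp add: algebra_simps)
    qed simp
    from this[of "Suc n"] show ?thesis by (simp add: t_def)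
  qed
  have "(\<lambda>n. moreau l (R 1) - moreau l (R 0) + (b 1 - b 0) / Suc n)
      \<longlonglongrightarrow> moreau l (R 1) - moreau l (R 0) + 0"
    by (intro tendsto_add tendsto_const) (rule LIMSEQ_Suc, rule lim_const_over_n)
  then have "moreau l (P 1) - moreau l (P 0) \<le> moreau l (R 1) - moreau l (R 0) + 0"
    by (rule LIMSEQ_le_const) (use disc in auto)
  moreover have "P 1 = refl2 u v" "P 0 = v" "R 1 = u" "R 0 = refl1 u v"
    by (auto simp: P_def R_def refl1_def refl2_def)
  ultimately show ?thesis by simp
qed

end

text \<open>Lower semicontinuity acts on single values, so a strict lower bound on a sum has to be
  split; either summand may be infinite.\<close>

lemma ereal_split_less_sum:
  fixes a b :: ereal
  assumes "a \<noteq> -\<infinity>" "b \<noteq> -\<infinity>" "ereal K < a + b"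
  obtains r s where "ereal r < a" "ereal s < b" "K < r + s"
proof (cases a)
  case (real x)
  show thesis
  proof (cases b)
    case [simp]: (real y)
    have "K < x + y" using assms(3) \<open>a = ereal x\<close> by simp
    then show thesis
      using that[of "x - (x + y - K) / 4" "y - (x + y - K) / 4"] \<open>a = ereal x\<close>
      by (simp add: field_simps)
  next
    case PInf
    then show thesis using that[of "x - 1" "K - x + 2"] \<open>a = ereal x\<close> by simp
  qed (use assms in auto)
next
  case PInf
  have "-\<infinity> < b" using assms(2) by simp
  then obtain s where "ereal s < b" using ereal_dense2 by blast
  then show thesis using that[of "K - s + 1" s] PInf by simp
qed (use assms in auto)

context constrained_resolvent
begin

text \<open>The envelope inequality is passed to the limit as \<open>l\<close> tends to 0. The
  reflected functions are not yet known to lie in the closed domain: the bound on the sum of their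
  envelopes and separate lower bounds give separate upper bounds, which force their resolvents to
  converge to them. Lower semicontinuity then concludes.\<close>

lemma energy_reflected_if_resolvent_invariant:
  assumes J: "\<And>l. l > 0 \<Longrightarrow> invariant (L2 M) (J l)"
  shows "energy_reflected"
  unfolding energy_reflected_def
proof (intro ballI)
  fix u v assume uv: "u \<in> D" "v \<in> D"
  note L = D_L2[OF uv(1)] D_L2[OF uv(2)]
  define x where "x = refl1 u v"
  define y where "y = refl2 u v"
  define K where "K = val u + val v"
  have xy: "x \<in> L2 M" "y \<in> L2 M" using L by (auto simp: x_def y_def)
  have bound: "moreau l x + moreau l y \<le> K" if "l > 0" for l
    using moreau_reflected[OF J[OF that] that L] moreau_le[OF that uv(1)] moreau_le[OF that uv(2)]
    unfolding x_def y_def K_def by linarith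
  have lower: "\<exists>m. \<forall>l. 0 < l \<longrightarrow> l \<le> 1 \<longrightarrow> m \<le> moreau l f" if f: "f \<in> L2 M" for f
  proof -
    obtain m where m: "\<And>l. 0 < l \<Longrightarrow> l \<le> 1 \<Longrightarrow> m + (l2_dist M f (J l f))\<^sup>2 / (4 * l) \<le> moreau l f"
      using moreau_lower_bound[OF f] by blast
    have "m \<le> moreau l f" if "0 < l" "l \<le> 1" for l
      by (rule order_trans[OF _ m[OF that]]) (use that in simp)
    then show ?thesis by blast
  qed
  obtain m1 m2 where m: "\<And>l. 0 < l \<Longrightarrow> l \<le> 1 \<Longrightarrow> m1 \<le> moreau l x"
    "\<And>l. 0 < l \<Longrightarrow> l \<le> 1 \<Longrightarrow> m2 \<le> moreau l y"
    using lower[OF xy(1)] lower[OF xy(2)] by blast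
  have limx: "((\<lambda>l. l2_dist M x (J l x)) \<longlongrightarrow> 0) (at_right 0)"
  proof (rule J_tendsto[OF xy(1)])
    show "moreau l x \<le> K - m2" if "0 < l" "l \<le> 1" for l using bound[OF that(1)] m(2)[OF that] by simp
  qed
  have limy: "((\<lambda>l. l2_dist M y (J l y)) \<longlongrightarrow> 0) (at_right 0)"
  proof (rule J_tendsto[OF xy(2)])
    show "moreau l y \<le> K - m1" if "0 < l" "l \<le> 1" for l using bound[OF that(1)] m(1)[OF that] by simp
  qed
  have "E x + E y \<le> ereal K"
  proof (rule ccontr)
    assume "\<not> E x + E y \<le> ereal K"
    then have "ereal K < E x + E y" by simp
    then obtain r s where rs: "ereal r < E x" "ereal s < E y" "K < r + s"
      using ereal_split_less_sum[OF E_not_MInf[OF xy(1)] E_not_MInf[OF xy(2)]] by blast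
    obtain d1 where d1: "d1 > 0" "\<And>g. g \<in> L2 M \<Longrightarrow> l2_dist M x g < d1 \<Longrightarrow> ereal r < E g"
      using lscD[OF xy(1) rs(1)] by blast
    obtain d2 where d2: "d2 > 0" "\<And>g. g \<in> L2 M \<Longrightarrow> l2_dist M y g < d2 \<Longrightarrow> ereal s < E g"
      using lscD[OF xy(2) rs(2)] by blast
    have "\<forall>\<^sub>F l in at_right (0 :: real). 0 < l \<and> l2_dist M x (J l x) < d1 \<and> l2_dist M y (J l y) < d2"
      by (intro eventually_conj eventually_at_right_less order_tendstoD(2)[OF limx d1(1)]
          order_tendstoD(2)[OF limy d2(1)])
    then obtain l where l: "0 < l" "l2_dist M x (J l x) < d1" "l2_dist M y (J l y) < d2"
      using eventually_happens'[OF trivial_limit_at_right_real] by blast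
    have "r < val (J l x)" "s < val (J l y)"
      using d1(2)[OF J_L2[OF l(1) xy(1)] l(2)] d2(2)[OF J_L2[OF l(1) xy(2)] l(3)]
        J_D[OF l(1) xy(1)] J_D[OF l(1) xy(2)] by (simp_all add: E_val)
    moreover have "val (J l x) \<le> moreau l x" "val (J l y) \<le> moreau l y"
      using l(1) by (simp_all add: moreau_def)
    ultimately show False using rs(3) bound[OF l(1)] by linarith
  qed
  then have "E x + E y \<le> E u + E v" using uv by (simp add: E_val K_def)
  from E_sum_le_D[OF xy uv this]
  show "refl1 u v \<in> D \<and> refl2 u v \<in> D \<and> val (refl1 u v) + val (refl2 u v) \<le> val u + val v"
    by (simp add: x_def y_def)
qed

end

section \<open>Curves of square-integrable functions\<close>

lemma has_l2_derivative_diff: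
  assumes "\<And>s. 0 \<le> s \<Longrightarrow> u s \<in> L2 M" "\<And>s. 0 \<le> s \<Longrightarrow> v s \<in> L2 M" "g \<in> L2 M" "h \<in> L2 M" "0 < t"
    and u: "has_l2_derivative M u g t" and v: "has_l2_derivative M v h t"
  shows "has_l2_derivative M (\<lambda>s x. v s x - u s x) (\<lambda>x. h x - g x) t"
  unfolding has_l2_derivative_def
proof (rule Lim_null_comparison)
  let ?q = "\<lambda>w s x. (w s x - w t x) / (s - t)"
  have "\<forall>\<^sub>F s in at t. 0 < s"
    using eventually_nhds_in_open[of "{0<..}" t] assms(5) by (auto simp: eventually_at_filter elim: eventually_mono)
  then show "\<forall>\<^sub>F s in at t. norm (l2_dist M (\<lambda>x. (v s x - u s x - (v t x - u t x)) / (s - t)) (\<lambda>x. h x - g x))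
      \<le> l2_dist M (?q v s) h + l2_dist M (?q u s) g"
  proof eventually_elim
    case (elim s)
    have "(\<lambda>x. (v s x - u s x - (v t x - u t x)) / (s - t) - (h x - g x))
        = (\<lambda>x. (?q v s x - h x) - (?q u s x - g x))"
      by (auto simp: diff_divide_distrib)
    moreover have "l2_norm M (\<lambda>x. (?q v s x - h x) - (?q u s x - g x))
        \<le> l2_norm M (\<lambda>x. ?q v s x - h x) + l2_norm M (\<lambda>x. ?q u s x - g x)"
      using assms elim by (intro l2_norm_triangle_diff) auto
    ultimately show ?case by (simp add: l2_dist_def)
  qed
  show "((\<lambda>s. l2_dist M (?q v s) h + l2_dist M (?q u s) g) \<longlongrightarrow> 0) (at t)"
    using tendsto_add[OF v[unfolded has_l2_derivative_def] u[unfolded has_l2_derivative_def]] by simp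
qed

text \<open>The difference quotient of half the squared distance is the inner product of
  \<open>?q s\<close> with \<open>u t - k\<close> plus \<open>(s - t) / 2\<close> times the squared
  norm of \<open>?q s\<close>; the last term vanishes in the limit.\<close>

lemma l2_dist_square_has_derivative:
  assumes u: "\<And>s. 0 \<le> s \<Longrightarrow> u s \<in> L2 M" and g: "g \<in> L2 M" and k: "k \<in> L2 M" and t: "0 < t"
    and der: "has_l2_derivative M u g t"
  shows "((\<lambda>s. (l2_dist M (u s) k)\<^sup>2 / 2) has_real_derivative l2_inner M g (\<lambda>x. u t x - k x)) (at t)"
proof -
  let ?q = "\<lambda>s x. (u s x - u t x) / (s - t)"
  have ut: "u t \<in> L2 M" using u t by simp
  have pos: "\<forall>\<^sub>F s in at t. 0 < s"
    using eventually_nhds_in_open[of "{0<..}" t] t by (auto simp: eventually_at_filter elim: eventually_mono)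
  then have qL: "\<forall>\<^sub>F s in at t. ?q s \<in> L2 M"
    by eventually_elim (use u ut in simp)
  have lim: "((\<lambda>s. l2_dist M (?q s) g) \<longlongrightarrow> 0) (at t)" using der by (simp add: has_l2_derivative_def)
  have "((\<lambda>s. l2_inner M (?q s) (\<lambda>x. u t x - k x) + (s - t) * (l2_norm M (?q s))\<^sup>2 / 2)
      \<longlongrightarrow> l2_inner M g (\<lambda>x. u t x - k x) + (t - t) * (l2_norm M g)\<^sup>2 / 2) (at t)"
    using ut k
    by (intro tendsto_add tendsto_mult tendsto_diff tendsto_divide tendsto_power tendsto_const tendsto_ident_at
        l2_inner_tendsto[OF qL g _ lim] l2_norm_tendsto[OF qL g lim]) auto
  moreover have "\<forall>\<^sub>F s in at t. l2_inner M (?q s) (\<lambda>x. u t x - k x) + (s - t) * (l2_norm M (?q s))\<^sup>2 / 2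
      = ((l2_dist M (u s) k)\<^sup>2 / 2 - (l2_dist M (u t) k)\<^sup>2 / 2) / (s - t)"
    using pos eventually_neq_at_within[of t t UNIV]
  proof eventually_elim
    case (elim s)
    define w where "w = (\<lambda>x. u s x - u t x)"
    define z where "z = (\<lambda>x. u t x - k x)"
    have L: "w \<in> L2 M" "z \<in> L2 M" using u[of s] ut k elim by (auto simp: w_def z_def)
    have "(\<lambda>x. u s x - k x) = (\<lambda>x. w x + z x)" by (auto simp: w_def z_def)
    then have "(l2_dist M (u s) k)\<^sup>2 - (l2_dist M (u t) k)\<^sup>2 = 2 * l2_inner M w z + l2_inner M w w"
      using L unfolding l2_dist_def l2_norm_square z_def[symmetric]
      by (simp add: l2_inner_simps l2_inner_commute[of M z w])
    moreover have "l2_inner M (?q s) z = l2_inner M w z / (s - t)"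
      "(l2_norm M (?q s))\<^sup>2 = l2_inner M w w / (s - t)\<^sup>2"
      unfolding l2_norm_square w_def[symmetric]
      by (simp_all add: l2_inner_divide_left l2_inner_divide_right power2_eq_square flip: w_def fun_cong[OF w_def])
    moreover have "X / h + h * (W / h\<^sup>2) / 2 = (a / 2 - b / 2) / h"
      if "h \<noteq> 0" "a - b = 2 * X + W" for X W a b h :: real
    proof -
      have "a / 2 - b / 2 = X + W / 2" using that(2) by simp
      then show ?thesis using that(1) by (simp add: power2_eq_square field_simps)
    qed
    ultimately show ?case
      unfolding z_def[symmetric] using elim(2) by simp
  qed
  ultimately have "((\<lambda>s. ((l2_dist M (u s) k)\<^sup>2 / 2 - (l2_dist M (u t) k)\<^sup>2 / 2) / (s - t))
      \<longlongrightarrow> l2_inner M g (\<lambda>x. u t x - k x)) (at t)"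
    by (simp add: Lim_transform_eventually)
  then show ?thesis by (simp add: has_field_derivative_iff)
qed

text \<open>This supplies the one-sided growth hypothesis of the monotonicity lemmas, with
  \<open>e\<close> the Lipschitz constant times the time step.\<close>

lemma l2_dist_square_lipschitz:
  assumes "w \<in> L2 M" "w' \<in> L2 M" "k \<in> L2 M" "l2_dist M w' w \<le> e" "l2_dist M w k \<le> C"
  shows "(l2_dist M w' k)\<^sup>2 / 2 - (l2_dist M w k)\<^sup>2 / 2 \<le> e * (C + e)"
proof -
  let ?a = "l2_dist M w k"
  have e: "0 \<le> e" using order_trans[OF l2_dist_nonneg assms(4)] .
  have "l2_dist M w' k \<le> ?a + e" using l2_dist_triangle[of w' M w k] assms by simp
  then have "(l2_dist M w' k)\<^sup>2 \<le> (?a + e)\<^sup>2" by (rule power_mono) simp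
  also have "\<dots> = ?a\<^sup>2 + 2 * (e * ?a) + e\<^sup>2" by (simp add: power2_sum algebra_simps)
  finally have "(l2_dist M w' k)\<^sup>2 / 2 - ?a\<^sup>2 / 2 \<le> e * ?a + e\<^sup>2 / 2" by simp
  also have "\<dots> \<le> e * C + e\<^sup>2"
    using assms(5) e by (intro add_mono mult_left_mono) auto
  finally show ?thesis by (simp add: power2_eq_square algebra_simps)
qed

text \<open>The affine right side serves two uses: minimality of the derivative takes the linear
  term, the evolution inequality the constant one.\<close>

lemma l2_curve_growth:
  assumes w: "\<And>s. 0 \<le> s \<Longrightarrow> w s \<in> L2 M" and k: "k \<in> L2 M" and ab: "0 \<le> a" "a \<le> b"
    and lip: "\<And>r s. 0 \<le> r \<Longrightarrow> 0 \<le> s \<Longrightarrow> l2_dist M (w r) (w s) \<le> L * \<bar>r - s\<bar>"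
    and der: "AE s in lborel. a < s \<longrightarrow> s < b \<longrightarrow> (\<exists>g\<in>L2 M. has_l2_derivative M w g s \<and>
      l2_inner M g (\<lambda>x. w s x - k x) \<le> \<kappa> + K * (s - a))"
  shows "(l2_dist M (w b) k)\<^sup>2 / 2 \<le> (l2_dist M (w a) k)\<^sup>2 / 2 + \<kappa> * (b - a) + K * (b - a)\<^sup>2 / 2"
proof -
  define \<phi> where "\<phi> s = (l2_dist M (w s) k)\<^sup>2 / 2 - (\<kappa> * (s - a) + K * (s - a)\<^sup>2 / 2)" for s
  have L0: "0 \<le> L" using lip[of 0 1] order_trans[OF l2_dist_nonneg] by fastforce
  define C where "C = l2_dist M (w a) k + L * (b - a)"
  have "\<phi> b \<le> \<phi> a"
  proof (rule nonincreasing_if_AE_derivative_le_0[OF ab(2)])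
    fix r s assume rs: "a \<le> r" "r \<le> s" "s \<le> b"
    have "l2_dist M (w s) (w r) \<le> L * (s - r)" using lip[of s r] rs ab by simp
    moreover have "l2_dist M (w r) k \<le> C"
    proof -
      have "l2_dist M (w r) k \<le> l2_dist M (w r) (w a) + l2_dist M (w a) k"
        using w k rs ab by (intro l2_dist_triangle) auto
      moreover have "l2_dist M (w r) (w a) \<le> L * (b - a)"
        using lip[of r a] rs ab L0 mult_left_mono[of "r - a" "b - a" L] by simp
      ultimately show ?thesis by (simp add: C_def)
    qed
    ultimately have 1: "(l2_dist M (w s) k)\<^sup>2 / 2 - (l2_dist M (w r) k)\<^sup>2 / 2 \<le> L * (s - r) * (C + L * (s - r))"
      using w k rs ab by (intro l2_dist_square_lipschitz) auto
    have C0: "0 \<le> C" using L0 ab by (simp add: C_def)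
    have "L * (s - r) * (C + L * (s - r)) \<le> L * (s - r) * (C + L * (b - a))"
      using rs L0 by (intro mult_left_mono add_left_mono) auto
    moreover have "- (\<kappa> * (s - a) - \<kappa> * (r - a)) \<le> \<bar>\<kappa>\<bar> * (s - r)"
      using mult_right_mono[of "- \<kappa>" "\<bar>\<kappa>\<bar>" "s - r"] rs by (simp add: algebra_simps)
    moreover have "- (K * (s - a)\<^sup>2 / 2 - K * (r - a)\<^sup>2 / 2) \<le> \<bar>K\<bar> * (b - a) * (s - r)"
    proof -
      have "- (K * (s - a)\<^sup>2 / 2 - K * (r - a)\<^sup>2 / 2) = - K * (((s - a) + (r - a)) / 2 * (s - r))"
        by (simp add: power2_eq_square field_simps)
      also have "\<dots> \<le> \<bar>K\<bar> * (((s - a) + (r - a)) / 2 * (s - r))"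
        using rs by (intro mult_right_mono) auto
      also have "\<dots> \<le> \<bar>K\<bar> * ((b - a) * (s - r))"
        using rs by (intro mult_left_mono mult_right_mono) auto
      finally show ?thesis by (simp add: mult.assoc)
    qed
    ultimately show "\<phi> s - \<phi> r \<le> (L * (C + L * (b - a)) + \<bar>\<kappa>\<bar> + \<bar>K\<bar> * (b - a)) * (s - r)"
      using 1 unfolding \<phi>_def distrib_right by (simp add: mult.commute mult.left_commute)
  next
    show "AE r in lborel. a < r \<longrightarrow> r < b \<longrightarrow> (\<exists>D\<le>0. (\<phi> has_real_derivative D) (at r))"
      using der
    proof eventually_elim
      case (elim r)
      show ?case
      proof (intro impI)
        assume r: "a < r" "r < b"
        then obtain g where g: "g \<in> L2 M" "has_l2_derivative M w g r"
          "l2_inner M g (\<lambda>x. w r x - k x) \<le> \<kappa> + K * (r - a)" using elim by blast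
        have "((\<lambda>s. (l2_dist M (w s) k)\<^sup>2 / 2) has_real_derivative l2_inner M g (\<lambda>x. w r x - k x)) (at r)"
          using g r ab w k by (intro l2_dist_square_has_derivative) auto
        moreover have "((\<lambda>s. \<kappa> * (s - a) + K * (s - a)\<^sup>2 / 2) has_real_derivative \<kappa> + K * (r - a)) (at r)"
          by (auto intro!: derivative_eq_intros)
        ultimately have "(\<phi> has_real_derivative l2_inner M g (\<lambda>x. w r x - k x) - (\<kappa> + K * (r - a))) (at r)"
          unfolding \<phi>_def[abs_def] by (rule DERIV_diff)
        then show "\<exists>D\<le>0. (\<phi> has_real_derivative D) (at r)" using g(3) by (intro exI conjI) auto
      qed
    qed
  qed
  then show ?thesis by (simp add: \<phi>_def)
qed

lemma l2_dist_tendsto: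
  assumes "\<And>n. f n \<in> L2 M" "g \<in> L2 M" "k \<in> L2 M" "(\<lambda>n. l2_dist M (f n) g) \<longlonglongrightarrow> 0"
  shows "(\<lambda>n. l2_dist M (f n) k) \<longlonglongrightarrow> l2_dist M g k"
proof -
  have "l2_dist M (\<lambda>x. f n x - k x) (\<lambda>x. g x - k x) = l2_dist M (f n) g" for n
    by (simp add: l2_dist_def)
  then show ?thesis
    unfolding l2_dist_def[of M _ k] using assms by (intro l2_norm_tendsto always_eventually allI) auto
qed

section \<open>The gradient flow\<close>

locale energy_flow = energy_resolvent M E J
  for M :: "'a measure" and E J +
  fixes T :: "real \<Rightarrow> ('a \<Rightarrow> real) \<Rightarrow> ('a \<Rightarrow> real)"
  assumes semigroup: "semigroup_of M E T"
begin

lemma T_Dc: "0 \<le> t \<Longrightarrow> f \<in> Dc \<Longrightarrow> T t f \<in> Dc"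
  and T_0: "f \<in> Dc \<Longrightarrow> ae_eq M (T 0 f) f"
  and T_nonexpansive: "0 \<le> t \<Longrightarrow> f \<in> Dc \<Longrightarrow> g \<in> Dc \<Longrightarrow> l2_dist M (T t f) (T t g) \<le> l2_dist M f g"
  and T_continuous: "f \<in> Dc \<Longrightarrow> 0 \<le> t \<Longrightarrow> ((\<lambda>s. l2_dist M (T s f) (T t f)) \<longlongrightarrow> 0) (at t within {0..})"
  and T_solution: "f \<in> op_dom A \<Longrightarrow> lipschitz_solution M A f (\<lambda>t. T t f)"
  using semigroup unfolding semigroup_of_def Let_def by blast+

lemma T_L2: "0 \<le> t \<Longrightarrow> f \<in> Dc \<Longrightarrow> T t f \<in> L2 M"
  using T_Dc Dc_L2 by blast

lemma op_dom_Dc: "f \<in> op_dom A \<Longrightarrow> f \<in> Dc"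
  using op_dom_D D_Dc by blast

lemma T_lipschitz:
  assumes "f \<in> op_dom A"
  obtains L where "\<And>r s. 0 \<le> r \<Longrightarrow> 0 \<le> s \<Longrightarrow> l2_dist M (T r f) (T s f) \<le> L * \<bar>r - s\<bar>"
  using T_solution[OF assms] unfolding lipschitz_solution_def by blast

lemma T_derivative:
  "f \<in> op_dom A \<Longrightarrow> AE t in lborel. 0 < t \<longrightarrow>
    (\<exists>g\<in>L2 M. has_l2_derivative M (\<lambda>t. T t f) g t \<and> (\<lambda>x. - g x) \<in> A (T t f))"
  using T_solution unfolding lipschitz_solution_def by blast

text \<open>Comparing the flow with an arbitrary \<open>h \<in> A (T t f)\<close> over a short time interval shows that the
  derivative at a point of differentiability has minimal norm.\<close>

lemma T_derivative_minimal:
  assumes f: "f \<in> op_dom A" and t: "0 < t" and g: "g \<in> L2 M"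
    and der: "has_l2_derivative M (\<lambda>t. T t f) g t" and h: "h \<in> A (T t f)"
  shows "l2_inner M g g \<le> - l2_inner M h g"
proof -
  define u where "u = (\<lambda>s. T s f)"
  have u: "u s \<in> L2 M" if "0 \<le> s" for s using that T_L2 op_dom_Dc[OF f] by (simp add: u_def)
  have ut: "u t \<in> L2 M" using u t by simp
  obtain L where lip: "\<And>r s. 0 \<le> r \<Longrightarrow> 0 \<le> s \<Longrightarrow> l2_dist M (u r) (u s) \<le> L * \<bar>r - s\<bar>"
    using T_lipschitz[OF f] unfolding u_def by blast
  note hL = A_L2[OF h]
  define B where "B = - l2_inner M h g"
  have bound: "l2_norm M g \<le> sqrt (B + l2_norm M h * e) + e" if "e > 0" for e
  proof -
    define q where "q s = (\<lambda>x. (u s x - u t x) / (s - t))" for s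
    have qL: "q s \<in> L2 M" if "0 \<le> s" for s using u that ut by (simp add: q_def)
    have "\<forall>\<^sub>F s in at t. l2_dist M (q s) g < e"
      using der that unfolding has_l2_derivative_def q_def u_def by (intro order_tendstoD(2)) auto
    then obtain d where d: "d > 0" "\<And>s. s \<noteq> t \<Longrightarrow> dist s t < d \<Longrightarrow> l2_dist M (q s) g < e"
      by (auto simp: eventually_at)
    define b where "b = t + d / 2"
    have b: "t < b" "b < t + d" using d(1) by (auto simp: b_def)
    \<comment> \<open>The reference point is \<open>u t\<close> itself, so the squared distance is
      of order \<open>(b - t)\<^sup>2\<close>, and dividing by that bounds the norm of the
      difference quotient.\<close>
    have "(l2_dist M (u b) (u t))\<^sup>2 / 2
        \<le> (l2_dist M (u t) (u t))\<^sup>2 / 2 + 0 * (b - t) + (B + l2_norm M h * e) * (b - t)\<^sup>2 / 2"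
    proof (rule l2_curve_growth[OF u ut _ _ lip])
      show "AE s in lborel. t < s \<longrightarrow> s < b \<longrightarrow> (\<exists>g\<in>L2 M. has_l2_derivative M u g s \<and>
          l2_inner M g (\<lambda>x. u s x - u t x) \<le> 0 + (B + l2_norm M h * e) * (s - t))"
        using T_derivative[OF f]
      proof eventually_elim
        case (elim s)
        show ?case
        proof (intro impI)
          assume s: "t < s" "s < b"
          then obtain g' where g': "g' \<in> L2 M" "has_l2_derivative M u g' s" "(\<lambda>x. - g' x) \<in> A (u s)"
            using elim t unfolding u_def by auto
          have us: "u s \<in> L2 M" "q s \<in> L2 M" using u qL s t by auto
          have "0 \<le> l2_inner M (\<lambda>x. - g' x - h x) (\<lambda>x. u s x - u t x)"
            using A_monotone[OF g'(3)] h by (simp add: u_def)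
          then have "l2_inner M g' (\<lambda>x. u s x - u t x) \<le> - l2_inner M h (\<lambda>x. u s x - u t x)"
            using g'(1) hL us ut by (simp add: l2_inner_simps)
          \<comment> \<open>Up to the factor \<open>s - t\<close> the displacement is
            \<open>q s\<close>, which is within \<open>e\<close> of \<open>g\<close>.\<close>
          also have "- l2_inner M h (\<lambda>x. u s x - u t x) = (s - t) * (B - l2_inner M h (\<lambda>x. q s x - g x))"
          proof -
            have eq: "(\<lambda>x. u s x - u t x) = (\<lambda>x. (s - t) * q s x)" using s by (auto simp: q_def)
            show ?thesis
              unfolding eq using hL us g by (simp add: B_def l2_inner_simps algebra_simps)
          qed
          also have "\<dots> \<le> (s - t) * (B + l2_norm M h * e)"
          proof (intro mult_left_mono)
            have "l2_norm M (\<lambda>x. q s x - g x) \<le> e"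
              using d(2)[of s] s b by (simp add: l2_dist_def dist_real_def)
            then have "l2_norm M h * l2_norm M (\<lambda>x. q s x - g x) \<le> l2_norm M h * e"
              by (intro mult_left_mono) auto
            moreover have "\<bar>l2_inner M h (\<lambda>x. q s x - g x)\<bar> \<le> l2_norm M h * l2_norm M (\<lambda>x. q s x - g x)"
              using hL us g by (intro l2_Cauchy_Schwarz) auto
            ultimately show "B - l2_inner M h (\<lambda>x. q s x - g x) \<le> B + l2_norm M h * e" by linarith
          qed (use s in simp)
          finally have "l2_inner M g' (\<lambda>x. u s x - u t x) \<le> 0 + (B + l2_norm M h * e) * (s - t)"
            by (simp add: mult.commute)
          with g' show "\<exists>g\<in>L2 M. has_l2_derivative M u g s \<and>
            l2_inner M g (\<lambda>x. u s x - u t x) \<le> 0 + (B + l2_norm M h * e) * (s - t)" by blast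
        qed
      qed
    qed (use t b in auto)
    then have "(l2_dist M (u b) (u t))\<^sup>2 \<le> (B + l2_norm M h * e) * (b - t)\<^sup>2" by simp
    moreover have "(l2_norm M (q b))\<^sup>2 = (l2_dist M (u b) (u t))\<^sup>2 / (b - t)\<^sup>2"
      unfolding q_def l2_dist_def l2_norm_square by (simp add: l2_inner_divide_left l2_inner_divide_right power2_eq_square)
    ultimately have "(l2_norm M (q b))\<^sup>2 \<le> B + l2_norm M h * e"
      using b by (simp add: divide_le_eq)
    then have "l2_norm M (q b) \<le> sqrt (B + l2_norm M h * e)" by (rule real_le_rsqrt)
    moreover have "\<bar>l2_norm M (q b) - l2_norm M g\<bar> \<le> l2_dist M (q b) g"
      using qL b t g by (intro l2_norm_dist_triangle) auto
    moreover have "l2_dist M (q b) g < e" using d b by (auto simp: dist_real_def)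
    ultimately show ?thesis by linarith
  qed
  have "((\<lambda>e. sqrt (B + l2_norm M h * e) + e) \<longlongrightarrow> sqrt (B + l2_norm M h * 0) + 0) (at_right 0)"
    by (intro tendsto_intros)
  then have "l2_norm M g \<le> sqrt (B + l2_norm M h * 0) + 0"
    by (rule tendsto_lowerbound)
      (auto intro!: eventually_mono[OF eventually_at_right_less] bound)
  then have "l2_norm M g \<le> sqrt B" by simp
  then have "(l2_norm M g)\<^sup>2 \<le> (sqrt B)\<^sup>2" by (intro power_mono) auto
  \<comment> \<open>Nonnegativity of \<open>B\<close> is a consequence here, because
    \<open>sqrt\<close> of a negative real is negative in HOL.\<close>
  moreover have "0 \<le> B" using \<open>l2_norm M g \<le> sqrt B\<close> order_trans[OF l2_norm_nonneg] real_sqrt_ge_0_iff by blast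
  ultimately show ?thesis by (simp add: l2_norm_square B_def)
qed

lemma T_derivative_minimal_section:
  assumes f: "f \<in> op_dom A"
  shows "AE t in lborel. 0 < t \<longrightarrow> T t f \<in> op_dom A \<and>
    (\<exists>g\<in>L2 M. has_l2_derivative M (\<lambda>t. T t f) g t \<and> ae_eq M (\<lambda>x. - g x) (minimal_section M A (T t f)))"
  using T_derivative[OF f]
proof eventually_elim
  case (elim t)
  show ?case
  proof
    assume t: "0 < t"
    then obtain g where g: "g \<in> L2 M" "has_l2_derivative M (\<lambda>t. T t f) g t" "(\<lambda>x. - g x) \<in> A (T t f)"
      using elim by blast
    have "ae_eq M (\<lambda>x. - g x) (minimal_section M A (T t f))"
    proof (rule minimal_section_unique[OF g(3)])
      fix h assume "h \<in> A (T t f)"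
      from T_derivative_minimal[OF f t g(1,2) this]
      show "l2_inner M (\<lambda>x. - g x) (\<lambda>x. - g x) \<le> l2_inner M (\<lambda>x. - g x) h"
        by (simp add: l2_inner_minus_left l2_inner_minus_right l2_inner_commute[of M g h])
    qed
    with g show "T t f \<in> op_dom A \<and> (\<exists>g\<in>L2 M. has_l2_derivative M (\<lambda>t. T t f) g t
        \<and> ae_eq M (\<lambda>x. - g x) (minimal_section M A (T t f)))"
      by (auto simp: op_dom_def)
  qed
qed

text \<open>A local form of the evolution variational inequality; lower semicontinuity replaces the
  monotonicity of the energy along the flow.\<close>

lemma evolution_inequality:
  assumes p: "p \<in> Dc" and z: "z \<in> D" and r: "ereal r < E p"
  obtains \<tau> where "\<tau> > 0" "\<And>t. 0 < t \<Longrightarrow> t \<le> \<tau> \<Longrightarrow>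
    (l2_dist M (T t p) z)\<^sup>2 / 2 \<le> (l2_dist M p z)\<^sup>2 / 2 + (val z - r) * t"
proof -
  note pL = Dc_L2[OF p] and zL = D_L2[OF z]
  obtain d where d: "d > 0" "\<And>g. g \<in> L2 M \<Longrightarrow> l2_dist M p g < d \<Longrightarrow> ereal r < E g"
    using lscD[OF pL r] by blast
  have "\<forall>\<^sub>F s in at 0 within {0..}. l2_dist M (T s p) (T 0 p) < d / 2"
    using T_continuous[OF p, of 0] d(1) by (intro order_tendstoD(2)) auto
  then obtain \<delta> where \<delta>: "\<delta> > 0" "\<And>s. 0 < s \<Longrightarrow> s < \<delta> \<Longrightarrow> l2_dist M (T s p) (T 0 p) < d / 2"
    by (auto simp: eventually_at dist_real_def)
  \<comment> \<open>Half of the radius \<open>d\<close> is spent on the flow of \<open>p\<close>,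
    the other half on passing to the flow of an approximant.\<close>
  have near: "l2_dist M p (T s p) < d / 2" if "0 < s" "s < \<delta>" for s
  proof -
    have "l2_dist M (T s p) (T 0 p) = l2_dist M (T s p) p"
      using T_L2[OF _ p] T_0[OF p] pL that by (intro l2_dist_cong) auto
    then show ?thesis using \<delta>(2)[OF that] by (simp add: l2_dist_commute)
  qed
  show thesis
  proof (rule that)
    show "\<delta> / 2 > 0" using \<delta> by simp
    fix t assume t: "0 < t" "t \<le> \<delta> / 2"
    \<comment> \<open>The Lipschitz property is available only for flows started in the domain of
      \<open>A\<close>. The inequality is proved for approximants there and passed to the limit,
      non-expansiveness keeping their flows in the ball of radius \<open>d\<close>.\<close>
    have "\<exists>f. f \<in> op_dom A \<and> l2_dist M p f < d / 2 / Suc n" for n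
      using op_dom_dense[OF p, of "d / 2 / Suc n"] d(1) by auto
    then obtain f where f: "\<And>n. f n \<in> op_dom A" "\<And>n. l2_dist M p (f n) < d / 2 / Suc n" by metis
    note fDc = op_dom_Dc[OF f(1)]
    note fL = Dc_L2[OF fDc]
    have lim: "(\<lambda>n. l2_dist M (f n) p) \<longlonglongrightarrow> 0"
    proof (rule Lim_null_comparison)
      show "\<forall>\<^sub>F n in sequentially. norm (l2_dist M (f n) p) \<le> d / 2 / Suc n"
        using f(2) by (intro always_eventually) (auto simp: l2_dist_commute[of M _ p] intro: less_imp_le)
      show "(\<lambda>n. d / 2 / Suc n) \<longlonglongrightarrow> 0" by (rule LIMSEQ_Suc, rule lim_const_over_n)
    qed
    have limT: "(\<lambda>n. l2_dist M (T t (f n)) (T t p)) \<longlonglongrightarrow> 0"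
      by (rule Lim_null_comparison[OF _ lim])
        (use T_nonexpansive[OF _ fDc p] t in \<open>auto intro!: always_eventually\<close>)
    have evi: "(l2_dist M (T t (f n)) z)\<^sup>2 / 2 \<le> (l2_dist M (f n) z)\<^sup>2 / 2 + (val z - r) * t" for n
    proof -
      define u where "u = (\<lambda>s. T s (f n))"
      have u: "u s \<in> L2 M" if "0 \<le> s" for s using T_L2[OF that fDc] by (simp add: u_def)
      obtain L where lip: "\<And>r s. 0 \<le> r \<Longrightarrow> 0 \<le> s \<Longrightarrow> l2_dist M (u r) (u s) \<le> L * \<bar>r - s\<bar>"
        using T_lipschitz[OF f(1)] unfolding u_def by blast
      have "(l2_dist M (u t) z)\<^sup>2 / 2 \<le> (l2_dist M (u 0) z)\<^sup>2 / 2 + (val z - r) * (t - 0) + 0 * (t - 0)\<^sup>2 / 2"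
      proof (rule l2_curve_growth[OF u zL _ _ lip])
        show "AE s in lborel. 0 < s \<longrightarrow> s < t \<longrightarrow> (\<exists>g\<in>L2 M. has_l2_derivative M u g s \<and>
            l2_inner M g (\<lambda>x. u s x - z x) \<le> (val z - r) + 0 * (s - 0))"
          using T_derivative[OF f(1)[of n]]
        proof eventually_elim
          case (elim s)
          show ?case
          proof (intro impI)
            assume s: "0 < s" "s < t"
            then obtain g where g: "g \<in> L2 M" "has_l2_derivative M u g s" "(\<lambda>x. - g x) \<in> A (u s)"
              using elim unfolding u_def by auto
            have us: "u s \<in> L2 M" using u s by simp
            have "l2_dist M p (u s) \<le> l2_dist M p (T s p) + l2_dist M (T s p) (u s)"
              using pL us T_L2[OF _ p] s by (intro l2_dist_triangle) auto
            also have "l2_dist M (T s p) (u s) \<le> l2_dist M p (f n)"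
              unfolding u_def using s by (intro T_nonexpansive[OF _ p fDc]) auto
            also have "\<dots> < d / 2"
            proof -
              have "d / 2 / Suc n \<le> d / 2" using d(1) by (simp add: field_simps)
              then show ?thesis using f(2)[of n] by linarith
            qed
            also have "l2_dist M p (T s p) < d / 2" using near s t \<delta> by auto
            finally have "ereal r < E (u s)" using d(2)[OF us] by simp
            then have "r < val (u s)" using A_D[OF g(3)] by (simp add: E_val)
            moreover have "val (u s) + l2_inner M (\<lambda>x. - g x) (\<lambda>x. z x - u s x) \<le> val z"
              by (rule A_le[OF g(3) z])
            ultimately have "l2_inner M g (\<lambda>x. u s x - z x) \<le> (val z - r) + 0 * (s - 0)"
              using g(1) us zL by (simp add: l2_inner_simps)
            with g show "\<exists>g\<in>L2 M. has_l2_derivative M u g s \<and>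
              l2_inner M g (\<lambda>x. u s x - z x) \<le> (val z - r) + 0 * (s - 0)" by blast
          qed
        qed
      qed (use t in auto)
      moreover have "l2_dist M (u 0) z = l2_dist M (f n) z"
        unfolding u_def using T_0[OF fDc] T_L2[OF _ fDc] fL zL by (intro l2_dist_cong) auto
      ultimately show ?thesis by (simp add: u_def)
    qed
    have "(\<lambda>n. (l2_dist M (T t (f n)) z)\<^sup>2 / 2) \<longlonglongrightarrow> (l2_dist M (T t p) z)\<^sup>2 / 2"
      using T_L2[OF _ fDc] T_L2[OF _ p] zL limT t
      by (intro tendsto_divide tendsto_power tendsto_const l2_dist_tendsto) auto
    moreover have "(\<lambda>n. (l2_dist M (f n) z)\<^sup>2 / 2 + (val z - r) * t) \<longlonglongrightarrow> (l2_dist M p z)\<^sup>2 / 2 + (val z - r) * t"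
      using fL pL zL lim
      by (intro tendsto_add tendsto_divide tendsto_power tendsto_const l2_dist_tendsto) auto
    ultimately show "(l2_dist M (T t p) z)\<^sup>2 / 2 \<le> (l2_dist M p z)\<^sup>2 / 2 + (val z - r) * t"
      by (rule LIMSEQ_le) (use evi in blast)
  qed
qed

end

section \<open>The flow under a constraint\<close>

locale constrained_flow = constrained_resolvent M E J I c + energy_flow M E J T
  for M :: "'a measure" and E J I c T
begin

text \<open>\<open>k r\<close> freezes the clamped difference at time \<open>r\<close>:
  \<open>\<phi> s\<close> is at most half the squared distance from \<open>w s\<close> to
  \<open>k r\<close>, with equality at \<open>s = r\<close>. The right growth of
  \<open>\<phi>\<close> at \<open>r\<close> is thus controlled by an honest derivative, which is the
  quantity in the generator condition.\<close>

lemma defect_nonincreasing: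
  assumes gen: generator_condition and f: "f \<in> op_dom A" and g: "g \<in> op_dom A" and t: "0 \<le> t"
  shows "l2_norm M (defect (T t f) (T t g)) \<le> l2_norm M (defect f g)"
proof -
  define w where "w s = (\<lambda>x. T s g x - T s f x)" for s
  define k where "k s = (\<lambda>x. c (w s x))" for s
  define \<phi> where "\<phi> s = (l2_norm M (defect (T s f) (T s g)))\<^sup>2 / 2" for s
  note fg = op_dom_Dc[OF f] op_dom_Dc[OF g]
  have TL: "T s f \<in> L2 M" "T s g \<in> L2 M" if "0 \<le> s" for s using T_L2 fg that by auto
  have wL: "w s \<in> L2 M" if "0 \<le> s" for s using TL[OF that] by (simp add: w_def)
  have kL: "k s \<in> L2 M" if "0 \<le> s" for s using wL[OF that] unfolding k_def by (rule clamp_L2)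
  obtain L1 where L1: "\<And>r s. 0 \<le> r \<Longrightarrow> 0 \<le> s \<Longrightarrow> l2_dist M (T r f) (T s f) \<le> L1 * \<bar>r - s\<bar>"
    using T_lipschitz[OF f] by blast
  obtain L2' where L2': "\<And>r s. 0 \<le> r \<Longrightarrow> 0 \<le> s \<Longrightarrow> l2_dist M (T r g) (T s g) \<le> L2' * \<bar>r - s\<bar>"
    using T_lipschitz[OF g] by blast
  define L where "L = L1 + L2'"
  have L0: "0 \<le> L"
    using order_trans[OF l2_dist_nonneg L1[of 0 1]] order_trans[OF l2_dist_nonneg L2'[of 0 1]]
    by (simp add: L_def)
  have lip: "l2_dist M (w s) (w r) \<le> L * \<bar>s - r\<bar>" if "0 \<le> r" "0 \<le> s" for r s
  proof -
    have eq: "(\<lambda>x. w s x - w r x) = (\<lambda>x. (T s g x - T r g x) - (T s f x - T r f x))"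
      by (auto simp: w_def)
    have "l2_dist M (w s) (w r) \<le> l2_dist M (T s g) (T r g) + l2_dist M (T s f) (T r f)"
      unfolding l2_dist_def eq using TL that by (intro l2_norm_triangle_diff) auto
    also have "\<dots> \<le> L2' * \<bar>s - r\<bar> + L1 * \<bar>s - r\<bar>"
      using L1[OF that(2,1)] L2'[OF that(2,1)] by linarith
    finally show ?thesis by (simp add: L_def algebra_simps)
  qed
  have \<phi>_eq: "\<phi> s = (l2_dist M (w s) (k s))\<^sup>2 / 2" for s
  proof -
    have "(\<lambda>x. w s x - k s x) = (\<lambda>x. - defect (T s f) (T s g) x)"
      by (auto simp: w_def k_def defect_def)
    then show ?thesis by (simp add: \<phi>_def l2_dist_def l2_norm_minus)
  qed
  have \<phi>_le: "\<phi> s \<le> (l2_dist M (w s) (k r))\<^sup>2 / 2" if "0 \<le> s" "0 \<le> r" for r s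
  proof -
    have "l2_norm M (defect (T s f) (T s g)) \<le> l2_dist M (w s) (k r)"
      unfolding w_def using TL[OF that(1)] kL[OF that(2)]
      by (intro defect_norm_le) (auto simp: k_def clamp_in)
    then show ?thesis unfolding \<phi>_def by (intro divide_right_mono power_mono) auto
  qed
  have "\<phi> t \<le> \<phi> 0"
  proof (rule nonincreasing_if_AE_right_growth[OF t])
    fix r s assume rs: "0 \<le> r" "r \<le> s" "s \<le> t"
    define C where "C = l2_norm M (w 0) + L * t"
    have dist: "l2_dist M (w r) (k r) \<le> C"
    proof -
      have "l2_dist M (w r) (k r) \<le> l2_norm M (w r)"
        unfolding l2_dist_def
      proof (rule l2_norm_mono)
        have "\<bar>d - c d\<bar> \<le> \<bar>d\<bar>" for d
          using clamp_variational[OF zero_in, of d] by (auto simp: zero_le_mult_iff)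
        then show "AE x in M. \<bar>w r x - k r x\<bar> \<le> \<bar>w r x\<bar>" by (simp add: k_def)
      qed (use wL kL rs in auto)
      moreover have "\<bar>l2_norm M (w r) - l2_norm M (w 0)\<bar> \<le> l2_dist M (w r) (w 0)"
        using wL rs by (intro l2_norm_dist_triangle) auto
      moreover have "l2_dist M (w r) (w 0) \<le> L * t"
        using lip[of 0 r] rs L0 mult_left_mono[of r t L] by simp
      ultimately show ?thesis by (simp add: C_def)
    qed
    have "\<phi> s - \<phi> r \<le> (l2_dist M (w s) (k r))\<^sup>2 / 2 - (l2_dist M (w r) (k r))\<^sup>2 / 2"
      using \<phi>_le[of s r] \<phi>_eq[of r] rs by simp
    also have "\<dots> \<le> L * (s - r) * (C + L * (s - r))"
      using lip[of r s] rs wL kL dist by (intro l2_dist_square_lipschitz) auto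
    also have "\<dots> \<le> L * (s - r) * (C + L * t)"
      using rs L0 by (intro mult_left_mono add_left_mono) auto
    finally show "\<phi> s - \<phi> r \<le> L * (C + L * t) * (s - r)" 
      unfolding C_def by (simp add: mult.commute mult.left_commute)
  next
    show "AE r in lborel. 0 < r \<longrightarrow> r < t \<longrightarrow>
        (\<forall>e>0. \<exists>d>0. \<forall>s. r < s \<longrightarrow> s < r + d \<longrightarrow> \<phi> s - \<phi> r \<le> e * (s - r))"
      using T_derivative_minimal_section[OF f] T_derivative_minimal_section[OF g]
    proof eventually_elim
      case (elim r)
      show ?case
      proof (intro impI allI)
        fix e :: real assume r: "0 < r" "r < t" and e: "0 < e"
        obtain f' where f': "f' \<in> L2 M" "has_l2_derivative M (\<lambda>t. T t f) f' r"
          "ae_eq M (\<lambda>x. - f' x) (minimal_section M A (T r f))" "T r f \<in> op_dom A"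
          using elim(1) r by blast
        obtain g' where g': "g' \<in> L2 M" "has_l2_derivative M (\<lambda>t. T t g) g' r"
          "ae_eq M (\<lambda>x. - g' x) (minimal_section M A (T r g))" "T r g \<in> op_dom A"
          using elim(2) r by blast
        let ?h = "\<lambda>x. g' x - f' x"
        have "has_l2_derivative M w ?h r"
          unfolding w_def[abs_def] using TL f' g' r by (intro has_l2_derivative_diff) auto
        then have der: "((\<lambda>s. (l2_dist M (w s) (k r))\<^sup>2 / 2) has_real_derivative
            l2_inner M ?h (\<lambda>x. w r x - k r x)) (at r)"
          using wL kL f' g' r by (intro l2_dist_square_has_derivative) auto
        have eq: "(\<lambda>x. w r x - k r x) = (\<lambda>x. - defect (T r f) (T r g) x)"
          by (auto simp: w_def k_def defect_def)
        note ms = A_L2[OF minimal_section_in[OF f'(4)]] A_L2[OF minimal_section_in[OF g'(4)]]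
        \<comment> \<open>Two signs cancel: the flow moves along minus the minimal section, and
          \<open>w r - k r\<close> is minus the defect.\<close>
        have "l2_inner M ?h (\<lambda>x. w r x - k r x)
            = l2_inner M (\<lambda>x. - (g' x - f' x)) (defect (T r f) (T r g))"
          unfolding eq l2_inner_minus_left l2_inner_minus_right ..
        also have "\<dots> = l2_inner M (\<lambda>x. minimal_section M A (T r g) x - minimal_section M A (T r f) x)
            (defect (T r f) (T r g))"
          using f' g' TL r ms by (intro l2_inner_cong) (auto simp: ae_eq_def)
        also have "\<dots> \<le> 0" using gen f'(4) g'(4) by (simp add: generator_condition_def)
        finally have "l2_inner M ?h (\<lambda>x. w r x - k r x) < e" using e by simp
        then have "\<forall>\<^sub>F s in at r. ((l2_dist M (w s) (k r))\<^sup>2 / 2 - (l2_dist M (w r) (k r))\<^sup>2 / 2) / (s - r) < e"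
          using der by (intro order_tendstoD(2)) (auto simp: has_field_derivative_iff)
        then obtain d where d: "d > 0" "\<And>s. s \<noteq> r \<Longrightarrow> dist s r < d \<Longrightarrow>
            ((l2_dist M (w s) (k r))\<^sup>2 / 2 - (l2_dist M (w r) (k r))\<^sup>2 / 2) / (s - r) < e"
          by (auto simp: eventually_at)
        have "\<phi> s - \<phi> r \<le> e * (s - r)" if "r < s" "s < r + d" for s
        proof -
          have "((l2_dist M (w s) (k r))\<^sup>2 / 2 - (l2_dist M (w r) (k r))\<^sup>2 / 2) / (s - r) < e"
            using d(2)[of s] that by (simp add: dist_real_def)
          then have "(l2_dist M (w s) (k r))\<^sup>2 / 2 - (l2_dist M (w r) (k r))\<^sup>2 / 2 < e * (s - r)"
            using that(1) by (simp only: pos_divide_less_eq diff_gt_0_iff_gt)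
          then show ?thesis using \<phi>_le[of s r] \<phi>_eq[of r] r that by simp
        qed
        with d(1) show "\<exists>d>0. \<forall>s. r < s \<longrightarrow> s < r + d \<longrightarrow> \<phi> s - \<phi> r \<le> e * (s - r)" by blast
      qed
    qed
  qed
  then have "l2_norm M (defect (T t f) (T t g)) \<le> l2_norm M (defect (T 0 f) (T 0 g))"
    by (simp add: \<phi>_def power2_le_iff_abs_le)
  also have "\<dots> = l2_norm M (defect f g)"
  proof (rule l2_norm_cong)
    show "ae_eq M (defect (T 0 f) (T 0 g)) (defect f g)"
      using T_0[OF fg(1)] T_0[OF fg(2)] unfolding ae_eq_def
      by eventually_elim (simp add: defect_def)
  qed (use TL fg Dc_L2 in auto)
  finally show ?thesis .
qed

text \<open>The generator condition concerns the domain of \<open>A\<close>, so both initial values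
  are approximated there. Four errors of \<open>e / 4\<close> arise: two at time \<open>t\<close>,
  by non-expansiveness, and two at time 0.\<close>

lemma semigroup_invariant_if_generator_condition:
  assumes generator_condition "0 \<le> t"
  shows "invariant Dc (T t)"
  unfolding invariant_def
proof (intro ballI impI)
  fix u v assume uv: "u \<in> Dc" "v \<in> Dc" and I: "AE x in M. v x - u x \<in> I"
  note L = Dc_L2[OF uv(1)] Dc_L2[OF uv(2)] T_L2[OF assms(2) uv(1)] T_L2[OF assms(2) uv(2)]
  have "l2_norm M (defect (T t u) (T t v)) \<le> 0 + e" if "e > 0" for e
  proof -
    obtain f where f: "f \<in> op_dom A" "l2_dist M u f < e / 4"
      using op_dom_dense[OF uv(1), of "e / 4"] \<open>e > 0\<close> by auto
    obtain g where g: "g \<in> op_dom A" "l2_dist M v g < e / 4"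
      using op_dom_dense[OF uv(2), of "e / 4"] \<open>e > 0\<close> by auto
    note fg = op_dom_Dc[OF f(1)] op_dom_Dc[OF g(1)]
    note fgL = Dc_L2[OF fg(1)] Dc_L2[OF fg(2)] T_L2[OF assms(2) fg(1)] T_L2[OF assms(2) fg(2)]
    have diff: "l2_dist M (\<lambda>x. b x - a x) (\<lambda>x. b' x - a' x) \<le> l2_dist M a a' + l2_dist M b b'"
      if "a \<in> L2 M" "a' \<in> L2 M" "b \<in> L2 M" "b' \<in> L2 M" for a a' b b'
      using that by (intro l2_dist_le_sum) auto
    let ?k = "\<lambda>x. c (T t g x - T t f x)"
    have kL: "?k \<in> L2 M" using fgL by simp
    have "l2_norm M (defect (T t u) (T t v)) \<le> l2_dist M (\<lambda>x. T t v x - T t u x) ?k"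
      using L kL by (intro defect_norm_le) (auto simp: clamp_in)
    also have "\<dots> \<le> l2_dist M (\<lambda>x. T t v x - T t u x) (\<lambda>x. T t g x - T t f x)
        + l2_dist M (\<lambda>x. T t g x - T t f x) ?k"
      using L fgL kL by (intro l2_dist_triangle) auto
    also have "l2_dist M (\<lambda>x. T t v x - T t u x) (\<lambda>x. T t g x - T t f x) \<le> e / 4 + e / 4"
      using diff[OF L(3) fgL(3) L(4) fgL(4)] T_nonexpansive[OF assms(2) uv(1) fg(1)]
        T_nonexpansive[OF assms(2) uv(2) fg(2)] f g by linarith
    also have "l2_dist M (\<lambda>x. T t g x - T t f x) ?k = l2_norm M (defect (T t f) (T t g))"
      unfolding l2_dist_commute[of M _ ?k] by (simp add: l2_dist_def defect_def[abs_def])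
    also have "\<dots> \<le> l2_norm M (defect f g)"
      by (rule defect_nonincreasing[OF assms(1) f(1) g(1) assms(2)])
    also have "\<dots> \<le> l2_dist M (\<lambda>x. g x - f x) (\<lambda>x. v x - u x)"
      using fgL L I by (intro defect_norm_le) auto
    also have "\<dots> \<le> e / 4 + e / 4"
      using diff[OF fgL(1) L(1) fgL(2) L(2)] f g by (simp add: l2_dist_commute)
    finally show ?thesis by simp
  qed
  then have "l2_norm M (defect (T t u) (T t v)) \<le> 0" by (rule field_le_epsilon)
  then have "l2_norm M (defect (T t u) (T t v)) = 0" by (simp add: order_antisym)
  then have "l2_inner M (defect (T t u) (T t v)) (defect (T t u) (T t v)) \<le> 0"
    by (simp flip: l2_norm_square)
  then show "AE x in M. T t v x - T t u x \<in> I" using L by (intro defect_zero_in)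
qed

text \<open>If the energy increased under the projection, the evolution inequality would move \<open>T t (p, q)\<close>
  closer to \<open>(u, v)\<close> than its projection \<open>(p, q)\<close>.\<close>

lemma energy_contracted_if_semigroup_invariant:
  assumes inv: "\<And>t. 0 \<le> t \<Longrightarrow> invariant Dc (T t)"
    and proj: "\<And>u v. u \<in> D \<Longrightarrow> v \<in> D \<Longrightarrow> proj1 u v \<in> Dc \<and> proj2 u v \<in> Dc"
  shows energy_contracted
  unfolding energy_contracted_def
proof (intro ballI)
  fix u v assume L: "u \<in> L2 M" "v \<in> L2 M"
  show "E (proj1 u v) + E (proj2 u v) \<le> E u + E v"
  proof (cases "u \<in> D \<and> v \<in> D")
    case True
    then have uv: "u \<in> D" "v \<in> D" by auto
    define p where "p = proj1 u v"
    define q where "q = proj2 u v"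
    have pq: "p \<in> Dc" "q \<in> Dc" using proj[OF uv] by (auto simp: p_def q_def)
    note pqL = Dc_L2[OF pq(1)] Dc_L2[OF pq(2)]
    have "E p + E q \<le> ereal (val u + val v)"
    proof (rule ccontr)
      assume "\<not> ?thesis"
      then have "ereal (val u + val v) < E p + E q" by simp
      then obtain r s where rs: "ereal r < E p" "ereal s < E q" "val u + val v < r + s"
        using ereal_split_less_sum[OF E_not_MInf[OF pqL(1)] E_not_MInf[OF pqL(2)]] by blast
      obtain t1 where t1: "t1 > 0" "\<And>t. 0 < t \<Longrightarrow> t \<le> t1 \<Longrightarrow>
          (l2_dist M (T t p) u)\<^sup>2 / 2 \<le> (l2_dist M p u)\<^sup>2 / 2 + (val u - r) * t"
        using evolution_inequality[OF pq(1) uv(1) rs(1)] by blast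
      obtain t2 where t2: "t2 > 0" "\<And>t. 0 < t \<Longrightarrow> t \<le> t2 \<Longrightarrow>
          (l2_dist M (T t q) v)\<^sup>2 / 2 \<le> (l2_dist M q v)\<^sup>2 / 2 + (val v - s) * t"
        using evolution_inequality[OF pq(2) uv(2) rs(2)] by blast
      define t where "t = min t1 t2"
      have t: "0 < t" "t \<le> t1" "t \<le> t2" using t1 t2 by (auto simp: t_def)
      have "(p, q) \<in> constraint M" unfolding p_def q_def by (rule proj_constraint[OF L])
      then have "AE x in M. q x - p x \<in> I" by (simp add: constraint_def)
      then have "AE x in M. T t q x - T t p x \<in> I"
        using inv[of t] t pq by (auto simp: invariant_def)
      then have "(T t p, T t q) \<in> constraint M" using t pq T_L2 by (simp add: constraint_def)
      then have "(l2_dist M u p)\<^sup>2 + (l2_dist M v q)\<^sup>2 \<le> (l2_dist M u (T t p))\<^sup>2 + (l2_dist M v (T t q))\<^sup>2"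
        using proj_is_metric_projection[OF L]
        by (simp add: is_metric_projection_def p_def q_def flip: l2sum_dist_le_iff)
      moreover have "((val u - r) + (val v - s)) * t < 0"
        using rs(3) t(1) by (intro mult_neg_pos) auto
      ultimately show False
        using t1(2)[OF t(1,2)] t2(2)[OF t(1,3)]
        unfolding l2_dist_commute[of M u] l2_dist_commute[of M v] distrib_right by linarith
    qed
    then show ?thesis using uv by (simp add: E_val p_def q_def)
  next
    case False
    then have top: "E u + E v = \<infinity>" using L E_not_MInf by (auto simp: E_not_D)
    show ?thesis unfolding top by simp
  qed
qed

text \<open>The domain of \<open>A\<close> is dense in the closed domain of \<open>E\<close>, so
  \<open>Q\<close> projects onto a product and is realized by \<open>J 0\<close> in each
  component.\<close>

lemma closure_op_dom_pairs:
  "closure_in (l2sum_dist M) (L2 M \<times> L2 M) (op_dom A \<times> op_dom A) = Dc \<times> Dc"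
proof (intro equalityI subsetI)
  have dist: "l2sum_dist M (a, b) (p, q) = sqrt ((l2_dist M a p)\<^sup>2 + (l2_dist M b q)\<^sup>2)" for a b p q
    by (simp add: l2sum_dist_def l2sum_inner_def pair_diff_def l2_dist_def l2_norm_square)
  show "z \<in> Dc \<times> Dc" if "z \<in> closure_in (l2sum_dist M) (L2 M \<times> L2 M) (op_dom A \<times> op_dom A)" for z
  proof -
    obtain a b where z: "z = (a, b)" by (cases z)
    have ab: "a \<in> L2 M" "b \<in> L2 M" using that by (auto simp: z closure_in_def)
    have ex: "\<exists>p\<in>D. \<exists>q\<in>D. l2_dist M a p < e \<and> l2_dist M b q < e" if "e > 0" for e
    proof -
      obtain p q where pq: "p \<in> op_dom A" "q \<in> op_dom A" "l2sum_dist M (a, b) (p, q) < e"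
        using \<open>z \<in> _\<close> \<open>e > 0\<close> unfolding z closure_in_def by auto
      have "l2_dist M a p \<le> l2sum_dist M (a, b) (p, q)" "l2_dist M b q \<le> l2sum_dist M (a, b) (p, q)"
        unfolding dist by (auto intro: real_le_rsqrt)
      then show ?thesis using pq op_dom_D by (meson le_less_trans)
    qed
    show ?thesis unfolding z using ex by (auto intro!: DcI ab; meson)
  qed
  show "z \<in> closure_in (l2sum_dist M) (L2 M \<times> L2 M) (op_dom A \<times> op_dom A)" if zD: "z \<in> Dc \<times> Dc" for z
  proof -
    obtain a b where z: "z = (a, b)" "a \<in> Dc" "b \<in> Dc" using zD by auto
    have "\<exists>w\<in>op_dom A \<times> op_dom A. l2sum_dist M z w < e" if "e > 0" for e
    proof -
      obtain p where p: "p \<in> op_dom A" "l2_dist M a p < e / 2"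
        using op_dom_dense[OF z(2), of "e / 2"] \<open>e > 0\<close> by auto
      obtain q where q: "q \<in> op_dom A" "l2_dist M b q < e / 2"
        using op_dom_dense[OF z(3), of "e / 2"] \<open>e > 0\<close> by auto
      have "l2sum_dist M (a, b) (p, q) \<le> l2_dist M a p + l2_dist M b q"
        unfolding dist by (rule sqrt_sum_squares_le_sum) auto
      then have "l2sum_dist M z (p, q) < e" using p q z by simp
      then show ?thesis using p q by blast
    qed
    then show ?thesis using z Dc_L2 by (simp add: closure_in_def)
  qed
qed

text \<open>For closed convex sets, \<open>Q C \<subseteq> C\<close> forces the projection onto \<open>C\<close> to preserve the range of \<open>Q\<close>:
  with \<open>w\<close> in that range, the variational inequalities at \<open>P w\<close> and at \<open>Q (P w)\<close> yield \<open>Q (P w) = P w\<close>.\<close>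

lemma proj_Dc_if_projection_invariant:
  assumes Q: "metric_projection (l2sum_dist M)
      (closure_in (l2sum_dist M) (L2 M \<times> L2 M) (op_dom A \<times> op_dom A)) ` constraint M \<subseteq> constraint M"
    and uv: "u \<in> D" "v \<in> D"
  shows "proj1 u v \<in> Dc \<and> proj2 u v \<in> Dc"
proof -
  note L = D_L2[OF uv(1)] D_L2[OF uv(2)]
  define p where "p = proj1 u v"
  define q where "q = proj2 u v"
  have pqL: "p \<in> L2 M" "q \<in> L2 M" using L by (auto simp: p_def q_def)
  \<comment> \<open>A projection has to be exhibited before anything is known about the element that
    the choice operator picks.\<close>
  have "is_metric_projection (l2sum_dist M) (Dc \<times> Dc) (p, q) (J 0 p, J 0 q)"
    unfolding is_metric_projection_def
  proof (intro conjI ballI)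
    fix z assume "z \<in> Dc \<times> Dc"
    then obtain a b where z: "z = (a, b)" "a \<in> Dc" "b \<in> Dc" by auto
    show "l2sum_dist M (p, q) (J 0 p, J 0 q) \<le> l2sum_dist M (p, q) z"
      unfolding z(1) l2sum_dist_le_iff using J_0_le pqL z by (intro add_mono power_mono) auto
  qed (use J_0 pqL in simp)
  then have proj: "is_metric_projection (l2sum_dist M) (Dc \<times> Dc) (p, q)
      (metric_projection (l2sum_dist M) (Dc \<times> Dc) (p, q))"
    unfolding metric_projection_def by (rule someI)
  obtain a b where ab: "metric_projection (l2sum_dist M) (Dc \<times> Dc) (p, q) = (a, b)"
    by (cases "metric_projection (l2sum_dist M) (Dc \<times> Dc) (p, q)")
  have abD: "a \<in> Dc" "b \<in> Dc"
    and min: "\<And>a' b'. a' \<in> Dc \<Longrightarrow> b' \<in> Dc \<Longrightarrow>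
      (l2_dist M p a)\<^sup>2 + (l2_dist M q b)\<^sup>2 \<le> (l2_dist M p a')\<^sup>2 + (l2_dist M q b')\<^sup>2"
    using proj unfolding ab is_metric_projection_def by (auto simp flip: l2sum_dist_le_iff)
  note abL = Dc_L2[OF abD(1)] Dc_L2[OF abD(2)]
  have "(p, q) \<in> constraint M" unfolding p_def q_def by (rule proj_constraint[OF L])
  then have "(a, b) \<in> constraint M"
    using Q unfolding closure_op_dom_pairs ab[symmetric] by blast
  note pyth = proj_pythagoras[OF L this, folded p_def q_def]
  \<comment> \<open>\<open>X \<le> 0\<close> is the variational inequality of the projection
    \<open>(a, b)\<close> at the test point \<open>(u, v)\<close>; moving a fraction
    \<open>s\<close> towards that point gives \<open>2 * X \<le> s * Y\<close>.\<close>
  define X where "X = l2_inner M (\<lambda>x. p x - a x) (\<lambda>x. u x - a x) + l2_inner M (\<lambda>x. q x - b x) (\<lambda>x. v x - b x)"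
  define Y where "Y = (l2_dist M u a)\<^sup>2 + (l2_dist M v b)\<^sup>2"
  have XY: "2 * X \<le> s * Y" if s: "0 < s" "s \<le> 1" for s
  proof -
    have expand: "(l2_dist M f (\<lambda>x. (1 - s) * g x + s * h x))\<^sup>2 = (l2_dist M f g)\<^sup>2
        - 2 * s * l2_inner M (\<lambda>x. f x - g x) (\<lambda>x. h x - g x) + s\<^sup>2 * (l2_dist M h g)\<^sup>2"
      if "f \<in> L2 M" "g \<in> L2 M" "h \<in> L2 M" for f g h
    proof -
      define y where "y = (\<lambda>x. f x - g x)"
      define z where "z = (\<lambda>x. h x - g x)"
      have "(\<lambda>x. f x - ((1 - s) * g x + s * h x)) = (\<lambda>x. y x - s * z x)"
        by (auto simp: y_def z_def algebra_simps)
      moreover have "y \<in> L2 M" "z \<in> L2 M" using that by (auto simp: y_def z_def)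
      ultimately show ?thesis
        unfolding l2_dist_def l2_norm_square y_def[symmetric] z_def[symmetric]
        by (simp add: l2_inner_simps l2_inner_commute[of M z y] power2_eq_square algebra_simps)
    qed
    have "(l2_dist M p a)\<^sup>2 + (l2_dist M q b)\<^sup>2
        \<le> (l2_dist M p (\<lambda>x. (1 - s) * a x + s * u x))\<^sup>2 + (l2_dist M q (\<lambda>x. (1 - s) * b x + s * v x))\<^sup>2"
      using uv abD s by (intro min Dc_convex abD D_Dc[OF uv(1)] D_Dc[OF uv(2)]) auto
    then have "0 \<le> s * (s * Y - 2 * X)"
      unfolding expand[OF pqL(1) abL(1) L(1)] expand[OF pqL(2) abL(2) L(2)] X_def Y_def
      by (simp add: power2_eq_square algebra_simps)
    then show ?thesis using s(1) by (simp add: zero_le_mult_iff)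
  qed
  have "2 * X \<le> 0 + e" if "e > 0" for e
  proof -
    \<comment> \<open>Adding 1 keeps the denominator positive when \<open>Y\<close> is 0, and
      \<open>s * Y\<close> is at most \<open>e\<close>.\<close>
    define s where "s = min 1 (e / (Y + 1))"
    have Y: "0 \<le> Y" by (simp add: Y_def)
    have s: "0 < s" "s \<le> 1" using that Y by (auto simp: s_def)
    have "s * Y \<le> e / (Y + 1) * (Y + 1)" using Y s that by (intro mult_mono) (auto simp: s_def)
    then show ?thesis using XY[OF s] Y by simp
  qed
  then have "2 * X \<le> 0" by (rule field_le_epsilon)
  moreover have "(l2_dist M u a)\<^sup>2 = (l2_dist M u p)\<^sup>2 - (l2_dist M p a)\<^sup>2 + 2 * l2_inner M (\<lambda>x. p x - a x) (\<lambda>x. u x - a x)"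
    "(l2_dist M v b)\<^sup>2 = (l2_dist M v q)\<^sup>2 - (l2_dist M q b)\<^sup>2 + 2 * l2_inner M (\<lambda>x. q x - b x) (\<lambda>x. v x - b x)"
    unfolding l2_dist_def l2_norm_square using L pqL abL
    by (simp_all add: l2_inner_simps l2_inner_commute[of M p u] l2_inner_commute[of M a u]
        l2_inner_commute[of M a p] l2_inner_commute[of M q v] l2_inner_commute[of M b v]
        l2_inner_commute[of M b q])
  \<comment> \<open>Inserting the two identities into \<open>pyth\<close> leaves the sum of squares
    at most \<open>X\<close>.\<close>
  ultimately have "(l2_dist M p a)\<^sup>2 + (l2_dist M q b)\<^sup>2 \<le> 0"
    using pyth by (simp add: X_def)
  then have "l2_dist M p a = 0" "l2_dist M q b = 0" by (simp_all add: sum_power2_le_zero_iff)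
  then have "ae_eq M a p" "ae_eq M b q" using pqL abL by (auto simp: l2_dist_eq_0 intro: ae_eq_sym)
  then show ?thesis using Dc_cong abD pqL unfolding p_def q_def by blast
qed

text \<open>Two cycles meet in \<open>energy_contracted\<close>: one through the resolvent and the
  reflection, the other through the generator and the semigroup, closed with the hypothesis on the
  projection.\<close>

lemma constraint_equivalences:
  assumes Q: "metric_projection (l2sum_dist M)
      (closure_in (l2sum_dist M) (L2 M \<times> L2 M) (op_dom A \<times> op_dom A)) ` constraint M \<subseteq> constraint M"
  shows "(\<forall>t\<ge>0. invariant Dc (T t)) \<longleftrightarrow> energy_contracted"
    and "generator_condition \<longleftrightarrow> energy_contracted"
    and "(\<forall>l\<ge>0. invariant (L2 M) (J l)) \<longleftrightarrow> energy_contracted"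
    and "energy_reflected \<longleftrightarrow> energy_contracted"
proof -
  have TE: energy_contracted if "\<forall>t\<ge>0. invariant Dc (T t)"
    using that proj_Dc_if_projection_invariant[OF Q]
    by (intro energy_contracted_if_semigroup_invariant) auto
  have EJ: "\<forall>l\<ge>0. invariant (L2 M) (J l)" if energy_contracted
    using resolvent_invariant_if_contracted_pos[OF that] resolvent_invariant_if_contracted_0[OF that]
    by (metis order_le_less)
  have JR: energy_reflected if "\<forall>l\<ge>0. invariant (L2 M) (J l)"
    using that by (intro energy_reflected_if_resolvent_invariant) auto
  show "(\<forall>t\<ge>0. invariant Dc (T t)) \<longleftrightarrow> energy_contracted"
    "generator_condition \<longleftrightarrow> energy_contracted"
    "(\<forall>l\<ge>0. invariant (L2 M) (J l)) \<longleftrightarrow> energy_contracted"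
    "energy_reflected \<longleftrightarrow> energy_contracted"
    using TE EJ JR energy_contracted_if_reflected generator_condition_if_contracted
      semigroup_invariant_if_generator_condition by blast+
qed

section \<open>Translation of the named conditions into the interval setting\<close>

lemma invariant_iff:
  assumes "S \<subseteq> L2 M" "\<And>f. f \<in> S \<Longrightarrow> B f \<in> L2 M"
  shows "map_prod B B ` ((S \<times> S) \<inter> constraint M) \<subseteq> constraint M \<longleftrightarrow> invariant S B"
proof -
  have "(u, v) \<in> constraint M \<longleftrightarrow> (AE x in M. v x - u x \<in> I)"
    "(B u, B v) \<in> constraint M \<longleftrightarrow> (AE x in M. B v x - B u x \<in> I)" if "u \<in> S" "v \<in> S" for u v
    using that assms by (auto simp: constraint_def)
  then have "invariant S B \<longleftrightarrow> (\<forall>u\<in>S. \<forall>v\<in>S. (u, v) \<in> constraint M \<longrightarrow> (B u, B v) \<in> constraint M)"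
    by (simp add: invariant_def)
  then show ?thesis by auto
qed

lemma energy_contracted_iff:
  "(\<forall>w\<in>L2 M \<times> L2 M. E_sum E (metric_projection (l2sum_dist M) (constraint M) w) \<le> E_sum E w)
    \<longleftrightarrow> energy_contracted"
proof -
  have "E_sum E (metric_projection (l2sum_dist M) (constraint M) (u, v)) = E (proj1 u v) + E (proj2 u v)"
    if uv: "u \<in> L2 M" "v \<in> L2 M" for u v
  proof -
    obtain p q where *: "metric_projection (l2sum_dist M) (constraint M) (u, v) = (p, q)"
      "p \<in> L2 M" "q \<in> L2 M" "ae_eq M p (proj1 u v)" "ae_eq M q (proj2 u v)"
      using metric_projection_constraint[OF uv] .
    then show ?thesis using E_cong[of p "proj1 u v"] E_cong[of q "proj2 u v"] uv by (simp add: E_sum_def)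
  qed
  then show ?thesis by (auto simp: energy_contracted_def E_sum_def)
qed

lemma generator_condition_iff:
  "(\<forall>w\<in>op_dom A \<times> op_dom A. 0 \<le> l2sum_inner M (map_prod (minimal_section M A) (minimal_section M A) w)
      (pair_diff w (metric_projection (l2sum_dist M) (constraint M) w))) \<longleftrightarrow> generator_condition"
proof -
  have "l2sum_inner M (map_prod (minimal_section M A) (minimal_section M A) (u, v))
      (pair_diff (u, v) (metric_projection (l2sum_dist M) (constraint M) (u, v)))
    = - l2_inner M (\<lambda>x. minimal_section M A v x - minimal_section M A u x) (defect u v) / 2"
    if uv: "u \<in> op_dom A" "v \<in> op_dom A" for u v
  proof -
    note L = D_L2[OF op_dom_D[OF uv(1)]] D_L2[OF op_dom_D[OF uv(2)]]
    note ms = A_L2[OF minimal_section_in[OF uv(1)]] A_L2[OF minimal_section_in[OF uv(2)]]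
    obtain p q where pq: "metric_projection (l2sum_dist M) (constraint M) (u, v) = (p, q)"
      "p \<in> L2 M" "q \<in> L2 M" "ae_eq M p (proj1 u v)" "ae_eq M q (proj2 u v)"
      using metric_projection_constraint[OF L] .
    have "l2_inner M (minimal_section M A u) (\<lambda>x. u x - p x)
        = l2_inner M (minimal_section M A u) (\<lambda>x. u x - proj1 u v x)"
      "l2_inner M (minimal_section M A v) (\<lambda>x. v x - q x)
        = l2_inner M (minimal_section M A v) (\<lambda>x. v x - proj2 u v x)"
      using pq L ms by (auto intro!: l2_inner_cong simp: ae_eq_def)
    then show ?thesis
      using L ms by (simp add: pq l2sum_inner_def pair_diff_def proj1_def proj2_def l2_inner_simps diff_divide_distrib)
  qed
  then show ?thesis by (auto simp: generator_condition_def)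
qed

end

section \<open>Order preservation and contraction in the supremum norm\<close>

lemma clamp_nonneg: "clamp {0..} (max 0 :: real \<Rightarrow> real)"
proof
  show "0 \<le> (d - max 0 d) * (max 0 d - i)" if "i \<in> {0..}" for i d :: real
    using that by (auto simp: max_def mult_nonpos_nonneg)
qed auto

text \<open>\<open>enn2real top\<close> is 0, so without the case distinction the infinite bound
  would clamp everything to 0.\<close>

definition clamp_abs :: "ennreal \<Rightarrow> real \<Rightarrow> real" where
  "clamp_abs \<alpha> d = (if \<alpha> = top then d else max (- enn2real \<alpha>) (min (enn2real \<alpha>) d))"

lemma clamp_clamp_abs: "clamp {d. ennreal \<bar>d\<bar> \<le> \<alpha>} (clamp_abs \<alpha>)"
proof (cases \<alpha>)
  case (real r)
  then have *: "{d. ennreal \<bar>d\<bar> \<le> \<alpha>} = {-r..r}" "clamp_abs \<alpha> = (\<lambda>d. max (- r) (min r d))"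
    by (auto simp: clamp_abs_def)
  show ?thesis unfolding *
  proof
    show "0 \<le> (d - max (- r) (min r d)) * (max (- r) (min r d) - i)" if "i \<in> {-r..r}" for i d :: real
      using that by (auto simp: max_def min_def mult_nonpos_nonpos)
  qed (use real in auto)
next
  case top
  then have *: "{d. ennreal \<bar>d\<bar> \<le> \<alpha>} = UNIV" "clamp_abs \<alpha> = (\<lambda>d. d)"
    by (auto simp: clamp_abs_def)
  show ?thesis unfolding * by standard auto
qed

lemma all_equivalentI: "(\<And>P. P \<in> set Ps \<Longrightarrow> P \<longleftrightarrow> R) \<Longrightarrow> all_equivalent Ps"
  by (auto simp: all_equivalent_def)

lemma all_equivalentD: "all_equivalent Ps \<Longrightarrow> P \<in> set Ps \<Longrightarrow> Q \<in> set Ps \<Longrightarrow> P \<longleftrightarrow> Q"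
  by (auto simp: all_equivalent_def)

text \<open>The bound linking both forms is the essential supremum of the absolute difference of
  \<open>u\<close> and \<open>v\<close>, which may be infinite and is still an admissible index of
  \<open>C_alpha\<close>.\<close>

lemma Linf_contraction_iff:
  assumes "S \<subseteq> L2 M" "\<And>f. f \<in> S \<Longrightarrow> B f \<in> L2 M"
  shows "cond_M2 M S B \<longleftrightarrow> cond_M2' M S B"
proof
  have meas: "(\<lambda>x. ennreal \<bar>f x - g x\<bar>) \<in> borel_measurable M" if "f \<in> L2 M" "g \<in> L2 M" for f g
    using L2_measurable[OF L2_diff[OF that]] by simp
  show "cond_M2' M S B" if *: "cond_M2 M S B"
  proof -
    have contr: "AE x in M. ennreal \<bar>B u x - B v x\<bar> \<le> \<alpha>"
      if uv: "u \<in> S" "v \<in> S" "AE x in M. ennreal \<bar>u x - v x\<bar> \<le> \<alpha>" for u v \<alpha>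
    proof -
      have "Linf_norm M (\<lambda>x. B u x - B v x) \<le> Linf_norm M (\<lambda>x. u x - v x)"
        using * uv by (simp add: cond_M2_def)
      also have "\<dots> \<le> \<alpha>"
        unfolding Linf_norm_def using uv assms(1) by (intro esssup_I meas) auto
      finally have le: "Linf_norm M (\<lambda>x. B u x - B v x) \<le> \<alpha>" .
      have "AE x in M. ennreal \<bar>B u x - B v x\<bar> \<le> Linf_norm M (\<lambda>x. B u x - B v x)"
        unfolding Linf_norm_def by (rule esssup_AE)
      then show ?thesis by eventually_elim (rule order_trans[OF _ le])
    qed
    show ?thesis
      unfolding cond_M2'_def
    proof (intro allI subsetI)
      fix \<alpha> z assume "z \<in> map_prod B B ` ((S \<times> S) \<inter> C_alpha M \<alpha>)"
      then obtain u v where "z = (B u, B v)" "u \<in> S" "v \<in> S" "AE x in M. ennreal \<bar>u x - v x\<bar> \<le> \<alpha>"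
        by (auto simp: C_alpha_def)
      then show "z \<in> C_alpha M \<alpha>" using contr assms(2) by (simp add: C_alpha_def)
    qed
  qed
  show "cond_M2 M S B" if *: "cond_M2' M S B"
    unfolding cond_M2_def
  proof (intro ballI)
    fix u v assume uv: "u \<in> S" "v \<in> S"
    let ?\<alpha> = "Linf_norm M (\<lambda>x. u x - v x)"
    have "AE x in M. ennreal \<bar>u x - v x\<bar> \<le> ?\<alpha>"
      unfolding Linf_norm_def by (rule esssup_AE)
    then have "(u, v) \<in> (S \<times> S) \<inter> C_alpha M ?\<alpha>" using uv assms by (auto simp: C_alpha_def)
    then have "map_prod B B (u, v) \<in> C_alpha M ?\<alpha>" using * unfolding cond_M2'_def by blast
    then have "AE x in M. ennreal \<bar>B u x - B v x\<bar> \<le> ?\<alpha>" by (simp add: C_alpha_def)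
    then show "Linf_norm M (\<lambda>x. B u x - B v x) \<le> ?\<alpha>"
      unfolding Linf_norm_def[of M "\<lambda>x. B u x - B v x"]
      using uv assms by (intro esssup_I meas) auto
  qed
qed

context energy_flow
begin

lemma order_equivalences:
  assumes Q: "metric_projection (l2sum_dist M)
      (closure_in (l2sum_dist M) (L2 M \<times> L2 M) (op_dom A \<times> op_dom A)) ` C_le M \<subseteq> C_le M"
  shows "all_equivalent
    [\<forall>t\<ge>0. cond_M1 M Dc (T t), \<forall>t\<ge>0. cond_M1' M Dc (T t), cond_A7' M A,
     \<forall>l\<ge>0. cond_M1 M (L2 M) (J l), \<forall>l\<ge>0. cond_M1' M (L2 M) (J l), cond_E7 M E, cond_E7' M E]"
proof -
  interpret clamp "{0..}" "max 0 :: real \<Rightarrow> real" by (rule clamp_nonneg)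
  interpret constrained_flow M E J "{0..}" "max 0" T by unfold_locales
  have C: "constraint M = C_le M" by (simp add: constraint_def C_le_def)
  note eqv = constraint_equivalences[unfolded C, OF Q]
  have M1: "cond_M1 M S B \<longleftrightarrow> invariant S B" for S B
    by (simp add: cond_M1_def invariant_def)
  have M1': "cond_M1' M S B \<longleftrightarrow> invariant S B" if "S \<subseteq> L2 M" "\<And>f. f \<in> S \<Longrightarrow> B f \<in> L2 M" for S B
    unfolding cond_M1'_def C[symmetric] by (rule invariant_iff[OF that])
  have T': "(\<forall>t\<ge>0. cond_M1' M Dc (T t)) \<longleftrightarrow> (\<forall>t\<ge>0. invariant Dc (T t))"
    using M1'[of Dc] Dc_L2 T_L2 by (metis subsetI)
  have J': "(\<forall>l\<ge>0. cond_M1' M (L2 M) (J l)) \<longleftrightarrow> (\<forall>l\<ge>0. invariant (L2 M) (J l))"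
    using M1'[of "L2 M"] J_L2 J_0 Dc_L2 by (metis order_le_less subset_refl)
  have A7: "cond_A7' M A \<longleftrightarrow> generator_condition"
    unfolding cond_A7'_def P_le_def C[symmetric] by (rule generator_condition_iff)
  have E7: "cond_E7 M E \<longleftrightarrow> energy_contracted"
    unfolding cond_E7_def P_le_def C[symmetric] by (rule energy_contracted_iff)
  \<comment> \<open>For \<open>c = max 0\<close> the defect is the positive part of
    \<open>u - v\<close>.\<close>
  have refl: "refl1 u v = (\<lambda>x. min (u x) (v x))" "refl2 u v = (\<lambda>x. max (u x) (v x))" for u v :: "'a \<Rightarrow> real"
    by (auto simp: refl1_def refl2_def defect_def max_def min_def)
  have E7': "cond_E7' M E \<longleftrightarrow> energy_reflected"
  proof -
    have "E f + E g \<le> E u + E v \<longleftrightarrow> val g + val f \<le> val u + val v"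
      if "f \<in> D" "g \<in> D" "u \<in> D" "v \<in> D" for f g u v
      using that by (simp add: E_val add.commute)
    then show ?thesis unfolding cond_E7'_def energy_reflected_def refl by blast
  qed
  show ?thesis
    by (rule all_equivalentI[of _ energy_contracted]) (auto simp: M1 T' J' A7 E7 E7' eqv)
qed

lemma sup_norm_equivalences:
  assumes Q: "\<And>\<alpha>. metric_projection (l2sum_dist M)
      (closure_in (l2sum_dist M) (L2 M \<times> L2 M) (op_dom A \<times> op_dom A)) ` C_alpha M \<alpha> \<subseteq> C_alpha M \<alpha>"
  shows "all_equivalent
    [\<forall>t\<ge>0. cond_M2 M Dc (T t), \<forall>t\<ge>0. cond_M2' M Dc (T t), cond_A8' M A,
     \<forall>l\<ge>0. cond_M2 M (L2 M) (J l), \<forall>l\<ge>0. cond_M2' M (L2 M) (J l), cond_E8 M E, cond_E8' M E]"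
proof -
  interpret cf: clamp "{d. ennreal \<bar>d\<bar> \<le> \<alpha>}" "clamp_abs \<alpha>" for \<alpha> by (rule clamp_clamp_abs)
  interpret cf: constrained_flow M E J "{d. ennreal \<bar>d\<bar> \<le> \<alpha>}" "clamp_abs \<alpha>" T for \<alpha> by unfold_locales
  have C: "cf.constraint \<alpha> M = C_alpha M \<alpha>" for \<alpha>
    by (simp add: cf.constraint_def C_alpha_def abs_minus_commute)
  have eqv: "(\<forall>t\<ge>0. cf.invariant \<alpha> Dc (T t)) \<longleftrightarrow> cf.energy_contracted \<alpha>"
    "cf.generator_condition \<alpha> \<longleftrightarrow> cf.energy_contracted \<alpha>"
    "(\<forall>l\<ge>0. cf.invariant \<alpha> (L2 M) (J l)) \<longleftrightarrow> cf.energy_contracted \<alpha>"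
    "cf.energy_reflected \<alpha> \<longleftrightarrow> cf.energy_contracted \<alpha>" for \<alpha>
    using Q[of \<alpha>] by (intro cf.constraint_equivalences; simp only: C)+
  have M2': "cond_M2' M S B \<longleftrightarrow> (\<forall>\<alpha>. cf.invariant \<alpha> S B)"
    if "S \<subseteq> L2 M" "\<And>f. f \<in> S \<Longrightarrow> B f \<in> L2 M" for S B
  proof -
    have "map_prod B B ` ((S \<times> S) \<inter> C_alpha M \<alpha>) \<subseteq> C_alpha M \<alpha> \<longleftrightarrow> cf.invariant \<alpha> S B" for \<alpha>
      unfolding C[symmetric] by (rule cf.invariant_iff[OF that])
    then show ?thesis by (simp add: cond_M2'_def)
  qed
  have T': "(\<forall>t\<ge>0. cond_M2' M Dc (T t)) \<longleftrightarrow> (\<forall>\<alpha>. \<forall>t\<ge>0. cf.invariant \<alpha> Dc (T t))"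
    using M2'[of Dc] Dc_L2 T_L2 by (metis subsetI)
  have JL: "J l f \<in> L2 M" if "0 \<le> l" "f \<in> L2 M" for l f
    using that J_L2 J_0 Dc_L2 by (metis order_le_less)
  have J': "(\<forall>l\<ge>0. cond_M2' M (L2 M) (J l)) \<longleftrightarrow> (\<forall>\<alpha>. \<forall>l\<ge>0. cf.invariant \<alpha> (L2 M) (J l))"
    using M2'[of "L2 M"] JL by (metis subset_refl)
  have T: "(\<forall>t\<ge>0. cond_M2 M Dc (T t)) \<longleftrightarrow> (\<forall>t\<ge>0. cond_M2' M Dc (T t))"
    using Linf_contraction_iff[of Dc] Dc_L2 T_L2 by (metis subsetI)
  have J: "(\<forall>l\<ge>0. cond_M2 M (L2 M) (J l)) \<longleftrightarrow> (\<forall>l\<ge>0. cond_M2' M (L2 M) (J l))"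
    using Linf_contraction_iff[of "L2 M"] JL by (metis subset_refl)
  have A8: "cond_A8' M A \<longleftrightarrow> (\<forall>\<alpha>. cf.generator_condition \<alpha>)"
    unfolding cond_A8'_def P_alpha_def C[symmetric] cf.generator_condition_iff ..
  have E8: "cond_E8 M E \<longleftrightarrow> (\<forall>\<alpha>. cf.energy_contracted \<alpha>)"
    unfolding cond_E8_def P_alpha_def C[symmetric] cf.energy_contracted_iff[symmetric] by blast
  \<comment> \<open>The reflections are \<open>v - c (v - u)\<close> and
    \<open>u + c (v - u)\<close>.\<close>
  have refl: "cf.refl1 (ennreal \<alpha>) u v = (\<lambda>x. H_cut \<alpha> (u x) (v x))"
    "cf.refl2 (ennreal \<alpha>) u v = (\<lambda>x. H_cut \<alpha> (v x) (u x))"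
    if "0 < \<alpha>" for \<alpha> and u v :: "'a \<Rightarrow> real"
    using that by (auto simp: fun_eq_iff cf.refl1_def cf.refl2_def cf.defect_def clamp_abs_def H_cut_def)
  have E8': "cond_E8' M E \<longleftrightarrow> (\<forall>\<alpha>>0. cf.energy_reflected (ennreal \<alpha>))"
  proof -
    have "E f + E g \<le> E u + E v \<longleftrightarrow> val f + val g \<le> val u + val v"
      if "f \<in> D" "g \<in> D" "u \<in> D" "v \<in> D" for f g u v
      using that by (simp add: E_val)
    then have "cf.energy_reflected (ennreal \<alpha>) \<longleftrightarrow> (\<forall>u\<in>D. \<forall>v\<in>D.
        (\<lambda>x. H_cut \<alpha> (u x) (v x)) \<in> D \<and> (\<lambda>x. H_cut \<alpha> (v x) (u x)) \<in> D \<and>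
        E (\<lambda>x. H_cut \<alpha> (u x) (v x)) + E (\<lambda>x. H_cut \<alpha> (v x) (u x)) \<le> E u + E v)" if "0 < \<alpha>" for \<alpha>
      unfolding cf.energy_reflected_def refl[OF that] by blast
    then show ?thesis unfolding cond_E8'_def by blast
  qed
  \<comment> \<open>\<open>cond_E8'\<close> covers real bounds above 0. At 0 the reflection
    exchanges \<open>u\<close> and \<open>v\<close>; at \<open>top\<close> the projection is the
    identity.\<close>
  have "cf.energy_contracted \<alpha>" if *: "\<forall>\<alpha>>0. cf.energy_reflected (ennreal \<alpha>)" for \<alpha>
  proof (cases \<alpha>)
    case (real r)
    show ?thesis
    proof (cases "r = 0")
      case True
      have "cf.refl1 0 u v = v" "cf.refl2 0 u v = u" for u v :: "'a \<Rightarrow> real"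
        by (auto simp: cf.refl1_def cf.refl2_def cf.defect_def clamp_abs_def)
      then have "cf.energy_reflected 0" by (simp add: cf.energy_reflected_def)
      then show ?thesis using True real eqv by simp
    next
      case False
      then show ?thesis using * real eqv by simp
    qed
  next
    case top
    then show ?thesis
      by (simp add: cf.energy_contracted_def cf.proj1_def cf.proj2_def cf.defect_def clamp_abs_def)
  qed
  then have E8'': "cond_E8' M E \<longleftrightarrow> (\<forall>\<alpha>. cf.energy_contracted \<alpha>)"
    unfolding E8' using eqv(4) by blast
  show ?thesis
    by (rule all_equivalentI[of _ "\<forall>\<alpha>. cf.energy_contracted \<alpha>"])
      (auto simp: T' J' T J A8 E8 E8'' eqv)
qed

end

theorem theorem4p33:
  fixes M :: "'a measure"
    and E :: "('a \<Rightarrow> real) \<Rightarrow> ereal"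
    and T J :: "real \<Rightarrow> ('a \<Rightarrow> real) \<Rightarrow> ('a \<Rightarrow> real)"
    and A :: "('a \<Rightarrow> real) \<Rightarrow> ('a \<Rightarrow> real) set"
    and Q :: "('a \<Rightarrow> real) \<times> ('a \<Rightarrow> real) \<Rightarrow> ('a \<Rightarrow> real) \<times> ('a \<Rightarrow> real)"
  assumes "sigma_finite_measure M"
    and "countably_generated_measure M"
    and "l2_functional M E"
    and "proper_functional M E"
    and "convex_functional M E"
    and "lsc_functional M E"
    and "semigroup_of M E T"
    and "resolvent_of M E J"
    and A_def: "A = subdifferential M E"
    and Q_def: "Q = metric_projection (l2sum_dist M)
                      (closure_in (l2sum_dist M) (L2 M \<times> L2 M) (op_dom A \<times> op_dom A))"
    and "Q ` C_le M \<subseteq> C_le M"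
    and "\<And>\<alpha>. Q ` C_alpha M \<alpha> \<subseteq> C_alpha M \<alpha>"
  shows "(all_equivalent
           [\<forall>t\<ge>0. cond_M1 M (eff_dom_closure M E) (T t),
            \<forall>t\<ge>0. cond_M1' M (eff_dom_closure M E) (T t),
            cond_A7' M A,
            \<forall>l\<ge>0. cond_M1 M (L2 M) (J l),
            \<forall>l\<ge>0. cond_M1' M (L2 M) (J l),
            cond_E7 M E,
            cond_E7' M E]) \<and>
         (all_equivalent
           [\<forall>t\<ge>0. cond_M2 M (eff_dom_closure M E) (T t),
            \<forall>t\<ge>0. cond_M2' M (eff_dom_closure M E) (T t),
            cond_A8' M A,
            \<forall>l\<ge>0. cond_M2 M (L2 M) (J l),
            \<forall>l\<ge>0. cond_M2' M (L2 M) (J l),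
            cond_E8 M E,
            cond_E8' M E]) \<and>
         (all_equivalent
           [\<forall>t\<ge>0. sub_Markovian M (eff_dom_closure M E) (T t),
            Dirichlet_operator M A,
            \<forall>l\<ge>0. sub_Markovian M (L2 M) (J l),
            Dirichlet_functional M E])"
proof -
  have flow: "energy_flow M E J T" and res: "energy_resolvent M E J"
    by (unfold_locales; fact)+
  note 1 = energy_flow.order_equivalences[OF flow, folded A_def, folded Q_def, OF assms(11)]
  note 2 = energy_flow.sup_norm_equivalences[OF flow, folded A_def, folded Q_def, OF assms(12)]
  note max = energy_resolvent.maximal_monotone_A[OF res, folded A_def]
  have 3: "all_equivalent
           [\<forall>t\<ge>0. sub_Markovian M (eff_dom_closure M E) (T t),
            Dirichlet_operator M A,
            \<forall>l\<ge>0. sub_Markovian M (L2 M) (J l),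
            Dirichlet_functional M E]"
  \<comment> \<open>\<open>max\<close> and the standing assumptions settle maximal monotonicity of
    \<open>A\<close> and properness, convexity and lower semicontinuity of \<open>E\<close>, so each
    item comes down to its order condition and its sup-norm condition.\<close>
  proof (rule all_equivalentI[of _ "cond_E7 M E \<and> cond_E8 M E"])
    have "(\<forall>t\<ge>0. cond_M1 M (eff_dom_closure M E) (T t)) \<longleftrightarrow> cond_E7 M E"
      "(\<forall>l\<ge>0. cond_M1 M (L2 M) (J l)) \<longleftrightarrow> cond_E7 M E" "cond_A7' M A \<longleftrightarrow> cond_E7 M E"
      by (rule all_equivalentD[OF 1]; simp)+
    moreover have "(\<forall>t\<ge>0. cond_M2 M (eff_dom_closure M E) (T t)) \<longleftrightarrow> cond_E8 M E"
      "(\<forall>l\<ge>0. cond_M2 M (L2 M) (J l)) \<longleftrightarrow> cond_E8 M E" "cond_A8' M A \<longleftrightarrow> cond_E8 M E"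
      by (rule all_equivalentD[OF 2]; simp)+
    moreover have "(\<forall>t\<ge>0. sub_Markovian M S (B t)) \<longleftrightarrow>
      (\<forall>t\<ge>0. cond_M1 M S (B t)) \<and> (\<forall>t\<ge>0. cond_M2 M S (B t))" for S and B :: "real \<Rightarrow> _"
      by (auto simp: sub_Markovian_def)
    moreover fix P assume "P \<in> set [\<forall>t\<ge>0. sub_Markovian M (eff_dom_closure M E) (T t),
      Dirichlet_operator M A, \<forall>l\<ge>0. sub_Markovian M (L2 M) (J l), Dirichlet_functional M E]"
    then have "P = (\<forall>t\<ge>0. sub_Markovian M (eff_dom_closure M E) (T t)) \<or> P = Dirichlet_operator M A
      \<or> P = (\<forall>l\<ge>0. sub_Markovian M (L2 M) (J l)) \<or> P = Dirichlet_functional M E"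
      by simp
    ultimately show "P \<longleftrightarrow> cond_E7 M E \<and> cond_E8 M E"
      using max assms(4-6) by (elim disjE) (simp_all add: Dirichlet_operator_def Dirichlet_functional_def)
  qed
  show ?thesis using 1 2 3 by blast
qed

end
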